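(* Let $0<q<1$, $M\in\mathbb N$, $\vec k=(k_1,\dots,k_M)$ with all $k_j>0$, $\lambda,\rho\in\mathbb R$, $v\ne0$, and define $$\omega^v_{\mathrm{AW}}(y,x,\lambda,\rho,q)=\frac{(vq^{2y+|\vec k|+\lambda-\rho+1};q^2)_\infty(v^{-1}q^{2y+|\vec k|+\lambda-\rho+1};q^2)_\infty}{(vq^{-2x-|\vec k|+\lambda-\rho+1};q^2)_\infty(v^{-1}q^{-2x-|\vec k|+\lambda-\rho+1};q^2)_\infty}.$$ If $\lambda>-1$ and $\rho\le-1$, then for all $\xi,\xi'\in X_{d,\rho}$ $$\sum_{\zeta\in X_d}P^v_{\mathrm{AW}}(\zeta,\xi;q)\,P^{v^{-1}}_{\mathrm{AW}}(\zeta,\xi';q)\,W_{\mathsf L}(\zeta)\,\omega^v_{\mathrm{AW}}(|\zeta|,|\xi|,\lambda,\rho,q)=\frac{\delta_{\xi,\xi'}}{W_{\mathsf R}(\xi)}.$$ If $\lambda\le-1$ and $\rho>-1$, then for all $\zeta,\zeta'\in X_{d,\lambda}$ $$\sum_{\xi\in X_d}P^v_{\mathrm{AW}}(\zeta',\xi;q^{-1})\,P^{v^{-1}}_{\mathrm{AW}}(\zeta,\xi;q^{-1})\,W_{\mathsf R}(\xi)\,\omega^v_{\mathrm{AW}}(|\xi|,|\zeta|,\rho,\lambda,q)=\frac{\delta_{\zeta,\zeta'}}{W_{\mathsf L}(\zeta)}.$$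
   Context: Notation: $X_d=\mathbb Z_{\ge0}^M$; $|\eta|=\sum_j\eta_j$; $X_{d,a}=\{\eta\in X_d:2|\eta|+|\vec k|+a<0\}$; $(a;q)_n=\prod_{i=0}^{n-1}(1-aq^i)$ (any base), $(a;q)_\infty=\prod_{i\ge0}(1-aq^i)$ for $0<q<1$; ${}_{4}\varphi_3(a_1,\dots,a_4;b_1,b_2,b_3;q,z)=\sum_{n\ge0}\frac{\prod_i(a_i;q)_n}{\prod_i(b_i;q)_n}\frac{z^n}{(q;q)_n}$, a finite sum over $n\le N$ when an upper parameter is $q^{-N}$. The identities are understood for $v$ for which the denominator of $\omega^v_{\mathrm{AW}}$ is nonzero. Heights: $h^-_0=\lambda$, $h^-_j(\zeta)=\lambda+\sum_{i\le j}(2\zeta_i+k_i)$; $h^+_{M+1}=\rho$, $h^+_j(\xi)=\rho+\sum_{i\ge j}(2\xi_i+k_i)$. For $y,x\in\mathbb Z_{\ge0}$ and any base $q>0$, $q\ne1$: $$p_{\mathrm{AW}}(y,x;\lambda,\rho,v,k;q)=(vq^{\rho+\lambda+k+1};q^2)_x(vq^{-\rho-\lambda-k-1};q^{-2})_y\,{}_4\varphi_3\left(\begin{matrix} q^{-2y},q^{2y+2\lambda+2k},q^{-2x},q^{2x+2\rho+2k} \\ q^{2k},vq^{\rho+\lambda+k+1},v^{-1}q^{\rho+\lambda+k+1}\end{matrix};q^2,q^2\right)$$ (extended by continuity in $v$ where a denominator parameter produces a zero), and $P^v_{\mathrm{AW}}(\zeta,\xi;q)=\prod_{j=1}^Mp_{\mathrm{AW}}(\zeta_j,\xi_j;h^-_{j-1}(\zeta),h^+_{j+1}(\xi),v,k_j;q)$.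 $P^v_{\mathrm{AW}}(\zeta,\xi;q^{-1})$ is obtained by replacing $q$ by $q^{-1}$ everywhere. One-site weight, with case distinction on its argument $a$: $$w_{\mathsf{dyn}}(z;a,k,q)=\frac{1-q^{4z+2a+2k}}{1-q^{2z+2a+2k}}\frac{(q^{2k};q^2)_z}{(q^2;q^2)_z}\frac{(q^{2z+2a+2};q^2)_\infty}{(q^{2z+2a+2k+2};q^2)_\infty}q^{2z(z+a)}\quad\text{if }a>-1,$$ $$w_{\mathsf{dyn}}(z;a,k,q)=\frac{1-q^{4z+2a+2k}}{1-q^{2z+2a+2k}}\frac{(q^{2k};q^2)_z}{(q^2;q^2)_z}\frac{(q^{-2z-2a-2k};q^2)_\infty}{(q^{-2z-2a};q^2)_\infty}q^{-2z(z+a+k)}\quad\text{if }a\le-1,$$ where the first quotient is read as $1$ for $z=0$. The measures are $$W_{\mathsf L}(\zeta)=\prod_{j=1}^Mw_{\mathsf{dyn}}(\zeta_j;h^-_{j-1}(\zeta),k_j,q),\qquad W_{\mathsf R}(\xi)=\prod_{j=1}^Mw_{\mathsf{dyn}}(\xi_j;h^+_{j+1}(\xi),k_j,q).$$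
   Formalization: For ξ=ξ' (ζ=ζ') the value 1/W_R (1/W_L) is claimed only if all heights h⁺_{j+1}(ξ) (h⁻_{j-1}(ζ)) are ≤ -1; it fails otherwise, e.g. M=2, k=(0.1,0.5), ρ=-1.2, ξ=0. In general the value is proved with the a≤-1 form of w_dyn at every site. *)

theory Defs
  imports "HOL-Analysis.Analysis"
begin

definition qpoch :: "'a::comm_ring_1 \<Rightarrow> 'a \<Rightarrow> nat \<Rightarrow> 'a" where
  "qpoch a q n = (\<Prod>i<n. 1 - a * q ^ i)"

definition qpoch_inf :: "'a::real_normed_field \<Rightarrow> 'a \<Rightarrow> 'a" where
  "qpoch_inf a q = (\<Prod>i. 1 - a * q ^ i)"

(* If some upper parameter is q^(-N), all terms with n > N are 0 (also where a lower
   parameter makes the denominator vanish, as x / 0 = 0), so the series is a finite sum. *)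
definition phi43 ::
  "complex \<Rightarrow> complex \<Rightarrow> complex \<Rightarrow> complex \<Rightarrow> complex \<Rightarrow> complex \<Rightarrow> complex \<Rightarrow> complex \<Rightarrow> complex \<Rightarrow> complex" where
  "phi43 a1 a2 a3 a4 b1 b2 b3 q z =
     (\<Sum>n. (qpoch a1 q n * qpoch a2 q n * qpoch a3 q n * qpoch a4 q n)
          / (qpoch b1 q n * qpoch b2 q n * qpoch b3 q n) * (z ^ n / qpoch q q n))"

abbreviation cpw :: "real \<Rightarrow> real \<Rightarrow> complex" where
  "cpw q r \<equiv> complex_of_real (q powr r)"

text \<open>Particle configurations on the sites \<open>1, \<dots>, M\<close>, as extensional functions.\<close>

definition X_d :: "nat \<Rightarrow> (nat \<Rightarrow> nat) set" where
  "X_d M = {1..M} \<rightarrow>\<^sub>E UNIV"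

definition wt :: "nat \<Rightarrow> (nat \<Rightarrow> nat) \<Rightarrow> nat" where
  "wt M \<eta> = (\<Sum>j=1..M. \<eta> j)"

definition ksum :: "nat \<Rightarrow> (nat \<Rightarrow> real) \<Rightarrow> real" where
  "ksum M k = (\<Sum>j=1..M. k j)"

definition X_da :: "nat \<Rightarrow> (nat \<Rightarrow> real) \<Rightarrow> real \<Rightarrow> (nat \<Rightarrow> nat) set" where
  "X_da M k a = {\<eta> \<in> X_d M. 2 * real (wt M \<eta>) + ksum M k + a < 0}"

definition hminus :: "(nat \<Rightarrow> real) \<Rightarrow> real \<Rightarrow> (nat \<Rightarrow> nat) \<Rightarrow> nat \<Rightarrow> real" where
  "hminus k lam \<zeta> j = lam + (\<Sum>i=1..j. 2 * real (\<zeta> i) + k i)"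

definition hplus :: "nat \<Rightarrow> (nat \<Rightarrow> real) \<Rightarrow> real \<Rightarrow> (nat \<Rightarrow> nat) \<Rightarrow> nat \<Rightarrow> real" where
  "hplus M k rho \<xi> j = rho + (\<Sum>i=j..M. 2 * real (\<xi> i) + k i)"

definition p_AW_raw ::
  "nat \<Rightarrow> nat \<Rightarrow> real \<Rightarrow> real \<Rightarrow> complex \<Rightarrow> real \<Rightarrow> real \<Rightarrow> complex" where
  "p_AW_raw y x lam rho v k q =
     qpoch (v * cpw q (rho + lam + k + 1)) (cpw q 2) x
     * qpoch (v * cpw q (- rho - lam - k - 1)) (cpw q (-2)) y
     * phi43 (cpw q (- 2 * real y)) (cpw q (2 * real y + 2 * lam + 2 * k))
             (cpw q (- 2 * real x)) (cpw q (2 * real x + 2 * rho + 2 * k))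
             (cpw q (2 * k)) (v * cpw q (rho + lam + k + 1))
             (inverse v * cpw q (rho + lam + k + 1))
             (cpw q 2) (cpw q 2)"

text \<open>The summation in \<^const>\<open>p_AW_raw\<close> ends at \<open>min y x\<close>. Where one of the two lower
  parameters containing \<open>v\<close> produces a zero denominator within that range, the value is
  the limit in \<open>v\<close>.\<close>

definition p_AW ::
  "nat \<Rightarrow> nat \<Rightarrow> real \<Rightarrow> real \<Rightarrow> complex \<Rightarrow> real \<Rightarrow> real \<Rightarrow> complex" where
  "p_AW y x lam rho v k q =
     (if qpoch (v * cpw q (rho + lam + k + 1)) (cpw q 2) (min y x) = 0
       \<or> qpoch (inverse v * cpw q (rho + lam + k + 1)) (cpw q 2) (min y x) = 0
      then Lim (at v) (\<lambda>u. p_AW_raw y x lam rho u k q)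
      else p_AW_raw y x lam rho v k q)"

definition P_AW ::
  "nat \<Rightarrow> (nat \<Rightarrow> real) \<Rightarrow> real \<Rightarrow> real \<Rightarrow> complex \<Rightarrow> (nat \<Rightarrow> nat) \<Rightarrow> (nat \<Rightarrow> nat) \<Rightarrow> real \<Rightarrow> complex" where
  "P_AW M k lam rho v \<zeta> \<xi> q =
     (\<Prod>j=1..M. p_AW (\<zeta> j) (\<xi> j) (hminus k lam \<zeta> (j - 1)) (hplus M k rho \<xi> (j + 1)) v (k j) q)"

definition w_front :: "nat \<Rightarrow> real \<Rightarrow> real \<Rightarrow> real \<Rightarrow> real" where
  "w_front z a k q =
     (if z = 0 then 1
      else (1 - q powr (4 * real z + 2 * a + 2 * k)) / (1 - q powr (2 * real z + 2 * a + 2 * k)))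
     * (qpoch (q powr (2 * k)) (q powr 2) z / qpoch (q powr 2) (q powr 2) z)"

definition w_dyn_gt :: "nat \<Rightarrow> real \<Rightarrow> real \<Rightarrow> real \<Rightarrow> real" where
  "w_dyn_gt z a k q = w_front z a k q
     * (qpoch_inf (q powr (2 * real z + 2 * a + 2)) (q powr 2)
        / qpoch_inf (q powr (2 * real z + 2 * a + 2 * k + 2)) (q powr 2))
     * q powr (2 * real z * (real z + a))"

definition w_dyn_le :: "nat \<Rightarrow> real \<Rightarrow> real \<Rightarrow> real \<Rightarrow> real" where
  "w_dyn_le z a k q = w_front z a k q
     * (qpoch_inf (q powr (- 2 * real z - 2 * a - 2 * k)) (q powr 2)
        / qpoch_inf (q powr (- 2 * real z - 2 * a)) (q powr 2))
     * q powr (- 2 * real z * (real z + a + k))"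

definition w_dyn :: "nat \<Rightarrow> real \<Rightarrow> real \<Rightarrow> real \<Rightarrow> real" where
  "w_dyn z a k q = (if a > -1 then w_dyn_gt z a k q else w_dyn_le z a k q)"

definition W_L :: "nat \<Rightarrow> (nat \<Rightarrow> real) \<Rightarrow> real \<Rightarrow> real \<Rightarrow> (nat \<Rightarrow> nat) \<Rightarrow> real" where
  "W_L M k lam q \<zeta> = (\<Prod>j=1..M. w_dyn (\<zeta> j) (hminus k lam \<zeta> (j - 1)) (k j) q)"

definition W_R :: "nat \<Rightarrow> (nat \<Rightarrow> real) \<Rightarrow> real \<Rightarrow> real \<Rightarrow> (nat \<Rightarrow> nat) \<Rightarrow> real" where
  "W_R M k rho q \<xi> = (\<Prod>j=1..M. w_dyn (\<xi> j) (hplus M k rho \<xi> (j + 1)) (k j) q)"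

text \<open>Variants of \<^const>\<open>W_L\<close> and \<^const>\<open>W_R\<close> that use the second branch of \<^const>\<open>w_dyn\<close> at
  every site. They differ from \<^const>\<open>W_L\<close>, \<^const>\<open>W_R\<close> only if some height exceeds \<open>-1\<close>.
  This can happen on \<^const>\<open>X_da\<close> even if the boundary height is \<open>\<le> -1\<close>: for example
  \<open>M = 2\<close>, \<open>k\<^sub>1 = 0.1\<close>, \<open>k\<^sub>2 = 0.5\<close>, \<open>\<rho> = -1.2\<close> and \<open>\<xi> = (0, 0)\<close> give \<open>h\<^sup>+\<^sub>2(\<xi>) = -0.7\<close>. The
  squared norm is analytic in the boundary height, so there it is given by these variants,
  and the two branches of \<^const>\<open>w_dyn\<close> do not agree.\<close>

definition W_L_le :: "nat \<Rightarrow> (nat \<Rightarrow> real) \<Rightarrow> real \<Rightarrow> real \<Rightarrow> (nat \<Rightarrow> nat) \<Rightarrow> real" where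
  "W_L_le M k lam q \<zeta> = (\<Prod>j=1..M. w_dyn_le (\<zeta> j) (hminus k lam \<zeta> (j - 1)) (k j) q)"

definition W_R_le :: "nat \<Rightarrow> (nat \<Rightarrow> real) \<Rightarrow> real \<Rightarrow> real \<Rightarrow> (nat \<Rightarrow> nat) \<Rightarrow> real" where
  "W_R_le M k rho q \<xi> = (\<Prod>j=1..M. w_dyn_le (\<xi> j) (hplus M k rho \<xi> (j + 1)) (k j) q)"

definition omega_num :: "nat \<Rightarrow> real \<Rightarrow> real \<Rightarrow> real \<Rightarrow> complex \<Rightarrow> real \<Rightarrow> complex" where
  "omega_num y lam rho K v q =
     qpoch_inf (v * cpw q (2 * real y + K + lam - rho + 1)) (cpw q 2)
     * qpoch_inf (inverse v * cpw q (2 * real y + K + lam - rho + 1)) (cpw q 2)"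

definition omega_den :: "nat \<Rightarrow> real \<Rightarrow> real \<Rightarrow> real \<Rightarrow> complex \<Rightarrow> real \<Rightarrow> complex" where
  "omega_den x lam rho K v q =
     qpoch_inf (v * cpw q (- 2 * real x - K + lam - rho + 1)) (cpw q 2)
     * qpoch_inf (inverse v * cpw q (- 2 * real x - K + lam - rho + 1)) (cpw q 2)"

text \<open>The parameter \<open>K\<close> is the sum of the \<open>k\<^sub>j\<close>.\<close>

definition omega_AW :: "nat \<Rightarrow> nat \<Rightarrow> real \<Rightarrow> real \<Rightarrow> real \<Rightarrow> complex \<Rightarrow> real \<Rightarrow> complex" where
  "omega_AW y x lam rho K v q = omega_num y lam rho K v q / omega_den x lam rho K v q"

end

theory Submission
  imports Defs
begin

text \<open>
  Put \<open>Q = q\<^sup>2\<close>. On one site the claim is the orthogonality, for an infinite mass distribution, of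
  finitely many functions of \<open>q\<close>-Racah type. The backward and forward shift operators, joined by
  summation by parts, lower both degrees by one while multiplying all parameters by \<open>Q\<close>; the
  boundary terms vanish because \<open>2x + k + \<rho> < 0\<close>. So everything reduces to the total mass, which is
  the nonterminating very-well-poised \<open>\<^sub>6\<phi>\<^sub>5\<close> sum. That sum follows from a telescoping relation
  between the parameters \<open>a\<close> and \<open>aQ\<close>, iterated until \<open>a Q^N\<close> tends to \<open>0\<close>.

  For several sites one sums over the last site first: the value of that sum turns the numerator of
  the weight \<open>\<omega>\<close> into the one for the remaining sites, with \<open>\<rho>\<close> replaced by the next height, so the
  claim follows by induction. The second family of relations is the first one for the reversed
  lattice, because the one-site function with base \<open>1/q\<close> is the one with base \<open>q\<close> and the roles of the
  two sides exchanged.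
\<close>

section \<open>q-shifted factorials\<close>

text \<open>Dictionary: Q = q^2, a = q^(2 lam + 2 k), b = q^(2 k), g = q^(2 rho + 2 k), while c and
  d are q^(rho + lam + k + 1) times v and 1/v. The balancing relation a g Q = b c d carries the
  backward shift, the duality under inversion of Q and the convergence: the argument a Q/(b c d) of
  the 6phi5 is 1/g. Each shift multiplies g by Q^2, and the inequalities for x and x' together give
  |g Q^(x+x')| > 1. Replacing v by 1/v exchanges c and d. The second function must have them
  exchanged, because the adjoint of the backward shift is the forward shift with c in place of d.
  Two obstacles shape the part on several sites. Numerator and denominator of omega are kept apart
  until the end, since the denominator met at one site is the numerator for the rest. And iterating
  the sum requires summability of the whole family, hence bounds uniform in the heights, which are
  unbounded in zeta.\<close>

lemma qpoch_0 [simp]: "qpoch a q 0 = 1"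
  by (simp add: qpoch_def)

lemma qpoch_Suc: "qpoch a q (Suc n) = qpoch a q n * (1 - a * q ^ n)"
  by (simp add: qpoch_def)

lemma qpoch_add: "qpoch a q (m + n) = qpoch a q m * qpoch (a * q ^ m) q n"
  by (induction n) (simp_all add: qpoch_Suc power_add mult.assoc)

lemma qpoch_Suc_left: "qpoch a q (Suc n) = (1 - a) * qpoch (a * q) q n"
  using qpoch_add[of a q 1 n] by (simp add: qpoch_Suc)

lemma qpoch_eq_0: "i < n \<Longrightarrow> a * q ^ i = 1 \<Longrightarrow> qpoch a q n = 0"
  unfolding qpoch_def by (rule prod_zero) auto

lemma qpoch_nonzero: "(\<And>i. i < n \<Longrightarrow> a * q ^ i \<noteq> 1) \<Longrightarrow> qpoch (a::'a::field) q n \<noteq> 0"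
  by (auto simp: qpoch_def)

lemma qpoch_inverse_power_eq_0:
  fixes q :: "'a::field"
  assumes "q \<noteq> 0" "m < n"
  shows "qpoch (inverse q ^ m) q n = 0"
  using assms by (intro qpoch_eq_0[of m]) (simp_all add: power_mult_distrib[symmetric] del: power_inverse)

lemma of_real_qpoch: "of_real (qpoch a q n) = qpoch (of_real a :: 'a::{real_algebra_1,comm_ring_1}) (of_real q) n"
  by (simp add: qpoch_def)

section \<open>Uniform bounds and infinite products\<close>

lemma norm_qpoch_le:
  fixes a q :: "'a::real_normed_field"
  assumes "norm q < 1"
  shows "norm (qpoch a q n) \<le> exp (norm a / (1 - norm q))"
proof -
  have "norm (qpoch a q n) = (\<Prod>i<n. norm (1 - a * q ^ i))"
    by (simp add: qpoch_def prod_norm)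
  also have "\<dots> \<le> (\<Prod>i<n. exp (norm a * norm q ^ i))"
  proof (intro prod_mono conjI)
    fix i
    have "norm (1 - a * q ^ i) \<le> 1 + norm a * norm q ^ i"
      using norm_triangle_ineq4[of 1 "a * q ^ i"] by (simp add: norm_mult norm_power)
    also have "\<dots> \<le> exp (norm a * norm q ^ i)" by (rule exp_ge_add_one_self)
    finally show "norm (1 - a * q ^ i) \<le> exp (norm a * norm q ^ i)" .
  qed simp
  also have "\<dots> = exp (norm a * (\<Sum>i<n. norm q ^ i))"
    by (simp add: exp_sum sum_distrib_left)
  also have "\<dots> \<le> exp (norm a * (1 / (1 - norm q)))"
  proof -
    have "(\<Sum>i<n. norm q ^ i) \<le> (\<Sum>i. norm q ^ i)"
      using assms by (intro sum_le_suminf summable_geometric) auto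
    also have "\<dots> = 1 / (1 - norm q)" using assms by (simp add: suminf_geometric)
    finally show ?thesis
      unfolding exp_le_cancel_iff by (intro mult_left_mono) auto
  qed
  finally show ?thesis by simp
qed

lemma convergent_prod_qpoch:
  fixes a q :: "'a::{real_normed_field,banach}"
  assumes "norm q < 1"
  shows "convergent_prod (\<lambda>i. 1 - a * q ^ i)"
proof -
  have "summable (\<lambda>i. norm a * norm q ^ i)"
    using assms by (intro summable_mult summable_geometric) auto
  hence "summable (\<lambda>i. norm ((1 - a * q ^ i) - 1))" by (simp add: norm_mult norm_power)
  thus ?thesis
    by (intro abs_convergent_prod_imp_convergent_prod summable_imp_abs_convergent_prod)
qed

lemma qpoch_tendsto_inf:
  fixes a q :: "'a::{real_normed_field,banach}"
  assumes "norm q < 1"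
  shows "qpoch a q \<longlonglongrightarrow> qpoch_inf a q"
  using convergent_prod_LIMSEQ[OF convergent_prod_qpoch[OF assms, of a]]
  unfolding qpoch_def[abs_def] qpoch_inf_def by (subst filterlim_sequentially_Suc[symmetric]) (simp add: lessThan_Suc_atMost)

lemma qpoch_inf_split:
  fixes a q :: "'a::{real_normed_field,banach}"
  assumes "norm q < 1"
  shows "qpoch_inf a q = qpoch a q n * qpoch_inf (a * q ^ n) q"
proof (rule LIMSEQ_unique)
  show "(\<lambda>m. qpoch a q (m + n)) \<longlonglongrightarrow> qpoch_inf a q"
    by (rule LIMSEQ_ignore_initial_segment[OF qpoch_tendsto_inf[OF assms]])
  have "(\<lambda>m. qpoch a q n * qpoch (a * q ^ n) q m) \<longlonglongrightarrow> qpoch a q n * qpoch_inf (a * q ^ n) q"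
    by (intro tendsto_intros qpoch_tendsto_inf assms)
  thus "(\<lambda>m. qpoch a q (m + n)) \<longlonglongrightarrow> qpoch a q n * qpoch_inf (a * q ^ n) q"
    by (subst add.commute) (simp add: qpoch_add)
qed

lemma qpoch_inf_Suc:
  fixes a q :: "'a::{real_normed_field,banach}"
  assumes "norm q < 1"
  shows "qpoch_inf a q = (1 - a) * qpoch_inf (a * q) q"
  using qpoch_inf_split[OF assms, of a 1] by (simp add: qpoch_Suc)

lemma qpoch_inf_nonzero:
  fixes a q :: "'a::{real_normed_field,banach}"
  assumes "norm q < 1" "\<And>i. a * q ^ i \<noteq> 1"
  shows "qpoch_inf a q \<noteq> 0"
  unfolding qpoch_inf_def using assms
  by (intro prodinf_nonzero convergent_prod_qpoch) auto

lemma norm_qpoch_inf_le: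
  fixes a q :: "'a::{real_normed_field,banach}"
  assumes "norm q < 1"
  shows "norm (qpoch_inf a q) \<le> exp (norm a / (1 - norm q))"
  using norm_qpoch_le[OF assms]
  by (intro LIMSEQ_le_const2[OF tendsto_norm[OF qpoch_tendsto_inf[OF assms]]] exI[of _ 0]) simp

lemma of_real_qpoch_inf:
  assumes "\<bar>q\<bar> < 1"
  shows "complex_of_real (qpoch_inf a q) = qpoch_inf (of_real a) (of_real q)"
proof (rule LIMSEQ_unique)
  show "(\<lambda>n. complex_of_real (qpoch a q n)) \<longlonglongrightarrow> complex_of_real (qpoch_inf a q)"
    using assms by (intro tendsto_of_real qpoch_tendsto_inf) auto
  show "(\<lambda>n. complex_of_real (qpoch a q n)) \<longlonglongrightarrow> qpoch_inf (of_real a) (of_real q)"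
    using assms unfolding of_real_qpoch by (intro qpoch_tendsto_inf) auto
qed

text \<open>Passing from a, q to -|a|, |q| makes every term of the expanded product nonnegative, so
  the distance from 1 is controlled by the bound for that product. The estimate vanishes with a and
  is free of n, hence survives in the infinite product.\<close>

lemma norm_qpoch_minus_1_le:
  fixes a q :: "'a::real_normed_field"
  assumes "norm q < 1"
  shows "norm (qpoch a q n - 1) \<le> exp (norm a / (1 - norm q)) - 1"
proof -
  have "norm (qpoch a q n - 1) \<le> (\<Prod>i<n. 1 + norm (a * q ^ i)) - 1"
    using norm_prod_minus1_le_prod_minus1[of "\<lambda>i. - (a * q ^ i)" "{..<n}"]
    by (simp add: qpoch_def)
  also have "(\<Prod>i<n. 1 + norm (a * q ^ i)) = norm (qpoch (- norm a) (norm q) n)"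
    by (simp add: qpoch_def norm_mult norm_power abs_prod)
  also have "\<dots> \<le> exp (norm a / (1 - norm q))"
    using norm_qpoch_le[of "norm q" "- norm a" n] assms by simp
  finally show ?thesis by simp
qed

lemma qpoch_inf_tendsto_1:
  fixes q :: "'a::{real_normed_field,banach}"
  assumes "norm q < 1" "(f \<longlongrightarrow> 0) F"
  shows "((\<lambda>x. qpoch_inf (f x) q) \<longlongrightarrow> 1) F"
proof -
  have "norm (qpoch_inf (f x) q - 1) \<le> exp (norm (f x) / (1 - norm q)) - 1" for x
    using norm_qpoch_minus_1_le[OF assms(1)]
    by (intro LIMSEQ_le_const2[OF tendsto_norm[OF tendsto_diff[OF qpoch_tendsto_inf[OF assms(1)] tendsto_const]]] exI[of _ 0]) simp
  moreover have "((\<lambda>x. exp (norm (f x) / (1 - norm q)) - 1) \<longlongrightarrow> 0) F"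
    using tendsto_diff[OF tendsto_exp[OF tendsto_divide[OF tendsto_norm[OF assms(2)] tendsto_const[of "1 - norm q"]]] tendsto_const[of 1]]
      assms(1) by simp
  ultimately have "((\<lambda>x. qpoch_inf (f x) q - 1) \<longlongrightarrow> 0) F"
    by (rule_tac Lim_null_comparison[OF always_eventually]) auto
  thus ?thesis by (rule LIM_zero_cancel)
qed

lemma qpoch_inf_tail_tendsto_1:
  fixes a q :: "'a::{real_normed_field,banach}"
  assumes "norm q < 1"
  shows "(\<lambda>n. qpoch_inf (a * q ^ n) q) \<longlonglongrightarrow> 1"
  using assms by (intro qpoch_inf_tendsto_1 tendsto_mult_right_zero LIMSEQ_power_zero)

section \<open>Regularised q-Racah functions and their shift operators\<close>

definition racah_coeff :: "'a::field \<Rightarrow> 'a \<Rightarrow> 'a \<Rightarrow> nat \<Rightarrow> nat \<Rightarrow> 'a" where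
  "racah_coeff Q b g x n =
     qpoch (inverse Q ^ x) Q n * qpoch (g * Q ^ x) Q n * Q ^ n / (qpoch b Q n * qpoch Q Q n)"

text \<open>All dependence on y is gathered here, so a difference operator in y acts on a single
  known family. The last factor is what is left of (d;Q)_y after division by (d;Q)_n; for y < n the
  subtraction truncates, but then the first factor is zero.\<close>

definition racah_basis :: "'a::field \<Rightarrow> 'a \<Rightarrow> 'a \<Rightarrow> nat \<Rightarrow> nat \<Rightarrow> 'a" where
  "racah_basis Q a d n y =
     qpoch (inverse Q ^ y) Q n * qpoch (a * Q ^ y) Q n * qpoch (d * Q ^ n) Q (y - n)"

text \<open>
  The terminating \<open>\<^sub>4\<phi>\<^sub>3\<close> with upper parameters \<open>Q^-y, a Q^y, Q^-x, g Q^x\<close> and lower parameters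
  \<open>b, c, d\<close>, multiplied by \<open>(c;Q)\<^sub>x (d;Q)\<^sub>y\<close>. The product absorbs the lower parameters \<open>c\<close> and
  \<open>d\<close>, so nothing degenerates where one of them produces a zero.
\<close>

definition racah :: "'a::field \<Rightarrow> 'a \<Rightarrow> 'a \<Rightarrow> 'a \<Rightarrow> 'a \<Rightarrow> 'a \<Rightarrow> nat \<Rightarrow> nat \<Rightarrow> 'a" where
  "racah Q a b g c d x y =
     (\<Sum>n\<le>x. racah_coeff Q b g x n * qpoch (c * Q ^ n) Q (x - n) * racah_basis Q a d n y)"

lemma racah_coeff_0 [simp]: "racah_coeff Q b g x 0 = 1"
  by (simp add: racah_coeff_def)

lemma racah_coeff_eq_0: "Q \<noteq> 0 \<Longrightarrow> x < n \<Longrightarrow> racah_coeff Q b g x n = 0"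
  by (simp add: racah_coeff_def qpoch_inverse_power_eq_0)

lemma racah_basis_0: "racah_basis Q a d 0 y = qpoch d Q y"
  by (simp add: racah_basis_def)

lemma racah_basis_eq_0: "Q \<noteq> 0 \<Longrightarrow> y < n \<Longrightarrow> racah_basis Q a d n y = 0"
  by (simp add: racah_basis_def qpoch_inverse_power_eq_0)

lemma qpoch_inverse_power_Suc:
  fixes Q :: "'a::field"
  assumes "Q \<noteq> 0"
  shows "qpoch (inverse Q ^ Suc y) Q (Suc m) = (1 - inverse Q ^ Suc y) * qpoch (inverse Q ^ y) Q m"
proof -
  have "inverse Q ^ Suc y * Q = inverse Q ^ y"
    using assms by (simp add: mult.commute[of _ Q] flip: mult.assoc)
  thus ?thesis by (simp only: qpoch_Suc_left)
qed

text \<open>Peel the first factor off each factorial: Q^-(x+1) becomes Q^-x, and g Q^(x+1) becomes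
  (g Q^2) Q^x. The factor 1 - Q^(m+1) stays on the left because \<open>racah_basis_forward\<close>
  supplies it.\<close>

lemma racah_coeff_Suc_Suc:
  fixes Q :: "'a::field"
  assumes "Q \<noteq> 0" "Q ^ Suc m \<noteq> 1"
  shows "racah_coeff Q b g (Suc x) (Suc m) * (1 - Q ^ Suc m) =
    (1 - inverse Q ^ Suc x) * (1 - g * Q ^ Suc x) * Q / (1 - b) * racah_coeff Q (b * Q) (g * Q\<^sup>2) x m"
proof -
  note 1 = qpoch_inverse_power_Suc[OF assms(1), of x m]
  have 2: "qpoch (g * Q ^ Suc x) Q (Suc m) = (1 - g * Q ^ Suc x) * qpoch (g * Q\<^sup>2 * Q ^ x) Q m"
    by (subst qpoch_Suc_left) (simp add: power2_eq_square mult_ac)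
  have 3: "qpoch Q Q (Suc m) = qpoch Q Q m * (1 - Q ^ Suc m)"
    by (simp add: qpoch_Suc)
  have 4: "1 - Q ^ Suc m \<noteq> 0" using assms(2) by simp
  show ?thesis unfolding racah_coeff_def 1 2 3 qpoch_Suc_left[of b Q m] power_Suc[of Q m]
    using 4 by simp
qed

lemma racah_coeff_Suc:
  "racah_coeff Q b g x (Suc m) = racah_coeff Q b g x m
     * ((1 - inverse Q ^ x * Q ^ m) * (1 - g * Q ^ x * Q ^ m) * Q / ((1 - b * Q ^ m) * (1 - Q ^ Suc m)))"
  by (simp add: racah_coeff_def qpoch_Suc mult_ac)

lemma qpoch_mult_power_Suc:
  "qpoch (a * Q ^ y) Q (Suc m) = (1 - a * Q ^ y) * qpoch (a * Q * Q ^ y) Q m"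
  by (subst qpoch_Suc_left) (simp add: mult_ac)

text \<open>The factor 1 - d Q^y completes the d-product at y to the one at y + 1. Both terms then
  share the factor \<open>E * D\<close>, and what remains is a rational identity in Q^y and
  Q^m.\<close>

lemma racah_basis_forward:
  fixes Q :: "'a::field"
  assumes "Q \<noteq> 0"
  shows "(1 - d * Q ^ y) * racah_basis Q a d (Suc m) y - racah_basis Q a d (Suc m) (Suc y) =
    inverse Q ^ Suc y * (1 - Q ^ Suc m) * (1 - a * Q ^ (2 * y + 1)) * racah_basis Q (a * Q) (d * Q) m y"
proof (cases "m \<le> y")
  case False
  thus ?thesis using assms by (simp add: racah_basis_eq_0)
next
  case True
  define D where "D = qpoch (d * Q ^ Suc m) Q (y - m)"
  define E where "E = qpoch (inverse Q ^ y) Q m * qpoch (a * Q * Q ^ y) Q m"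
  have D: "(1 - d * Q ^ y) * racah_basis Q a d (Suc m) y
      = E * (1 - inverse Q ^ y * Q ^ m) * (1 - a * Q ^ y) * D"
  \<comment> \<open>For m = y the length y - Suc m truncates to 0 and no d-product is completed, but
    then 1 - Q^(m-y) makes both sides zero.\<close>
  proof (cases "m = y")
    case True
    hence "inverse Q ^ y * Q ^ m = 1" using assms by (simp add: power_inverse)
    thus ?thesis using True by (simp add: racah_basis_def qpoch_Suc)
  next
    case False
    then obtain j where j: "y = m + Suc j" using True less_imp_Suc_add[of m y] by auto
    have "D = qpoch (d * Q ^ Suc m) Q j * (1 - d * Q ^ y)"
      by (simp add: D_def j qpoch_Suc power_add mult_ac)
    moreover have "y - Suc m = j" by (simp add: j)
    ultimately show ?thesis
      unfolding racah_basis_def E_def qpoch_mult_power_Suc qpoch_Suc[of "inverse Q ^ y"] by simp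
  qed
  have "racah_basis Q a d (Suc m) (Suc y) = E * (1 - inverse Q ^ Suc y) * (1 - a * Q * Q ^ y * Q ^ m) * D"
    unfolding racah_basis_def qpoch_inverse_power_Suc[OF assms] E_def D_def
    by (simp add: qpoch_Suc mult_ac)
  moreover have "racah_basis Q (a * Q) (d * Q) m y = E * D"
    by (simp add: racah_basis_def E_def D_def mult_ac)
  moreover have "((1 - inverse Q ^ y * Q ^ m) * (1 - a * Q ^ y) - (1 - inverse Q ^ Suc y) * (1 - a * Q * Q ^ y * Q ^ m)) * (E * D)
      = inverse Q ^ Suc y * (1 - Q ^ Suc m) * (1 - a * Q ^ (2 * y + 1)) * (E * D)"
  proof -
    have "(1 - inverse Y * P) * (1 - a * Y) - (1 - inverse (Q * Y)) * (1 - a * Q * Y * P)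
      = inverse (Q * Y) * (1 - Q * P) * (1 - a * (Q * (Y * Y)))" if "Y \<noteq> 0" for P Y :: 'a
      using assms that by (simp add: divide_simps) algebra
    from this[of "Q ^ y" "Q ^ m"] show ?thesis
      using assms by (simp add: power_inverse mult_2 power_add)
  qed
  moreover have "E * A * A' * D - E * B * B' * D = (A * A' - B * B') * (E * D)" for A A' B B'
    by (simp add: algebra_simps)
  ultimately show ?thesis unfolding D by simp
qed

text \<open>The operator annihilates (d;Q)_y, the basis function of index 0, and lowers every other
  index by one; this is why the degree drops.\<close>

lemma racah_forward:
  fixes Q :: "'a::field"
  assumes "Q \<noteq> 0" "\<And>m. Q ^ Suc m \<noteq> 1"
  shows "(1 - d * Q ^ y) * racah Q a b g c d (Suc x) y - racah Q a b g c d (Suc x) (Suc y) =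
    inverse Q ^ y * (1 - a * Q ^ (2 * y + 1)) * ((1 - inverse Q ^ Suc x) * (1 - g * Q ^ Suc x) / (1 - b))
      * racah Q (a * Q) (b * Q) (g * Q\<^sup>2) (c * Q) (d * Q) x y"
proof -
  define F where "F = (\<lambda>n. racah_coeff Q b g (Suc x) n * qpoch (c * Q ^ n) Q (Suc x - n)
     * ((1 - d * Q ^ y) * racah_basis Q a d n y - racah_basis Q a d n (Suc y)))"
  have "(1 - d * Q ^ y) * racah Q a b g c d (Suc x) y - racah Q a b g c d (Suc x) (Suc y) = (\<Sum>n\<le>Suc x. F n)"
    unfolding racah_def sum_distrib_left sum_subtractf[symmetric] F_def
    by (intro sum.cong refl) (simp add: algebra_simps)
  also have "\<dots> = (\<Sum>n\<le>x. F (Suc n))"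
    by (subst sum.atMost_Suc_shift) (simp add: F_def racah_basis_0 qpoch_Suc)
  also have "\<dots> = (\<Sum>n\<le>x. inverse Q ^ y * (1 - a * Q ^ (2 * y + 1)) * ((1 - inverse Q ^ Suc x) * (1 - g * Q ^ Suc x) / (1 - b))
      * (racah_coeff Q (b * Q) (g * Q\<^sup>2) x n * qpoch (c * Q * Q ^ n) Q (x - n) * racah_basis Q (a * Q) (d * Q) n y))"
  proof (intro sum.cong refl)
    fix m
    define R B where "R = racah_coeff Q (b * Q) (g * Q\<^sup>2) x m" and "B = racah_basis Q (a * Q) (d * Q) m y"
    define C where "C = qpoch (c * Q * Q ^ m) Q (x - m)"
    have "F (Suc m) = (racah_coeff Q b g (Suc x) (Suc m) * (1 - Q ^ Suc m)) * C
        * (inverse Q ^ Suc y * (1 - a * Q ^ (2 * y + 1)) * B)"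
      unfolding F_def racah_basis_forward[OF assms(1)] by (simp add: B_def C_def mult_ac)
    also have "\<dots> = (1 - inverse Q ^ Suc x) * (1 - g * Q ^ Suc x) * Q / (1 - b) * R * C
        * (inverse Q ^ Suc y * (1 - a * Q ^ (2 * y + 1)) * B)"
      unfolding racah_coeff_Suc_Suc[OF assms] R_def ..
    also have "\<dots> = inverse Q ^ y * (1 - a * Q ^ (2 * y + 1)) * ((1 - inverse Q ^ Suc x) * (1 - g * Q ^ Suc x) / (1 - b)) * (R * C * B)"
      using assms(1) by simp
    finally show "F (Suc m) = inverse Q ^ y * (1 - a * Q ^ (2 * y + 1)) * ((1 - inverse Q ^ Suc x) * (1 - g * Q ^ Suc x) / (1 - b))
      * (racah_coeff Q (b * Q) (g * Q\<^sup>2) x m * qpoch (c * Q * Q ^ m) Q (x - m) * racah_basis Q (a * Q) (d * Q) m y)"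
      by (simp add: R_def B_def C_def)
  qed
  finally show ?thesis by (simp add: racah_def sum_distrib_left)
qed

text \<open>With P = Q^n, Y = Q^y and G = g Q, this is what remains of the backward shift of one
  basis function once the common factorials are divided out. The relation a G = b c d is what lets
  the coefficient of the raised function factor.\<close>

lemma backward_key:
  fixes a b c d P Y G :: "'a::field"
  assumes "a \<noteq> 0" "P \<noteq> 0" "Y \<noteq> 0" "a * G = b * c * d"
  shows "(1 - c * Y) * (1 - b * Y) * (1 - a * Y * P) * (1 - d * Y)
      + (Y - P) * ((b - a * Y) * (c - a * Y) * (d - a * Y) / a)
    = Y * (1 - a * Y\<^sup>2) * ((1 - b * P) * (1 - c * P) / P * (1 - d * P)
       - (1 - G * P) / P * ((1 - P / Y) * (1 - a * Y * P)))"
proof -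
  have G: "G = b * c * d / a" using assms by (simp add: field_simps)
  show ?thesis unfolding G using assms(1-3)
    by (simp add: divide_simps) algebra
qed

text \<open>Applied to the family with shifted parameters, the operator produces only the indices n
  and n + 1 of the unshifted family, so it raises the degree by one. The truncated y - 1 at y = 0 is
  harmless, as its coefficient 1 - Q^y is zero there.\<close>

lemma racah_basis_backward:
  fixes Q :: "'a::field"
  assumes "Q \<noteq> 0" "a \<noteq> 0" "a * g * Q = b * c * d"
  shows "(1 - c * Q ^ y) * (1 - b * Q ^ y) * (1 - a * Q ^ y) * racah_basis Q (a * Q) (d * Q) n y
      - (1 - Q ^ y) * ((b - a * Q ^ y) * (c - a * Q ^ y) * (d - a * Q ^ y) / a) * racah_basis Q (a * Q) (d * Q) n (y - 1)
    = Q ^ y * (1 - a * (Q ^ y)\<^sup>2) * ((1 - b * Q ^ n) * (1 - c * Q ^ n) / Q ^ n * racah_basis Q a d n y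
       - (1 - g * Q * Q ^ n) / Q ^ n * racah_basis Q a d (Suc n) y)"
proof -
  note key = backward_key[of a "Q ^ n" "Q ^ y" "g * Q" b c d]
  \<comment> \<open>Outside the generic range y > n some lengths truncate: for y < n everything
    vanishes, and for y = n only the function of index n at y survives on each side.\<close>
  consider "y < n" | "y = n" | j where "y = n + Suc j"
    by (metis less_imp_Suc_add linorder_neqE_nat add_Suc_right)
  thus ?thesis
  proof cases
    case 1
    thus ?thesis using assms by (simp add: racah_basis_eq_0)
  next
    case 2
    define E where "E = qpoch (inverse Q ^ n) Q n * qpoch (a * Q ^ n) Q n"
    have K: "(1 - c * Q ^ n) * (1 - b * Q ^ n) * (1 - a * Q ^ n * Q ^ n)
       = Q ^ n * (1 - a * (Q ^ n)\<^sup>2) * ((1 - b * Q ^ n) * (1 - c * Q ^ n) / Q ^ n)"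
      using assms by (simp add: power2_eq_square mult_ac)
    have "(1 - a * Q ^ n) * racah_basis Q (a * Q) (d * Q) n n = (1 - a * Q ^ n * Q ^ n) * E"
      using qpoch_mult_power_Suc[of a Q n n] by (simp add: racah_basis_def E_def qpoch_Suc mult_ac)
    hence "(1 - c * Q ^ n) * (1 - b * Q ^ n) * (1 - a * Q ^ n) * racah_basis Q (a * Q) (d * Q) n n
       = Q ^ n * (1 - a * (Q ^ n)\<^sup>2) * ((1 - b * Q ^ n) * (1 - c * Q ^ n) / Q ^ n) * E"
      unfolding K[symmetric] by (simp add: mult.assoc)
    moreover have "racah_basis Q a d n n = E" "racah_basis Q a d (Suc n) n = 0"
      using assms by (simp_all add: racah_basis_eq_0) (simp add: racah_basis_def E_def)
    moreover have "(1 - Q ^ n) * racah_basis Q (a * Q) (d * Q) n (n - 1) = 0"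
      using assms(1) by (cases n) (simp_all add: racah_basis_eq_0)
    ultimately show ?thesis unfolding 2 using assms(1) by (auto simp: mult.assoc)
  next
    case 3
    define E where "E = qpoch (inverse Q ^ y) Q n * qpoch (a * Q ^ y) Q n * qpoch (d * Q * Q ^ n) Q j"
    have Sn: "Suc (y - 1) = y" using 3 by simp
    have 1: "(1 - a * Q ^ y) * racah_basis Q (a * Q) (d * Q) n y = (1 - a * Q ^ y * Q ^ n) * (1 - d * Q ^ y) * E"
      using qpoch_mult_power_Suc[of a Q y n]
      by (simp add: racah_basis_def E_def 3 qpoch_Suc power_add mult_ac)
    \<comment> \<open>Obtained by splitting (Q^-y;Q)_(n+1) once at its last and once at its first
      factor.\<close>
    have 2: "(1 - Q ^ y) * racah_basis Q (a * Q) (d * Q) n (y - 1) = - ((Q ^ y - Q ^ n) * E)"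
    proof -
      have "qpoch (inverse Q ^ y) Q n * (1 - inverse Q ^ y * Q ^ n) = (1 - inverse Q ^ y) * qpoch (inverse Q ^ (y - 1)) Q n"
        using qpoch_inverse_power_Suc[OF assms(1), of "y - 1" n] unfolding Sn by (simp add: qpoch_Suc)
      hence "Q ^ y * (1 - inverse Q ^ y) * qpoch (inverse Q ^ (y - 1)) Q n = Q ^ y * (1 - inverse Q ^ y * Q ^ n) * qpoch (inverse Q ^ y) Q n"
        by (simp add: mult_ac)
      hence "(Q ^ y - 1) * qpoch (inverse Q ^ (y - 1)) Q n = (Q ^ y - Q ^ n) * qpoch (inverse Q ^ y) Q n"
        using assms(1) by (simp add: right_diff_distrib power_inverse flip: mult.assoc)
      moreover have "a * Q * Q ^ (y - 1) = a * Q ^ y" using Sn by (metis mult.assoc power_Suc)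
      moreover have "y - 1 - n = j" using 3 by simp
      ultimately have "(Q ^ y - 1) * racah_basis Q (a * Q) (d * Q) n (y - 1) = (Q ^ y - Q ^ n) * E"
        unfolding racah_basis_def E_def by (simp only: mult.assoc[symmetric])
      thus ?thesis by (simp add: algebra_simps)
    qed
    have 4: "racah_basis Q a d n y = (1 - d * Q ^ n) * E"
    proof -
      have "qpoch (d * Q ^ n) Q (Suc j) = (1 - d * Q ^ n) * qpoch (d * Q * Q ^ n) Q j"
        by (rule qpoch_mult_power_Suc)
      thus ?thesis by (simp add: racah_basis_def E_def 3)
    qed
    have 5: "racah_basis Q a d (Suc n) y = (1 - Q ^ n / Q ^ y) * (1 - a * Q ^ y * Q ^ n) * E"
      by (simp add: racah_basis_def E_def 3 qpoch_Suc power_inverse divide_inverse mult_ac)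
    have "((1 - c * Q ^ y) * (1 - b * Q ^ y)) * ((1 - a * Q ^ y) * racah_basis Q (a * Q) (d * Q) n y)
      - ((1 - Q ^ y) * racah_basis Q (a * Q) (d * Q) n (y - 1)) * ((b - a * Q ^ y) * (c - a * Q ^ y) * (d - a * Q ^ y) / a)
     = ((1 - c * Q ^ y) * (1 - b * Q ^ y) * (1 - a * Q ^ y * Q ^ n) * (1 - d * Q ^ y)
      + (Q ^ y - Q ^ n) * ((b - a * Q ^ y) * (c - a * Q ^ y) * (d - a * Q ^ y) / a)) * E"
    proof -
      have "A * (t * u * E) - (- (w * E)) * K = (A * t * u + w * K) * E" for A t u w K
        by (simp add: algebra_simps)
      thus ?thesis unfolding 1 2 .
    qed
    also have "\<dots> = Q ^ y * (1 - a * (Q ^ y)\<^sup>2) * ((1 - b * Q ^ n) * (1 - c * Q ^ n) / Q ^ n * (1 - d * Q ^ n)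
       - (1 - g * Q * Q ^ n) / Q ^ n * ((1 - Q ^ n / Q ^ y) * (1 - a * Q ^ y * Q ^ n))) * E"
      using assms by (subst key) (simp_all add: mult_ac)
    also have "\<dots> = Q ^ y * (1 - a * (Q ^ y)\<^sup>2) * ((1 - b * Q ^ n) * (1 - c * Q ^ n) / Q ^ n * ((1 - d * Q ^ n) * E)
       - (1 - g * Q * Q ^ n) / Q ^ n * ((1 - Q ^ n / Q ^ y) * (1 - a * Q ^ y * Q ^ n) * E))"
    proof -
      have "V * (r * s - t * (u * w)) * E = V * (r * (s * E) - t * (u * w * E))" for V r s t u w
        by (simp add: algebra_simps)
      thus ?thesis .
    qed
    finally show ?thesis unfolding 4 5 by (simp only: mult.assoc mult.left_commute mult.commute)
  qed
qed

text \<open>In the image of the backward shift the basis function of index m + 1 arises from term m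
  + 1, which keeps its index, and from term m, which is raised. The two contributions combine into
  one coefficient of degree x + 1.\<close>

lemma racah_coeff_backward:
  fixes Q :: "'a::field"
  assumes "Q \<noteq> 0" "\<And>m. Q ^ Suc m \<noteq> 1" "\<And>m. b * Q ^ m \<noteq> 1"
  shows "(1 - b) * racah_coeff Q b g (Suc x) (Suc m) =
    racah_coeff Q (b * Q) (g * Q\<^sup>2) x (Suc m) * ((1 - b * Q ^ Suc m) / Q ^ Suc m)
    - racah_coeff Q (b * Q) (g * Q\<^sup>2) x m * ((1 - g * Q * Q ^ m) / Q ^ m)"
proof -
  define R where "R = racah_coeff Q (b * Q) (g * Q\<^sup>2) x m"
  define X P where "X = Q ^ x" and "P = Q ^ m"
  have nz: "1 - b \<noteq> 0" "1 - Q * P \<noteq> 0" "1 - b * Q * P \<noteq> 0" "X \<noteq> 0" "P \<noteq> 0"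
    using assms(3)[of 0] assms(2)[of m] assms(3)[of "Suc m"] assms(1) by (simp_all add: X_def P_def mult_ac)
  have 1: "racah_coeff Q b g (Suc x) (Suc m) =
     (1 - inverse (Q * X)) * (1 - g * (Q * X)) * Q / (1 - b) * R / (1 - Q * P)"
    using racah_coeff_Suc_Suc[OF assms(1,2), of b g x m] nz(2)
    unfolding R_def[symmetric] power_inverse power_Suc X_def[symmetric] P_def[symmetric]
    by (simp only: eq_divide_eq)  auto
  have 2: "racah_coeff Q (b * Q) (g * Q\<^sup>2) x (Suc m) =
     R * ((1 - inverse X * P) * (1 - g * Q\<^sup>2 * X * P) * Q / ((1 - b * Q * P) * (1 - Q * P)))"
    by (simp add: racah_coeff_Suc R_def X_def P_def power_inverse)
  have "(1 - inverse (Q * X)) * (1 - g * (Q * X)) * Q / (1 - Q * P) =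
     (1 - inverse X * P) * (1 - g * Q\<^sup>2 * X * P) / (1 - Q * P) / P - (1 - g * Q * P) / P"
    using nz(2,4,5) assms(1) by (simp add: divide_simps power2_eq_square) algebra
  hence "R * ((1 - inverse (Q * X)) * (1 - g * (Q * X)) * Q / (1 - Q * P)) =
     R * ((1 - inverse X * P) * (1 - g * Q\<^sup>2 * X * P) / (1 - Q * P) / P - (1 - g * Q * P) / P)"
    by simp
  thus ?thesis unfolding 1 2 R_def[symmetric] power_Suc X_def[symmetric] P_def[symmetric]
    using nz assms(1) by (simp add: right_diff_distrib[of R] mult_ac)
qed

lemma racah_backward:
  fixes Q :: "'a::field"
  assumes Q: "Q \<noteq> 0" "\<And>m. Q ^ Suc m \<noteq> 1" and b: "\<And>m. b * Q ^ m \<noteq> 1"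
    and a: "a \<noteq> 0" "a * g * Q = b * c * d"
  shows "(1 - c * Q ^ y) * (1 - b * Q ^ y) * (1 - a * Q ^ y) * racah Q (a * Q) (b * Q) (g * Q\<^sup>2) (c * Q) (d * Q) x y
      - (1 - Q ^ y) * ((b - a * Q ^ y) * (c - a * Q ^ y) * (d - a * Q ^ y) / a)
          * racah Q (a * Q) (b * Q) (g * Q\<^sup>2) (c * Q) (d * Q) x (y - 1)
    = (1 - b) * (1 - a * (Q ^ y)\<^sup>2) * Q ^ y * racah Q a b g c d (Suc x) y"
proof -
  define R where "R = racah_coeff Q (b * Q) (g * Q\<^sup>2) x"
  define C where "C = (\<lambda>n. qpoch (c * Q ^ n) Q (Suc x - n))"
  define B where "B = (\<lambda>n. racah_basis Q a d n y)"
  define V where "V = Q ^ y * (1 - a * (Q ^ y)\<^sup>2)"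
  \<comment> \<open>The factor 1 - c Q^n from the basis identity completes the c-product to length x
    + 1 - n, which is how c takes part in the shift.\<close>
  have C: "C n = (1 - c * Q ^ n) * qpoch (c * Q * Q ^ n) Q (x - n)" if "n \<le> x" for n
    using that qpoch_mult_power_Suc[of c Q n "x - n"] by (simp add: C_def Suc_diff_le)
  have C': "C (Suc n) = qpoch (c * Q * Q ^ n) Q (x - n)" for n
    by (simp add: C_def mult_ac)
  have "(1 - c * Q ^ y) * (1 - b * Q ^ y) * (1 - a * Q ^ y) * racah Q (a * Q) (b * Q) (g * Q\<^sup>2) (c * Q) (d * Q) x y
      - (1 - Q ^ y) * ((b - a * Q ^ y) * (c - a * Q ^ y) * (d - a * Q ^ y) / a)
          * racah Q (a * Q) (b * Q) (g * Q\<^sup>2) (c * Q) (d * Q) x (y - 1)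
     = (\<Sum>n\<le>x. R n * qpoch (c * Q * Q ^ n) Q (x - n) *
         ((1 - c * Q ^ y) * (1 - b * Q ^ y) * (1 - a * Q ^ y) * racah_basis Q (a * Q) (d * Q) n y
      - (1 - Q ^ y) * ((b - a * Q ^ y) * (c - a * Q ^ y) * (d - a * Q ^ y) / a) * racah_basis Q (a * Q) (d * Q) n (y - 1)))"
    unfolding racah_def sum_distrib_left sum_subtractf[symmetric] R_def
    by (intro sum.cong refl) (simp only: right_diff_distrib mult.assoc mult.left_commute)
  also have "\<dots> = (\<Sum>n\<le>x. R n * qpoch (c * Q * Q ^ n) Q (x - n) *
        (V * ((1 - b * Q ^ n) * (1 - c * Q ^ n) / Q ^ n * B n - (1 - g * Q * Q ^ n) / Q ^ n * B (Suc n))))"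
    unfolding racah_basis_backward[OF Q(1) a] B_def V_def ..
  also have "\<dots> = V * ((\<Sum>n\<le>x. R n * ((1 - b * Q ^ n) / Q ^ n) * C n * B n)
       - (\<Sum>n\<le>x. R n * ((1 - g * Q * Q ^ n) / Q ^ n) * C (Suc n) * B (Suc n)))"
    unfolding sum_distrib_left sum_subtractf[symmetric]
  proof (intro sum.cong refl)
    fix n assume n: "n \<in> {..x}"
    have "r * k * (v * (b' * c' / p * B1 - g' / p * B2)) = v * (r * (b' / p) * (c' * k) * B1 - r * (g' / p) * k * B2)"
      for r k v b' c' p B1 g' B2 :: 'a
      by (simp add: algebra_simps)
    thus "R n * qpoch (c * Q * Q ^ n) Q (x - n) *
        (V * ((1 - b * Q ^ n) * (1 - c * Q ^ n) / Q ^ n * B n - (1 - g * Q * Q ^ n) / Q ^ n * B (Suc n)))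
      = V * (R n * ((1 - b * Q ^ n) / Q ^ n) * C n * B n - R n * ((1 - g * Q * Q ^ n) / Q ^ n) * C (Suc n) * B (Suc n))"
      using n by (simp only: atMost_iff C C')
  qed
  \<comment> \<open>The added term n = x + 1 is zero; with it both sums run over the same indices
    once n = 0 is split off.\<close>
  also have "(\<Sum>n\<le>x. R n * ((1 - b * Q ^ n) / Q ^ n) * C n * B n)
      = (\<Sum>n\<le>Suc x. R n * ((1 - b * Q ^ n) / Q ^ n) * C n * B n)"
    using Q by (simp add: R_def racah_coeff_eq_0)
  also have "\<dots> = (1 - b) * C 0 * B 0 + (\<Sum>n\<le>x. R (Suc n) * ((1 - b * Q ^ Suc n) / Q ^ Suc n) * C (Suc n) * B (Suc n))"
    by (subst sum.atMost_Suc_shift) (simp add: R_def)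
  also have "\<dots> - (\<Sum>n\<le>x. R n * ((1 - g * Q * Q ^ n) / Q ^ n) * C (Suc n) * B (Suc n))
     = (1 - b) * C 0 * B 0 + (\<Sum>n\<le>x. (1 - b) * (racah_coeff Q b g (Suc x) (Suc n) * C (Suc n) * B (Suc n)))"
    unfolding add_diff_eq[symmetric] sum_subtractf[symmetric] mult.assoc[symmetric]
      racah_coeff_backward[OF Q b] R_def by (simp only: left_diff_distrib)
  also have "\<dots> = (1 - b) * (\<Sum>n\<le>Suc x. racah_coeff Q b g (Suc x) n * C n * B n)"
    by (subst sum.atMost_Suc_shift) (simp add: sum_distrib_left distrib_left mult.assoc)
  finally show ?thesis by (simp add: racah_def C_def B_def V_def mult_ac)
qed

section \<open>The nonterminating very-well-poised 6phi5 sum\<close>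

text \<open>The case \<open>y = 0\<close> is separate because \<open>a = 1\<close> is allowed.\<close>

definition vwp_front :: "'a::field \<Rightarrow> 'a \<Rightarrow> nat \<Rightarrow> 'a" where
  "vwp_front Q a y = (if y = 0 then 1 else (1 - a * (Q ^ y)\<^sup>2) / (1 - a * Q ^ y))"

text \<open>It depends on a and m only through a Q^m, so passing from a to a Q is the same as
  passing from m to m + 1.\<close>

definition vwp_tail :: "'a::{real_normed_field,banach} \<Rightarrow> 'a \<Rightarrow> 'a \<Rightarrow> 'a \<Rightarrow> 'a \<Rightarrow> nat \<Rightarrow> 'a" where
  "vwp_tail Q a b c d m = qpoch_inf (a / b * Q ^ m) Q * qpoch_inf (a / c * Q ^ m) Q
     * qpoch_inf (a / d * Q ^ m) Q / qpoch_inf (a * Q ^ m) Q"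

text \<open>
  The summand of the very-well-poised \<open>\<^sub>6\<phi>\<^sub>5\<close> without \<open>(c;Q)\<^sub>y (d;Q)\<^sub>y\<close>, which \<^const>\<open>racah\<close>
  contributes, and with infinite products in place of the factors \<open>(aQ/b;Q)\<^sub>y\<close> etc. in the denominator.
\<close>

definition racah_weight :: "'a::{real_normed_field,banach} \<Rightarrow> 'a \<Rightarrow> 'a \<Rightarrow> 'a \<Rightarrow> 'a \<Rightarrow> nat \<Rightarrow> 'a" where
  "racah_weight Q a b c d y = vwp_front Q a y * (qpoch b Q y / qpoch Q Q y)
     * vwp_tail Q a b c d (Suc y) * (a * Q / (b * c * d)) ^ y"

section \<open>Bounds uniform under the shift of a\<close>

lemma vwp_tail_tendsto:
  assumes "norm Q < 1"
  shows "vwp_tail Q a b c d \<longlonglongrightarrow> 1"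
proof -
  have "vwp_tail Q a b c d \<longlonglongrightarrow> 1 * 1 * 1 / 1"
    unfolding vwp_tail_def[abs_def]
    by (intro tendsto_divide tendsto_mult qpoch_inf_tail_tendsto_1 assms) auto
  thus ?thesis by simp
qed

lemma qpoch_bounded:
  fixes a q :: "'a::real_normed_field"
  assumes "norm q < 1"
  shows "Bseq (\<lambda>n. qpoch a q n)"
  using norm_qpoch_le[OF assms] by (rule BseqI')

lemma power_Suc_neq_1:
  fixes Q :: "'a::real_normed_field"
  assumes "norm Q < 1"
  shows "Q ^ Suc m \<noteq> 1"
proof
  assume *: "Q ^ Suc m = 1"
  have "norm Q * norm Q ^ m \<le> norm Q * 1" using assms by (intro mult_left_mono power_le_one) auto
  hence "norm (Q ^ Suc m) < 1" using assms by (simp add: norm_power norm_mult)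
  thus False unfolding * by simp
qed

lemma inverse_qpoch_bounded:
  fixes a q :: "'a::{real_normed_field,banach}"
  assumes "norm q < 1" "\<And>m. a * q ^ m \<noteq> 1"
  shows "Bseq (\<lambda>n. inverse (qpoch a q n))"
  using assms by (intro Bfun_inverse[OF qpoch_tendsto_inf] qpoch_inf_nonzero) auto

lemma inverse_one_minus_bounded:
  fixes a q :: "'a::{real_normed_field,banach}"
  assumes "norm q < 1"
  shows "Bseq (\<lambda>m. inverse (1 - a * q ^ m))"
proof -
  have "(\<lambda>m. 1 - a * q ^ m) \<longlonglongrightarrow> 1 - a * 0"
    using assms by (intro tendsto_diff tendsto_mult tendsto_const LIMSEQ_power_zero) auto
  thus ?thesis by (rule Bfun_inverse) auto
qed

text \<open>All denominators belong to the one sequence 1 - a Q^(N+y), which tends to 1 and so has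
  bounded inverses; one constant serves all N and y.\<close>

lemma vwp_front_bounded:
  fixes Q :: "'a::{real_normed_field,banach}"
  assumes "norm Q < 1"
  shows "\<exists>C. \<forall>N y. norm (vwp_front Q (a * Q ^ N) y) \<le> C"
proof -
  obtain C where C: "C > 0" "\<And>m. norm (inverse (1 - a * Q ^ m)) \<le> C"
    using inverse_one_minus_bounded[OF assms, of a] by (auto elim!: BseqE)
  have "norm (vwp_front Q (a * Q ^ N) y) \<le> 1 + (1 + norm a) * C" for N y
  proof -
    have "norm ((1 - a * Q ^ N * (Q ^ y)\<^sup>2) * inverse (1 - a * Q ^ (N + y))) \<le> (1 + norm a) * C"
      unfolding norm_mult
    proof (intro mult_mono C)
      have "norm (a * Q ^ N * (Q ^ y)\<^sup>2) = norm a * norm Q ^ (N + 2 * y)"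
        by (simp add: norm_mult norm_power power_add power_mult power2_eq_square mult_2)
      also have "\<dots> \<le> norm a * 1"
        using assms by (intro mult_left_mono power_le_one) auto
      finally show "norm (1 - a * Q ^ N * (Q ^ y)\<^sup>2) \<le> 1 + norm a"
        using norm_triangle_ineq4[of 1 "a * Q ^ N * (Q ^ y)\<^sup>2"] by simp
    qed auto
    moreover have "0 \<le> (1 + norm a) * C" using C by simp
    ultimately show ?thesis
      by (auto simp: vwp_front_def divide_inverse power_add mult.assoc)
  qed
  thus ?thesis by blast
qed

text \<open>Every factor is bounded along the sequence a Q^N, so N survives only in the geometric
  ratio. The uniform constant is what dominated convergence needs as N grows.\<close>

lemma racah_weight_bounded:
  fixes Q a b c d :: "'a::{real_normed_field,banach}"
  assumes Q: "norm Q < 1"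
  shows "\<exists>C. \<forall>N y. norm (racah_weight Q (a * Q ^ N) b c d y) \<le> C * (norm (a * Q / (b * c * d)) * norm Q ^ N) ^ y"
proof -
  obtain C1 where C1: "\<And>N y. norm (vwp_front Q (a * Q ^ N) y) \<le> C1"
    using vwp_front_bounded[OF Q] by blast
  obtain C2 where C2: "C2 > 0" "\<And>m. norm (vwp_tail Q a b c d m) \<le> C2"
    using convergent_imp_Bseq[OF convergentI[OF vwp_tail_tendsto[OF Q, of a b c d]]] by (auto elim!: BseqE)
  obtain C3 where C3: "C3 > 0" "\<And>m. norm (qpoch b Q m * inverse (qpoch Q Q m)) \<le> C3"
    using Bseq_mult[OF qpoch_bounded[OF Q] inverse_qpoch_bounded[OF Q, of Q], of b] power_Suc_neq_1[OF Q]
    by (auto elim!: BseqE)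
  have "norm (racah_weight Q (a * Q ^ N) b c d y) \<le> C1 * C3 * C2 * (norm (a * Q / (b * c * d)) * norm Q ^ N) ^ y" for N y
  proof -
    have "vwp_tail Q (a * Q ^ N) b c d (Suc y) = vwp_tail Q a b c d (N + Suc y)"
      by (simp add: vwp_tail_def power_add mult_ac)
    moreover have "norm (a * Q ^ N * Q / (b * c * d)) = norm (a * Q / (b * c * d)) * norm Q ^ N"
      by (simp add: norm_mult norm_divide norm_power)
    ultimately show ?thesis
      using C1[of N y] C2 C3 order_trans[OF norm_ge_zero C1[of N y]]
      unfolding racah_weight_def norm_mult norm_power divide_inverse[of "qpoch b Q y"]
      by (intro mult_mono) (auto simp: norm_mult)
  qed
  thus ?thesis by blast
qed

text \<open>
  With \<open>\<beta>, \<gamma>, \<delta>\<close> the inverses of \<open>b, c, d\<close> and \<open>Y = Q^y\<close>, these are the identities behind the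
  telescoping of the series for \<open>a\<close> against the one for \<open>aQ\<close>; \<open>a z Y - 1\<close> is the certificate.
\<close>

lemma vwp_telescope_0:
  fixes a \<beta> \<gamma> \<delta> Q z :: "'a::field"
  assumes "z = a * Q * \<beta> * \<gamma> * \<delta>"
  shows "(1 - z) * ((1 - a * Q * \<beta>) * (1 - a * Q * \<gamma>) * (1 - a * Q * \<delta>))
    - (1 - a * Q * \<beta> * \<gamma>) * (1 - a * Q * \<beta> * \<delta>) * (1 - a * Q * \<gamma> * \<delta>) * (1 - a * Q)
    = a * Q * (\<beta> - 1) * (\<gamma> - 1) * (\<delta> - 1) * (a * z * Q - 1)"
  unfolding assms by algebra

lemma vwp_telescope_Suc:
  fixes a \<beta> \<gamma> \<delta> Q z Y :: "'a::field"
  assumes "z = a * Q * \<beta> * \<gamma> * \<delta>"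
  shows "(1 - z) * (1 - a * Y\<^sup>2) * ((1 - a * Q * Y * \<beta>) * (1 - a * Q * Y * \<gamma>) * (1 - a * Q * Y * \<delta>))
    - (1 - a * Q * \<beta> * \<gamma>) * (1 - a * Q * \<beta> * \<delta>) * (1 - a * Q * \<gamma> * \<delta>) * (1 - a * Q * Y\<^sup>2) * Y * (1 - a * Y)
    = (1 - a * Y) * (a * Q * (\<beta> - Y) * (\<gamma> - Y) * (\<delta> - Y) * (a * z * Q * Y - 1))
      - (1 - Y) * ((1 - a * Q * Y * \<beta>) * (1 - a * Q * Y * \<gamma>) * (1 - a * Q * Y * \<delta>)) * (a * z * Y - 1)"
  unfolding assms by algebra

lemma vwp_tail_Suc:
  fixes a b c d Q :: "'a::{real_normed_field,banach}"
  assumes "norm Q < 1" "\<And>m. a * Q ^ Suc m \<noteq> 1"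
  shows "vwp_tail Q a b c d (Suc m) = (1 - a / b * Q ^ Suc m) * (1 - a / c * Q ^ Suc m) * (1 - a / d * Q ^ Suc m)
     / (1 - a * Q ^ Suc m) * vwp_tail Q a b c d (Suc (Suc m))"
  unfolding vwp_tail_def qpoch_inf_Suc[OF assms(1), of "_ * Q ^ Suc m"]
  by (simp add: mult_ac)

text \<open>A certificate in the style of Wilf and Zeilberger puts the partial sums in closed form,
  so the proof is an induction that compares one summand with the difference of two boundary
  terms.\<close>

lemma vwp_partial_sum:
  fixes a b c d Q :: "'a::{real_normed_field,banach}"
  assumes Q: "norm Q < 1" and nz: "b \<noteq> 0" "c \<noteq> 0" "d \<noteq> 0"
    and a: "\<And>m. a * Q ^ Suc m \<noteq> 1"
  defines "z \<equiv> a * Q / (b * c * d)"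
  shows "(\<Sum>y\<le>N. (1 - z) * (racah_weight Q a b c d y * qpoch c Q y * qpoch d Q y)
      - (1 - a * Q / (b * c)) * (1 - a * Q / (b * d)) * (1 - a * Q / (c * d))
        * (racah_weight Q (a * Q) b c d y * qpoch c Q y * qpoch d Q y))
    = qpoch b Q (Suc N) * qpoch c Q (Suc N) * qpoch d Q (Suc N) / qpoch Q Q N
      * (vwp_tail Q a b c d (Suc (Suc N)) / (1 - a * Q ^ Suc N)) * z ^ Suc N * (a * z * Q ^ Suc N - 1)"
    (is "(\<Sum>y\<le>N. ?f y) = ?K N")
proof -
  \<comment> \<open>The common factor of all terms. The tail is taken at y + 2 so that the weights
    for a and for a Q both reduce to it: the first through the product \<open>P\<close> below, the
    second directly.\<close>
  define H where "H = (\<lambda>y. qpoch b Q y * qpoch c Q y * qpoch d Q y / qpoch Q Q y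
      * (vwp_tail Q a b c d (Suc (Suc y)) / (1 - a * Q ^ Suc y)) * z ^ y)"
  define B C D where "B = inverse b" and "C = inverse c" and "D = inverse d"
  define P where "P = (\<lambda>Y. (1 - a * Q * Y * B) * (1 - a * Q * Y * C) * (1 - a * Q * Y * D))"
  define \<kappa> where "\<kappa> = (1 - a * Q * B * C) * (1 - a * Q * B * D) * (1 - a * Q * C * D)"
  have z: "z = a * Q * B * C * D" by (simp only: z_def B_def C_def D_def divide_inverse inverse_mult_distrib mult.assoc)
  have \<kappa>: "\<kappa> = (1 - a * Q / (b * c)) * (1 - a * Q / (b * d)) * (1 - a * Q / (c * d))"
    by (simp only: \<kappa>_def B_def C_def D_def divide_inverse inverse_mult_distrib mult.assoc)
  have W1: "racah_weight Q a b c d y * qpoch c Q y * qpoch d Q y = vwp_front Q a y * P (Q ^ y) * H y" for y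
    unfolding racah_weight_def H_def vwp_tail_Suc[OF Q a, of b c d y] P_def z_def
    by (simp only: divide_inverse inverse_mult_distrib B_def C_def D_def mult.assoc mult.commute mult.left_commute power_Suc)
  have W2: "racah_weight Q (a * Q) b c d y * qpoch c Q y * qpoch d Q y
     = vwp_front Q (a * Q) y * (1 - a * Q ^ Suc y) * Q ^ y * H y" for y
  proof -
    have "vwp_tail Q (a * Q) b c d (Suc y) = vwp_tail Q a b c d (Suc (Suc y))"
      by (simp add: vwp_tail_def mult_ac)
    moreover have "(a * Q * Q / (b * c * d)) ^ y = z ^ y * Q ^ y"
      by (simp add: z_def power_mult_distrib[symmetric])
    moreover have "1 - a * Q ^ Suc y \<noteq> 0" using a[of y] by simp
    ultimately show ?thesis
      unfolding racah_weight_def H_def by (simp add: mult_ac)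
  qed
  have K: "?K y = H y * (a * Q * (B - Q ^ y) * (C - Q ^ y) * (D - Q ^ y) * (a * z * Q * Q ^ y - 1))" for y
  proof -
    have "(1 - b * Q ^ y) * (1 - c * Q ^ y) * (1 - d * Q ^ y) * z = a * Q * (B - Q ^ y) * (C - Q ^ y) * (D - Q ^ y)"
      using nz by (simp add: z B_def C_def D_def field_simps)
    hence "H y * ((1 - b * Q ^ y) * (1 - c * Q ^ y) * (1 - d * Q ^ y) * z) * (a * z * Q * Q ^ y - 1)
      = H y * (a * Q * (B - Q ^ y) * (C - Q ^ y) * (D - Q ^ y)) * (a * z * Q * Q ^ y - 1)" by simp
    thus ?thesis by (simp add: H_def qpoch_Suc mult_ac)
  qed
  have "?f y = ((1 - z) * vwp_front Q a y * P (Q ^ y) - \<kappa> * (vwp_front Q (a * Q) y * (1 - a * Q ^ Suc y) * Q ^ y)) * H y" for y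
    unfolding W1 W2 \<kappa>[symmetric] by (simp add: algebra_simps)
  note f = this
  show ?thesis
  proof (induction N)
    case 0
    have "?f 0 = ?K 0"
      unfolding f K using vwp_telescope_0[OF z]
      by (simp add: vwp_front_def P_def \<kappa>_def mult_ac)
    thus ?case by simp
  next
    case (Suc N)
    define Y where "Y = Q ^ Suc N"
    have nzY: "1 - a * Y \<noteq> 0" "1 - Y \<noteq> 0" "1 - a * Q * Y \<noteq> 0" "1 - Q * Y \<noteq> 0"
      using a[of N] a[of "Suc N"] power_Suc_neq_1[OF Q, of N] power_Suc_neq_1[OF Q, of "Suc N"] by (simp_all add: Y_def mult_ac)
    \<comment> \<open>The previous boundary term is rewritten over the common factor at N + 1, where
      the telescoping identity can be applied.\<close>
    have 1: "?K N = H (Suc N) * ((1 - Y) * P Y * (a * z * Y - 1) / (1 - a * Y))"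
    proof -
      have "vwp_tail Q a b c d (Suc (Suc N)) = P Y / (1 - a * Q * Y) * vwp_tail Q a b c d (Suc (Suc (Suc N)))"
        unfolding vwp_tail_Suc[OF Q a, of b c d "Suc N"]
        by (simp add: P_def Y_def B_def C_def D_def divide_inverse mult_ac)
      moreover have "qpoch Q Q (Suc N) = qpoch Q Q N * (1 - Y)" by (simp add: qpoch_Suc Y_def)
      ultimately show ?thesis
        using nzY by (simp add: H_def Y_def[symmetric] mult_ac del: power_Suc) (simp add: Y_def mult_ac)
    qed
    have 2: "?f (Suc N) = H (Suc N) * (((1 - z) * (1 - a * Y\<^sup>2) * P Y - \<kappa> * (1 - a * Q * Y\<^sup>2) * Y * (1 - a * Y)) / (1 - a * Y))"
    proof -
      have "vwp_front Q a (Suc N) = (1 - a * Y\<^sup>2) / (1 - a * Y)" by (simp add: vwp_front_def Y_def)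
      moreover have "vwp_front Q (a * Q) (Suc N) * (1 - a * Q ^ Suc (Suc N)) = 1 - a * Q * Y\<^sup>2"
        using nzY by (simp add: vwp_front_def Y_def[symmetric] mult_ac del: power_Suc) (simp add: Y_def mult_ac)
      moreover have "((1 - z) * (n / r) * p - k * (m * Y)) * h = h * (((1 - z) * n * p - k * m * Y * r) / r)"
        if "r \<noteq> 0" for n r p k m h
        using that by (simp add: field_simps)
      ultimately show ?thesis
        unfolding f Y_def[symmetric] using nzY(1) by simp
    qed
    have "?K N + ?f (Suc N) = H (Suc N) * (((1 - a * Y) * (a * Q * (B - Y) * (C - Y) * (D - Y) * (a * z * Q * Y - 1))) / (1 - a * Y))"
      unfolding 1 2 \<kappa>_def P_def vwp_telescope_Suc[OF z]
      by (simp only: distrib_left[symmetric] add_divide_distrib[symmetric]) simp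
    also have "\<dots> = ?K (Suc N)"
      unfolding K Y_def[symmetric] using nzY by simp
    finally show ?case using Suc.IH by simp
  qed
qed

lemma vwp_summable:
  fixes a b c d Q :: "'a::{real_normed_field,banach}"
  assumes Q: "norm Q < 1" and z: "norm (a * Q / (b * c * d)) < 1"
  shows "summable (\<lambda>y. racah_weight Q a b c d y * qpoch c Q y * qpoch d Q y)"
proof -
  obtain C where C: "\<And>y. norm (racah_weight Q a b c d y) \<le> C * norm (a * Q / (b * c * d)) ^ y"
    using racah_weight_bounded[OF Q, of a b c d] by (metis mult.right_neutral power_0)
  obtain C1 where C1: "C1 > 0" "\<And>y. norm (qpoch c Q y) \<le> C1"
    using qpoch_bounded[OF Q, of c] by (auto elim!: BseqE)
  obtain C2 where C2: "C2 > 0" "\<And>y. norm (qpoch d Q y) \<le> C2"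
    using qpoch_bounded[OF Q, of d] by (auto elim!: BseqE)
  show ?thesis
  proof (rule summable_comparison_test')
    show "summable (\<lambda>y. C * norm (a * Q / (b * c * d)) ^ y * C1 * C2)"
      using z by (intro summable_mult summable_mult2 summable_geometric) auto
    show "norm (racah_weight Q a b c d y * qpoch c Q y * qpoch d Q y) \<le> C * norm (a * Q / (b * c * d)) ^ y * C1 * C2" for y
      using C1 C2 C[of y] order_trans[OF norm_ge_zero C[of y]] unfolding norm_mult by (intro mult_mono) auto
  qed
qed

text \<open>In the limit of the closed partial sums the boundary term carries z^(N+1) and
  disappears.\<close>

lemma vwp_shift:
  fixes a b c d Q :: "'a::{real_normed_field,banach}"
  assumes Q: "norm Q < 1" and nz: "b \<noteq> 0" "c \<noteq> 0" "d \<noteq> 0"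
    and a: "\<And>m. a * Q ^ Suc m \<noteq> 1" and z: "norm (a * Q / (b * c * d)) < 1"
  shows "(1 - a * Q / (b * c * d)) * (\<Sum>y. racah_weight Q a b c d y * qpoch c Q y * qpoch d Q y)
    = (1 - a * Q / (b * c)) * (1 - a * Q / (b * d)) * (1 - a * Q / (c * d))
      * (\<Sum>y. racah_weight Q (a * Q) b c d y * qpoch c Q y * qpoch d Q y)"
proof -
  define z where "z = a * Q / (b * c * d)"
  have "norm (a * Q * Q / (b * c * d)) = norm (a * Q / (b * c * d)) * norm Q"
    by (simp add: norm_mult norm_divide)
  also have "\<dots> \<le> norm (a * Q / (b * c * d)) * 1" using Q by (intro mult_left_mono) auto
  also have "\<dots> < 1" using z by simp
  finally have z': "norm (a * Q * Q / (b * c * d)) < 1" .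
  define f where "f = (\<lambda>y. (1 - z) * (racah_weight Q a b c d y * qpoch c Q y * qpoch d Q y)
      - (1 - a * Q / (b * c)) * (1 - a * Q / (b * d)) * (1 - a * Q / (c * d))
        * (racah_weight Q (a * Q) b c d y * qpoch c Q y * qpoch d Q y))"
  have "f sums ((1 - z) * (\<Sum>y. racah_weight Q a b c d y * qpoch c Q y * qpoch d Q y)
     - (1 - a * Q / (b * c)) * (1 - a * Q / (b * d)) * (1 - a * Q / (c * d))
      * (\<Sum>y. racah_weight Q (a * Q) b c d y * qpoch c Q y * qpoch d Q y))"
    unfolding f_def by (intro sums_diff sums_mult summable_sums vwp_summable Q z z')
  moreover have "f sums 0"
    unfolding sums_def_le f_def vwp_partial_sum[OF Q nz a, folded z_def]
  proof -
    have "(\<lambda>N. qpoch b Q (Suc N) * qpoch c Q (Suc N) * qpoch d Q (Suc N) / qpoch Q Q N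
      * (vwp_tail Q a b c d (Suc (Suc N)) / (1 - a * Q ^ Suc N)) * z ^ Suc N * (a * z * Q ^ Suc N - 1))
      \<longlonglongrightarrow> qpoch_inf b Q * qpoch_inf c Q * qpoch_inf d Q / qpoch_inf Q Q * (1 / (1 - a * 0)) * 0 * (a * z * 0 - 1)"
      using z Q power_Suc_neq_1[OF Q]
      by (intro tendsto_mult tendsto_divide tendsto_diff tendsto_const qpoch_tendsto_inf
          LIMSEQ_Suc[OF vwp_tail_tendsto] LIMSEQ_Suc LIMSEQ_power_zero qpoch_inf_nonzero) (auto simp: z_def)
    thus "(\<lambda>N. qpoch b Q (Suc N) * qpoch c Q (Suc N) * qpoch d Q (Suc N) / qpoch Q Q N
      * (vwp_tail Q a b c d (Suc (Suc N)) / (1 - a * Q ^ Suc N)) * z ^ Suc N * (a * z * Q ^ Suc N - 1)) \<longlonglongrightarrow> 0"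
      by simp
  qed
  ultimately show ?thesis using sums_unique2 by (fastforce simp: z_def)
qed

theorem nonterminating_6phi5:
  fixes a b c d Q :: "'a::{real_normed_field,banach}"
  assumes Q: "norm Q < 1" and nz: "b \<noteq> 0" "c \<noteq> 0" "d \<noteq> 0"
    and a: "\<And>m. a * Q ^ Suc m \<noteq> 1" and z: "norm (a * Q / (b * c * d)) < 1"
  shows "(\<lambda>y. racah_weight Q a b c d y * qpoch c Q y * qpoch d Q y) sums
    (qpoch_inf (a * Q / (b * c)) Q * qpoch_inf (a * Q / (b * d)) Q * qpoch_inf (a * Q / (c * d)) Q
      / qpoch_inf (a * Q / (b * c * d)) Q)"
proof -
  define z where "z = a * Q / (b * c * d)"
  define f where "f = (\<lambda>N y. racah_weight Q (a * Q ^ N) b c d y * qpoch c Q y * qpoch d Q y)"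
  have zN: "norm (a * Q ^ N * Q / (b * c * d)) < 1" for N
  proof -
    have "norm (a * Q ^ N * Q / (b * c * d)) = norm z * norm Q ^ N"
      by (simp add: z_def norm_mult norm_divide norm_power)
    also have "\<dots> \<le> norm z * 1" using Q by (intro mult_left_mono power_le_one) auto
    finally show ?thesis using z by (simp add: z_def)
  qed
  have aN: "a * Q ^ N * Q ^ Suc m \<noteq> 1" for N m
    using a[of "N + m"] by (simp add: power_add mult_ac)
  have iter: "qpoch z Q N * suminf (f 0) = qpoch (a * Q / (b * c)) Q N * qpoch (a * Q / (b * d)) Q N
      * qpoch (a * Q / (c * d)) Q N * suminf (f N)" for N
  proof (induction N)
    case (Suc N)
    have "qpoch z Q (Suc N) * suminf (f 0) = (1 - z * Q ^ N) * (qpoch z Q N * suminf (f 0))"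
      by (simp add: qpoch_Suc mult_ac)
    also have "\<dots> = qpoch (a * Q / (b * c)) Q N * qpoch (a * Q / (b * d)) Q N
      * qpoch (a * Q / (c * d)) Q N * ((1 - z * Q ^ N) * suminf (f N))"
      unfolding Suc.IH by (simp add: mult_ac)
    also have "(1 - z * Q ^ N) * suminf (f N) = (1 - a * Q / (b * c) * Q ^ N) * (1 - a * Q / (b * d) * Q ^ N)
       * (1 - a * Q / (c * d) * Q ^ N) * suminf (f (Suc N))"
      using vwp_shift[OF Q nz aN zN, of N] by (simp add: f_def z_def mult_ac)
    finally show ?case by (simp add: qpoch_Suc mult_ac)
  qed simp
  \<comment> \<open>Terms with y > 0 carry (z Q^N)^y and tend to 0; the term y = 0 is a
    \<open>vwp_tail\<close> and tends to 1. The dominating sequence is a multiple of |z|^y, free of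
    N.\<close>
  have lim: "(\<lambda>N. suminf (f N)) \<longlonglongrightarrow> 1"
  proof -
    obtain C where C: "\<And>N y. norm (racah_weight Q (a * Q ^ N) b c d y) \<le> C * (norm z * norm Q ^ N) ^ y"
      using racah_weight_bounded[OF Q, of a b c d] unfolding z_def by blast
    obtain C1 where C1: "C1 > 0" "\<And>y. norm (qpoch c Q y) \<le> C1"
      using qpoch_bounded[OF Q, of c] by (auto elim!: BseqE)
    obtain C2 where C2: "C2 > 0" "\<And>y. norm (qpoch d Q y) \<le> C2"
      using qpoch_bounded[OF Q, of d] by (auto elim!: BseqE)
    have C0: "C \<ge> 0" using order_trans[OF norm_ge_zero C[of 0 0]] by simp
    have f0: "(\<lambda>N. f N y) \<longlonglongrightarrow> (if y = 0 then 1 else 0)" for y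
    proof (cases y)
      case 0
      have "f N y = vwp_tail Q a b c d (Suc N)" for N
        by (simp add: 0 f_def racah_weight_def vwp_front_def vwp_tail_def mult_ac)
      thus ?thesis using LIMSEQ_Suc[OF vwp_tail_tendsto[OF Q]] 0 by simp
    next
      case (Suc m)
      have "norm (f N y) \<le> C * (norm z * norm Q ^ N) ^ y * C1 * C2" for N
        unfolding f_def norm_mult using C1 C2 C0 C[of N y] by (intro mult_mono) auto
      moreover have "(\<lambda>N. C * (norm z * norm Q ^ N) ^ y * C1 * C2) \<longlonglongrightarrow> C * (norm z * 0) ^ y * C1 * C2"
        using Q by (intro tendsto_mult tendsto_power tendsto_const LIMSEQ_power_zero) auto
      ultimately have "(\<lambda>N. f N y) \<longlonglongrightarrow> 0"
        using Suc by (rule_tac Lim_null_comparison[OF always_eventually]) auto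
      thus ?thesis using Suc by simp
    qed
    have "norm (f N y) \<le> C * norm z ^ y * C1 * C2" for N y
    proof -
      have "(norm z * norm Q ^ N) ^ y \<le> norm z ^ y"
        using Q by (intro power_mono mult_left_le power_le_one) auto
      hence "norm (racah_weight Q (a * Q ^ N) b c d y) \<le> C * norm z ^ y"
        using C[of N y] C0 by (meson mult_left_mono order_trans)
      thus ?thesis unfolding f_def norm_mult using C1 C2 C0 by (intro mult_mono) auto
    qed
    hence "\<forall>\<^sub>F (y, N) in at_top \<times>\<^sub>F sequentially. norm (f N y) \<le> C * norm z ^ y * C1 * C2"
      by (intro always_eventually) auto
    moreover have "summable (\<lambda>y. C * norm z ^ y * C1 * C2)"
      using z by (intro summable_mult summable_mult2 summable_geometric) (auto simp: z_def)
    ultimately have "(\<lambda>N. suminf (f N)) \<longlonglongrightarrow> (\<Sum>y. if y = 0 then 1 else 0)"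
      using tannerys_theorem[OF f0] by simp
    moreover have "(\<lambda>y. if y = 0 then 1 else 0 :: 'a) sums 1" by (rule sums_single)
    ultimately show ?thesis by (simp add: sums_iff)
  qed
  have "qpoch_inf z Q * suminf (f 0) = qpoch_inf (a * Q / (b * c)) Q * qpoch_inf (a * Q / (b * d)) Q
      * qpoch_inf (a * Q / (c * d)) Q * 1"
  proof (rule LIMSEQ_unique)
    show "(\<lambda>N. qpoch z Q N * suminf (f 0)) \<longlonglongrightarrow> qpoch_inf z Q * suminf (f 0)"
      by (intro tendsto_intros qpoch_tendsto_inf Q)
    show "(\<lambda>N. qpoch z Q N * suminf (f 0)) \<longlonglongrightarrow> qpoch_inf (a * Q / (b * c)) Q * qpoch_inf (a * Q / (b * d)) Q
      * qpoch_inf (a * Q / (c * d)) Q * 1"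
      unfolding iter by (intro tendsto_mult lim qpoch_tendsto_inf Q)
  qed
  moreover have "qpoch_inf z Q \<noteq> 0"
  proof (rule qpoch_inf_nonzero[OF Q])
    fix i
    have "norm (z * Q ^ i) < 1" using zN[of i] by (simp add: z_def mult_ac)
    thus "z * Q ^ i \<noteq> 1" by (metis norm_one less_irrefl)
  qed
  ultimately have "suminf (f 0) = qpoch_inf (a * Q / (b * c)) Q * qpoch_inf (a * Q / (b * d)) Q
      * qpoch_inf (a * Q / (c * d)) Q / qpoch_inf z Q"
    by (simp add: eq_divide_eq mult.commute)
  moreover have "f 0 sums suminf (f 0)" using vwp_summable[OF Q z] by (intro summable_sums) (simp add: f_def)
  ultimately show ?thesis by (simp add: f_def z_def)
qed

section \<open>Orthogonality of the q-Racah functions\<close>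

text \<open>The function whose \<open>Q\<close>-difference gives the weight in the backward shift.\<close>

definition racah_potential :: "'a::{real_normed_field,banach} \<Rightarrow> 'a \<Rightarrow> 'a \<Rightarrow> 'a \<Rightarrow> 'a \<Rightarrow> nat \<Rightarrow> 'a" where
  "racah_potential Q a b c d y = qpoch (b * Q) Q y / qpoch Q Q y
     * vwp_tail Q a b c d (Suc y) * (a / (b * c * d)) ^ y"

lemma racah_0_left: "racah Q a b g c d 0 y = qpoch d Q y"
  by (simp add: racah_def racah_basis_0)

lemma racah_0_right:
  assumes "Q \<noteq> 0"
  shows "racah Q a b g c d x 0 = qpoch c Q x"
proof -
  have "racah Q a b g c d x 0 = (\<Sum>n\<in>{0}. racah_coeff Q b g x n * qpoch (c * Q ^ n) Q (x - n) * racah_basis Q a d n 0)"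
    unfolding racah_def using assms by (intro sum.mono_neutral_right) (auto simp: racah_basis_eq_0)
  thus ?thesis by (simp add: racah_basis_0)
qed

lemma racah_weight_commute: "racah_weight Q a b c d = racah_weight Q a b d c"
  by (simp add: fun_eq_iff racah_weight_def vwp_tail_def mult_ac)

context
  fixes Q a b c d g :: "'a::{real_normed_field,banach}"
  assumes Q: "Q \<noteq> 0" "norm Q < 1"
    and nz: "a \<noteq> 0" "b \<noteq> 0" "c \<noteq> 0" "d \<noteq> 0"
    and a: "\<And>m. a * Q ^ Suc m \<noteq> 1" and b: "\<And>m. b * Q ^ m \<noteq> 1"
    and g: "a * g * Q = b * c * d"
begin

text \<open>The extra factor is exactly the one produced by \<open>racah_forward\<close>; after
  summation by parts the forward shift thus turns the potential back into a weight, with all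
  parameters raised.\<close>

lemma racah_weight_shift:
  "racah_weight Q (a * Q) (b * Q) (c * Q) (d * Q) y
     = racah_potential Q a b c d y * (inverse Q ^ y * (1 - a * Q ^ (2 * y + 1)))"
proof -
  have nz1: "1 - a * Q ^ Suc y \<noteq> 0" using a[of y] by simp
  have "vwp_tail Q (a * Q) (b * Q) (c * Q) (d * Q) (Suc y)
      = vwp_tail Q a b c d (Suc y) * (1 - a * Q ^ Suc y)"
    using Q nz1 unfolding vwp_tail_def qpoch_inf_Suc[OF Q(2), of "a * Q ^ Suc y"]
    by (simp add: mult_ac)
  moreover have "(a * Q * Q / (b * Q * (c * Q) * (d * Q))) ^ y = (a / (b * c * d)) ^ y * inverse Q ^ y"
  proof -
    have "a * Q * Q / (b * Q * (c * Q) * (d * Q)) = a / (b * c * d) * inverse Q"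
      using Q nz by (simp add: divide_simps)
    thus ?thesis by (simp only: power_mult_distrib)
  qed
  moreover have "vwp_front Q (a * Q) y * (1 - a * Q ^ Suc y) = 1 - a * Q ^ (2 * y + 1)"
    using nz1 by (auto simp: vwp_front_def power_add power_mult power2_eq_square mult_2 mult_ac)
  ultimately show ?thesis
    unfolding racah_weight_def racah_potential_def by (simp add: mult_ac)
qed

text \<open>This is \<open>racah_backward\<close> multiplied by one factor h: up to h its
  coefficients are the weight at y, the potential at y times 1 - c Q^y, and the potential at y -
  1.\<close>

lemma racah_weight_backward:
  "racah_weight Q a b c d y * racah Q a b g c d (Suc x) y
     = (1 - c * Q ^ y) * (racah_potential Q a b c d y * racah Q (a * Q) (b * Q) (g * Q\<^sup>2) (c * Q) (d * Q) x y)
       - (if y = 0 then 0 else racah_potential Q a b c d (y - 1)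
           * racah Q (a * Q) (b * Q) (g * Q\<^sup>2) (c * Q) (d * Q) x (y - 1))"
proof (cases y)
  case 0
  thus ?thesis
    using Q by (simp add: racah_0_right racah_weight_def racah_potential_def vwp_front_def qpoch_Suc_left)
next
  case (Suc m)
  hence y0: "y \<noteq> 0" by simp
  define Y where "Y = Q ^ y"
  define r r0 r1 where "r = racah Q a b g c d (Suc x) y"
    and "r0 = racah Q (a * Q) (b * Q) (g * Q\<^sup>2) (c * Q) (d * Q) x y"
    and "r1 = racah Q (a * Q) (b * Q) (g * Q\<^sup>2) (c * Q) (d * Q) x (y - 1)"
  have nzY: "1 - a * Y \<noteq> 0" "1 - Y \<noteq> 0" "1 - b \<noteq> 0" "Y \<noteq> 0"
    using a[of m] power_Suc_neq_1[OF Q(2), of m] b[of 0] Q by (simp_all add: Y_def Suc)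
  define z where "z = a * Q / (b * c * d)"
  \<comment> \<open>The quotient of the weight by (1 - b)(1 - a Y^2) Y, the coefficient of the
    function of higher degree in \<open>racah_backward\<close>.\<close>
  define h where "h = qpoch b Q y / qpoch Q Q y * vwp_tail Q a b c d (Suc y) * z ^ y / (1 - a * Y) / (1 - b) / Y"
  have h1: "racah_weight Q a b c d y = h * ((1 - b) * (1 - a * Y\<^sup>2) * Y)"
    using nzY y0 by (simp add: racah_weight_def vwp_front_def h_def z_def Y_def[symmetric] mult_ac)
  have h2: "racah_potential Q a b c d y = h * ((1 - b * Y) * (1 - a * Y))"
  proof -
    have "(1 - b) * qpoch (b * Q) Q y = qpoch b Q y * (1 - b * Y)"
      unfolding Y_def qpoch_Suc[symmetric] qpoch_Suc_left ..
    hence 1: "qpoch (b * Q) Q y = qpoch b Q y * (1 - b * Y) / (1 - b)"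
      using nzY by (simp add: eq_divide_eq mult.commute)
    have 2: "(a / (b * c * d)) ^ y = z ^ y / Y"
      using Q by (simp add: z_def Y_def power_divide[symmetric])
    show ?thesis unfolding racah_potential_def 1 2 h_def using nzY by (simp add: mult_ac)
  qed
  have h3: "racah_potential Q a b c d m = h * ((1 - Y) * ((b - a * Y) * (c - a * Y) * (d - a * Y) / a))"
  proof -
    have 1: "qpoch (b * Q) Q m = qpoch b Q y / (1 - b)"
      using nzY unfolding Suc qpoch_Suc_left by simp
    have 2: "qpoch Q Q m = qpoch Q Q y / (1 - Y)"
      using nzY unfolding Suc Y_def qpoch_Suc by simp
    have 3: "(a / (b * c * d)) ^ m = z ^ y / Y * (b * c * d / a)"
    proof -
      have "z ^ y / Y = (a / (b * c * d)) ^ y"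
        using Q by (simp add: z_def Y_def power_divide[symmetric])
      thus ?thesis using nz by (simp add: Suc)
    qed
    have 4: "vwp_tail Q a b c d (Suc m) = (1 - a / b * Y) * (1 - a / c * Y) * (1 - a / d * Y)
     / (1 - a * Y) * vwp_tail Q a b c d (Suc y)"
      using vwp_tail_Suc[OF Q(2) a, of b c d m] by (simp add: Suc Y_def)
    have 5: "(1 - a / b * Y) * (1 - a / c * Y) * (1 - a / d * Y) * (b * c * d / a) = (b - a * Y) * (c - a * Y) * (d - a * Y) / a"
      using nz by (simp add: diff_divide_distrib[symmetric] divide_simps)
    have "racah_potential Q a b c d m = h * ((1 - Y) * ((1 - a / b * Y) * (1 - a / c * Y) * (1 - a / d * Y) * (b * c * d / a)))"
      unfolding racah_potential_def 1 2 3 4 h_def using nzY by (simp add: mult_ac)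
    thus ?thesis unfolding 5 .
  qed
  have "h * ((1 - b) * (1 - a * Y\<^sup>2) * Y * r) = h * ((1 - c * Y) * (1 - b * Y) * (1 - a * Y) * r0
     - (1 - Y) * ((b - a * Y) * (c - a * Y) * (d - a * Y) / a) * r1)"
    unfolding r_def r0_def r1_def Y_def
    by (subst racah_backward[OF Q(1) power_Suc_neq_1[OF Q(2)] b nz(1) g]) (rule refl)
  hence "racah_weight Q a b c d y * r = (1 - c * Y) * (racah_potential Q a b c d y * r0) - racah_potential Q a b c d m * r1"
    unfolding h1 h2 h3 by (simp only: right_diff_distrib[of h] mult_ac)
  thus ?thesis using Suc by (simp add: r_def r0_def r1_def Y_def)
qed

text \<open>Abel summation against an arbitrary test sequence s. The adjoint operator (1 - c Q^y)
  s(y) - s(y + 1) is the forward shift with c in place of d; hence the second function has c and d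
  exchanged, and the sequence (c;Q)_y is annihilated.\<close>

lemma racah_sum_by_parts:
  "(\<Sum>y\<le>N. racah_weight Q a b c d y * racah Q a b g c d (Suc x) y * s y)
    = (\<Sum>y\<le>N. racah_potential Q a b c d y * racah Q (a * Q) (b * Q) (g * Q\<^sup>2) (c * Q) (d * Q) x y
         * ((1 - c * Q ^ y) * s y - s (Suc y)))
      + racah_potential Q a b c d N * racah Q (a * Q) (b * Q) (g * Q\<^sup>2) (c * Q) (d * Q) x N * s (Suc N)"
proof (induction N)
  case 0
  show ?case unfolding racah_weight_backward by (simp add: algebra_simps)
next
  case (Suc N)
  define u where "u = (\<lambda>y. racah_potential Q a b c d y * racah Q (a * Q) (b * Q) (g * Q\<^sup>2) (c * Q) (d * Q) x y)"
  have "racah_weight Q a b c d (Suc N) * racah Q a b g c d (Suc x) (Suc N) = (1 - c * Q ^ Suc N) * u (Suc N) - u N"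
    unfolding racah_weight_backward u_def by simp
  moreover have "(w * v - u') * s' = v * (w * s' - s2) + v * s2 - u' * s'" for w v u' s' s2 :: 'a
    by (simp add: algebra_simps)
  ultimately have "racah_weight Q a b c d (Suc N) * racah Q a b g c d (Suc x) (Suc N) * s (Suc N)
    = u (Suc N) * ((1 - c * Q ^ Suc N) * s (Suc N) - s (Suc (Suc N))) + u (Suc N) * s (Suc (Suc N)) - u N * s (Suc N)"
    by (simp only:)
  thus ?case
    unfolding sum.atMost_Suc Suc.IH by (simp add: u_def)
qed

lemma racah_ladder_partial:
  "(\<Sum>y\<le>N. racah_weight Q a b c d y * racah Q a b g c d (Suc x) y * racah Q a b g d c (Suc x') y)
    = (1 - inverse Q ^ Suc x') * (1 - g * Q ^ Suc x') / (1 - b)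
       * (\<Sum>y\<le>N. racah_weight Q (a * Q) (b * Q) (c * Q) (d * Q) y
           * racah Q (a * Q) (b * Q) (g * Q\<^sup>2) (c * Q) (d * Q) x y
           * racah Q (a * Q) (b * Q) (g * Q\<^sup>2) (d * Q) (c * Q) x' y)
      + racah_potential Q a b c d N * racah Q (a * Q) (b * Q) (g * Q\<^sup>2) (c * Q) (d * Q) x N
         * racah Q a b g d c (Suc x') (Suc N)"
  unfolding racah_sum_by_parts racah_forward[OF Q(1) power_Suc_neq_1[OF Q(2)]] racah_weight_shift sum_distrib_left
  by (intro arg_cong2[of _ _ _ _ "(+)"] sum.cong refl) (simp only: mult_ac)

end

text \<open>One power Q^y is given to each of the n factors: 1 - Q^(i-y) becomes Q^y - Q^i, of norm
  at most 2.\<close>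

lemma qpoch_inverse_power_bound:
  fixes Q :: "'a::real_normed_field"
  assumes "Q \<noteq> 0" "norm Q < 1"
  shows "norm (qpoch (inverse Q ^ y) Q n) * norm Q ^ (n * y) \<le> 2 ^ n"
proof -
  have "norm (qpoch (inverse Q ^ y) Q n) * norm Q ^ (n * y) = norm (qpoch (inverse Q ^ y) Q n * (\<Prod>i<n. Q ^ y))"
    by (simp add: norm_mult norm_power power_mult mult.commute[of n])
  also have "\<dots> = (\<Prod>i<n. norm (Q ^ y - Q ^ i))"
    unfolding qpoch_def prod.distrib[symmetric] prod_norm[symmetric] using assms(1)
    by (intro prod.cong refl arg_cong[of _ _ norm]) (simp add: field_simps)
  also have "\<dots> \<le> (\<Prod>i<n. 2)"
  proof (intro prod_mono conjI)
    fix i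
    have "norm (Q ^ y) \<le> 1" "norm (Q ^ i) \<le> 1"
      using assms(2) by (simp_all add: norm_power power_le_one)
    thus "norm (Q ^ y - Q ^ i) \<le> 2" using norm_triangle_ineq4[of "Q ^ y" "Q ^ i"] by simp
  qed auto
  finally show ?thesis by simp
qed

text \<open>The growth is at most |Q|^(-xy), the rate allowed to the index n = x. Uniformity over
  bounded a, c, d matters for several sites, where these parameters contain heights that vary with
  the configuration.\<close>

lemma racah_bound:
  fixes Q b g :: "'a::real_normed_field"
  assumes Q: "Q \<noteq> 0" "norm Q < 1"
  shows "\<exists>C>0. \<forall>a c d y. norm a \<le> A \<longrightarrow> norm c \<le> A \<longrightarrow> norm d \<le> A \<longrightarrow>
    norm (racah Q a b g c d x y) * norm Q ^ (x * y) \<le> C"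
proof -
  define E where "E = exp (A / (1 - norm Q))"
  define C where "C = (\<Sum>n\<le>x. norm (racah_coeff Q b g x n) * E * (2 ^ n * E * E))"
  have E: "norm (qpoch (t * Q ^ m) Q n) \<le> E" if "norm t \<le> A" for t m n
  proof -
    have "norm (t * Q ^ m) \<le> norm t * 1"
      unfolding norm_mult norm_power using Q by (intro mult_left_mono power_le_one) auto
    hence "norm (t * Q ^ m) / (1 - norm Q) \<le> A / (1 - norm Q)"
      using that Q by (intro divide_right_mono) auto
    thus ?thesis using norm_qpoch_le[OF Q(2), of "t * Q ^ m" n] unfolding E_def
      by (meson exp_le_cancel_iff order_trans)
  qed
  have E0: "E > 0" by (simp add: E_def)
  have "norm (racah Q a b g c d x y) * norm Q ^ (x * y) \<le> C" if "norm a \<le> A" "norm c \<le> A" "norm d \<le> A" for a c d y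
  proof -
    have "norm (racah Q a b g c d x y) * norm Q ^ (x * y) \<le>
      (\<Sum>n\<le>x. norm (racah_coeff Q b g x n) * norm (qpoch (c * Q ^ n) Q (x - n)) * (norm (racah_basis Q a d n y) * norm Q ^ (x * y)))"
      unfolding racah_def mult.assoc[symmetric] norm_mult[symmetric] sum_distrib_right[symmetric]
      by (intro mult_right_mono norm_sum) auto
    also have "\<dots> \<le> C"
      unfolding C_def
    proof (intro sum_mono)
      fix n assume n: "n \<in> {..x}"
      have "norm (racah_basis Q a d n y) * norm Q ^ (x * y) \<le> norm (racah_basis Q a d n y) * norm Q ^ (n * y)"
        using n Q by (intro mult_left_mono power_decreasing) auto
      also have "\<dots> = norm (qpoch (inverse Q ^ y) Q n) * norm Q ^ (n * y) * norm (qpoch (a * Q ^ y) Q n) * norm (qpoch (d * Q ^ n) Q (y - n))"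
        by (simp add: racah_basis_def norm_mult)
      also have "\<dots> \<le> 2 ^ n * E * E"
        using E0 by (intro mult_mono E that qpoch_inverse_power_bound Q) auto
      finally have "norm (racah_basis Q a d n y) * norm Q ^ (x * y) \<le> 2 ^ n * E * E" .
      thus "norm (racah_coeff Q b g x n) * norm (qpoch (c * Q ^ n) Q (x - n)) * (norm (racah_basis Q a d n y) * norm Q ^ (x * y))
          \<le> norm (racah_coeff Q b g x n) * E * (2 ^ n * E * E)"
        using E0 by (intro mult_mono[OF mult_left_mono[OF E[OF that(2)]]]) auto
    qed
    finally show ?thesis .
  qed
  moreover have "max C 1 > 0" by simp
  ultimately show ?thesis by (meson max.coboundedI1)
qed

lemma racah_boundary_tendsto_0:
  fixes Q a b c d g :: "'a::{real_normed_field,banach}"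
  assumes Q: "Q \<noteq> 0" "norm Q < 1" and nz: "a \<noteq> 0" "b \<noteq> 0" "c \<noteq> 0" "d \<noteq> 0"
    and g: "a * g * Q = b * c * d" and gt: "1 < norm (g * Q ^ (Suc x + x'))"
  shows "(\<lambda>N. racah_potential Q a b c d N * racah Q (a * Q) (b * Q) (g * Q\<^sup>2) (c * Q) (d * Q) x N
         * racah Q a b g d c x' (Suc N)) \<longlonglongrightarrow> 0"
proof -
  define A where "A = Max {norm a, norm c, norm d}"
  have A: "norm a \<le> A" "norm c \<le> A" "norm d \<le> A" by (auto simp: A_def)
  have AQ: "norm (t * Q) \<le> A" if "norm t \<le> A" for t
  proof -
    have "norm (t * Q) \<le> norm t * 1" unfolding norm_mult using Q by (intro mult_left_mono) auto
    thus ?thesis using that by simp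
  qed
  obtain C1 where C1: "C1 > 0" "\<And>a c d y. norm a \<le> A \<Longrightarrow> norm c \<le> A \<Longrightarrow> norm d \<le> A \<Longrightarrow>
      norm (racah Q a (b * Q) (g * Q\<^sup>2) c d x y) * norm Q ^ (x * y) \<le> C1"
    using racah_bound[OF Q, of A "b * Q" "g * Q\<^sup>2" x] by blast
  obtain C2 where C2: "C2 > 0" "\<And>a c d y. norm a \<le> A \<Longrightarrow> norm c \<le> A \<Longrightarrow> norm d \<le> A \<Longrightarrow>
      norm (racah Q a b g c d x' y) * norm Q ^ (x' * y) \<le> C2"
    using racah_bound[OF Q, of A b g x'] by blast
  have "Bseq (\<lambda>y. qpoch (b * Q) Q y * inverse (qpoch Q Q y) * vwp_tail Q a b c d (Suc y))"
    using power_Suc_neq_1[OF Q(2)] Q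
    by (intro Bseq_mult qpoch_bounded inverse_qpoch_bounded convergent_imp_Bseq[OF convergentI[OF LIMSEQ_Suc[OF vwp_tail_tendsto]]]) auto
  then obtain C3 where C3: "C3 > 0" "\<And>y. norm (qpoch (b * Q) Q y * inverse (qpoch Q Q y) * vwp_tail Q a b c d (Suc y)) \<le> C3"
    by (auto elim!: BseqE)
  \<comment> \<open>The potential contributes (a/(bcd))^N and the two functions |Q|^(-xN) and
    |Q|^(-x'N). As a/(bcd) = 1/(gQ), the ratio is the inverse of |g Q^(x+x'+1)|.\<close>
  define t where "t = norm (a / (b * c * d)) * inverse (norm Q) ^ (x + x')"
  have g0: "g \<noteq> 0" using gt by auto
  have "a / (b * c * d) = inverse (g * Q)" using nz Q g0 unfolding g[symmetric] by (simp add: field_simps)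
  hence "t = inverse (norm (g * Q ^ (Suc x + x')))"
    by (simp add: t_def norm_mult norm_inverse norm_power power_inverse mult_ac)
  hence t: "0 \<le> t" "t < 1" using gt by (simp_all add: t_def inverse_less_1_iff)
  have "norm (racah_potential Q a b c d N * racah Q (a * Q) (b * Q) (g * Q\<^sup>2) (c * Q) (d * Q) x N
         * racah Q a b g d c x' (Suc N)) \<le> C3 * C1 * (C2 * inverse (norm Q) ^ x') * t ^ N" for N
  proof -
    have pot: "racah_potential Q a b c d N = qpoch (b * Q) Q N * inverse (qpoch Q Q N) * vwp_tail Q a b c d (Suc N) * (a / (b * c * d)) ^ N"
      by (simp add: racah_potential_def divide_inverse)
    have r1: "norm (racah Q (a * Q) (b * Q) (g * Q\<^sup>2) (c * Q) (d * Q) x N) \<le> C1 * (inverse (norm Q) ^ x) ^ N"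
      using C1(2)[OF AQ AQ AQ, OF A, of N] Q
      by (simp add: power_mult[symmetric] power_inverse divide_inverse[symmetric] pos_le_divide_eq)
    have r2: "norm (racah Q a b g d c x' (Suc N)) \<le> C2 * inverse (norm Q) ^ x' * (inverse (norm Q) ^ x') ^ N"
      using C2(2)[OF A(1,3,2), of "Suc N"] Q
      by (simp add: power_mult[symmetric] power_inverse divide_inverse[symmetric] pos_le_divide_eq power_add mult_ac)
    have "norm (racah_potential Q a b c d N * racah Q (a * Q) (b * Q) (g * Q\<^sup>2) (c * Q) (d * Q) x N
         * racah Q a b g d c x' (Suc N)) \<le> C3 * norm (a / (b * c * d)) ^ N * (C1 * (inverse (norm Q) ^ x) ^ N)
           * (C2 * inverse (norm Q) ^ x' * (inverse (norm Q) ^ x') ^ N)"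
      unfolding pot norm_mult[of "_ * _" "racah _ _ _ _ _ _ _ _"] norm_mult[of _ "racah _ _ _ _ _ _ _ _"]
        norm_mult[of _ "(a / (b * c * d)) ^ N"] norm_power
      using C1 C2 C3 r1 r2 by (intro mult_mono) auto
    also have "\<dots> = C3 * C1 * (C2 * inverse (norm Q) ^ x') * t ^ N"
      by (simp add: t_def power_mult_distrib power_add mult_ac)
    finally show ?thesis .
  qed
  moreover have "(\<lambda>N. C3 * C1 * (C2 * inverse (norm Q) ^ x') * t ^ N) \<longlonglongrightarrow> 0"
    using t by (intro tendsto_mult_right_zero LIMSEQ_power_zero) auto
  ultimately show ?thesis
    by (rule_tac Lim_null_comparison[OF always_eventually]) auto
qed

text \<open>The product of the x ladder constants times the 6phi5 value at the raised parameters b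
  Q^x, c Q^x, d Q^x and g Q^(2x).\<close>

definition racah_norm :: "'a::{real_normed_field,banach} \<Rightarrow> 'a \<Rightarrow> 'a \<Rightarrow> 'a \<Rightarrow> 'a \<Rightarrow> nat \<Rightarrow> 'a" where
  "racah_norm Q b g c d x = qpoch (inverse Q ^ x) Q x * qpoch (g * Q ^ x) Q x / qpoch b Q x
     * (qpoch_inf (b / (g * Q ^ x)) Q * qpoch_inf (c / (g * Q ^ x)) Q * qpoch_inf (d / (g * Q ^ x)) Q
        / qpoch_inf (1 / (g * Q ^ (2 * x))) Q)"

lemma racah_norm_Suc:
  fixes Q :: "'a::{real_normed_field,banach}"
  assumes "Q \<noteq> 0"
  shows "racah_norm Q b g c d (Suc x) = (1 - inverse Q ^ Suc x) * (1 - g * Q ^ Suc x) / (1 - b)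
    * racah_norm Q (b * Q) (g * Q\<^sup>2) (c * Q) (d * Q) x"
proof -
  have 1: "qpoch (g * Q ^ Suc x) Q (Suc x) = (1 - g * Q ^ Suc x) * qpoch (g * Q\<^sup>2 * Q ^ x) Q x"
    by (subst qpoch_Suc_left) (simp add: power2_eq_square mult_ac)
  have 2: "t / (g * Q ^ Suc x) = t * Q / (g * Q\<^sup>2 * Q ^ x)" for t
    using assms by (simp add: power2_eq_square mult_ac)
  have 3: "1 / (g * Q ^ (2 * Suc x)) = 1 / (g * Q\<^sup>2 * Q ^ (2 * x))"
    by (simp add: power2_eq_square mult_ac)
  show ?thesis
    unfolding racah_norm_def 1 2 3 qpoch_inverse_power_Suc[OF assms] qpoch_Suc_left[of b Q x]
    by (simp add: mult_ac)
qed

text \<open>Induction on the first degree, for all parameters at once. If exactly one degree is 0,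
  summation by parts leaves only the boundary term, because the other function is an annihilated
  test sequence.\<close>

theorem racah_orthogonality:
  fixes Q a b c d g :: "'a::{real_normed_field,banach}"
  assumes Q: "Q \<noteq> 0" "norm Q < 1" and "a \<noteq> 0" "b \<noteq> 0" "c \<noteq> 0" "d \<noteq> 0"
    and "\<And>m. a * Q ^ Suc m \<noteq> 1" and "\<And>m. b * Q ^ m \<noteq> 1"
    and "a * g * Q = b * c * d" and "1 < norm (g * Q ^ (x + x'))"
  shows "(\<lambda>y. racah_weight Q a b c d y * racah Q a b g c d x y * racah Q a b g d c x' y) sums
    (if x = x' then racah_norm Q b g c d x else 0)"
  using assms(3-)
proof (induction x arbitrary: x' a b c d g)
  case (0 x')
  show ?case
  proof (cases x')
    case x': 0
    have g: "a * Q / (b * c * d) = 1 / g" "a * Q / (b * c) = d / g" "a * Q / (b * d) = c / g" "a * Q / (c * d) = b / g"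
      using 0 x' by (auto simp: divide_simps mult_ac)
    have "norm (a * Q / (b * c * d)) < 1"
      using 0 x' unfolding g by (simp add: norm_divide divide_less_eq)
    from nonterminating_6phi5[OF Q(2) 0(2-5) this] show ?thesis
      unfolding g x' racah_0_left by (simp add: racah_norm_def mult_ac)
  next
    case (Suc m)
    have gt: "1 < norm (g * Q ^ (Suc m + 0))" using 0 Suc by simp
    \<comment> \<open>Here the second function has the positive degree, so summation by parts is
      used with c and d exchanged; its test sequence (d;Q)_y is annihilated.\<close>
    have "(\<lambda>N. \<Sum>y\<le>N. racah_weight Q a b d c y * racah Q a b g d c (Suc m) y * qpoch d Q y) \<longlonglongrightarrow> 0"
    proof -
      have "racah_potential Q a b d c N * racah Q (a * Q) (b * Q) (g * Q\<^sup>2) (d * Q) (c * Q) m N * qpoch d Q (Suc N)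
         = (\<Sum>y\<le>N. racah_weight Q a b d c y * racah Q a b g d c (Suc m) y * qpoch d Q y)" for N
        using 0 by (subst racah_sum_by_parts[OF Q]) (auto simp: qpoch_Suc mult_ac)
      thus ?thesis
        using racah_boundary_tendsto_0[OF Q, of a b d c g m 0] 0 gt by (simp add: racah_0_left mult_ac)
    qed
    thus ?thesis
      unfolding sums_def_le by (simp add: Suc racah_0_left racah_weight_commute[of Q a b c d] mult_ac)
  qed
next
  case (Suc x x')
  show ?case
  proof (cases x')
    case 0
    have "(\<lambda>N. \<Sum>y\<le>N. racah_weight Q a b c d y * racah Q a b g c d (Suc x) y * qpoch c Q y) \<longlonglongrightarrow> 0"
    proof -
      have "racah_potential Q a b c d N * racah Q (a * Q) (b * Q) (g * Q\<^sup>2) (c * Q) (d * Q) x N * qpoch c Q (Suc N)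
         = (\<Sum>y\<le>N. racah_weight Q a b c d y * racah Q a b g c d (Suc x) y * qpoch c Q y)" for N
        using Suc.prems by (subst racah_sum_by_parts[OF Q]) (auto simp: qpoch_Suc mult_ac)
      thus ?thesis
        using racah_boundary_tendsto_0[OF Q Suc.prems(1-4,7), of x 0] Suc.prems(8) by (simp add: 0 racah_0_left)
    qed
    thus ?thesis
      unfolding sums_def_le by (simp add: 0 racah_0_left)
  next
    case x': (Suc m)
    define E where "E = (1 - inverse Q ^ Suc m) * (1 - g * Q ^ Suc m) / (1 - b)"
    have IH: "(\<lambda>y. racah_weight Q (a * Q) (b * Q) (c * Q) (d * Q) y
           * racah Q (a * Q) (b * Q) (g * Q\<^sup>2) (c * Q) (d * Q) x y
           * racah Q (a * Q) (b * Q) (g * Q\<^sup>2) (d * Q) (c * Q) m y) sums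
        (if x = m then racah_norm Q (b * Q) (g * Q\<^sup>2) (c * Q) (d * Q) x else 0)"
    proof (rule Suc.IH)
      show "a * Q * Q ^ Suc j \<noteq> 1" "b * Q * Q ^ j \<noteq> 1" for j
        using Suc.prems(5)[of "Suc j"] Suc.prems(6)[of "Suc j"] by (simp_all add: mult_ac)
      show "a * Q * (g * Q\<^sup>2) * Q = b * Q * (c * Q) * (d * Q)"
        using Suc.prems(7) by (simp add: power2_eq_square) algebra
      show "1 < norm (g * Q\<^sup>2 * Q ^ (x + m))"
        using Suc.prems(8) by (simp add: x' power2_eq_square mult_ac)
    qed (use Suc.prems Q in auto)
    have "(\<lambda>N. \<Sum>y\<le>N. racah_weight Q a b c d y * racah Q a b g c d (Suc x) y * racah Q a b g d c (Suc m) y)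
       \<longlonglongrightarrow> E * (if x = m then racah_norm Q (b * Q) (g * Q\<^sup>2) (c * Q) (d * Q) x else 0) + 0"
      unfolding racah_ladder_partial[OF Q Suc.prems(1-7)] E_def[symmetric]
      using Suc.prems(8) x'
      by (intro tendsto_add tendsto_mult tendsto_const IH[unfolded sums_def_le] racah_boundary_tendsto_0 Q Suc.prems(1-4,7)) simp
    thus ?thesis
      unfolding sums_def_le by (simp add: x' E_def racah_norm_Suc[OF Q(1)] split: if_splits)
  qed
qed

section \<open>The one-site functions\<close>

lemma prod_lessThan_add:
  fixes n m :: nat
  shows "prod f {..<n + m} = prod f {..<n} * (\<Prod>i<m. f (n + i))"
  by (induction m) (simp_all add: mult.assoc)

lemma qpoch_inverse_base:
  fixes a q :: "'a::field"
  assumes "a \<noteq> 0" "q \<noteq> 0"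
  shows "qpoch (inverse a) (inverse q) n = (\<Prod>i<n. - inverse (a * q ^ i)) * qpoch a q n"
  unfolding qpoch_def prod.distrib[symmetric] using assms
  by (intro prod.cong refl) (simp add: field_simps)

lemma racah_min:
  assumes "Q \<noteq> 0"
  shows "racah Q a b g c d x y =
    (\<Sum>n\<le>min x y. racah_coeff Q b g x n * qpoch (c * Q ^ n) Q (x - n) * racah_basis Q a d n y)"
  unfolding racah_def using assms
  by (intro sum.mono_neutral_right) (auto simp: racah_basis_eq_0 not_le)

text \<open>Each factorial in base 1/Q is the one in base Q times a product of monomials
  \<open>J\<close>. By a g Q = b c d these products cancel up to prefactors free of n, and the
  series that remains is the same one with x and y, and a and g, exchanged.\<close>

lemma racah_inverse_base:
  fixes Q :: "'a::field"
  assumes nz: "Q \<noteq> 0" "a \<noteq> 0" "b \<noteq> 0" "g \<noteq> 0" "c \<noteq> 0" "d \<noteq> 0" and g: "a * g * Q = b * c * d"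
  shows "(\<Prod>i<y. - (c * Q ^ i)) * racah (inverse Q) (inverse a) (inverse b) (inverse g) (inverse d) (inverse c) x y
    = (\<Prod>i<x. - inverse (d * Q ^ i)) * racah Q g b a c d y x"
proof -
  define J where "J = (\<lambda>t n. \<Prod>i<n. - inverse (t * Q ^ i))"
  have inv: "qpoch (inverse t) (inverse Q) n = J t n * qpoch t Q n" if "t \<noteq> 0" for t n
    using qpoch_inverse_base[OF that nz(1)] by (simp add: J_def)
  have J_split: "J t m = J t n * J (t * Q ^ n) (m - n)" if "n \<le> m" for t n m
  proof -
    have "(\<Prod>i<n + (m - n). - inverse (t * Q ^ i)) = (\<Prod>i<n. - inverse (t * Q ^ i)) * (\<Prod>i<m - n. - inverse (t * Q ^ (n + i)))"
      by (rule prod_lessThan_add)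
    thus ?thesis using that by (simp add: J_def power_add mult.assoc)
  qed
  have J_nz: "J t n \<noteq> 0" if "t \<noteq> 0" for t n using that nz by (simp add: J_def)
  have J_key: "J (inverse Q ^ x) n * J (g * Q ^ x) n * inverse Q ^ n / (J b n * J Q n)
      * (J (inverse Q ^ y) n * J (a * Q ^ y) n) = J d n * J c n * Q ^ n" for n
  proof -
    \<comment> \<open>For each X = Q^i the left side contributes 1/(b c d X^4) and the right side
      1/(a g Q X^4), since Q^x and Q^y cancel against their inverses.\<close>
    have *: "J c n * J d n * J b n * J Q n * Q ^ n = J (inverse Q ^ x) n * J (g * Q ^ x) n * inverse Q ^ n
      * (J (inverse Q ^ y) n * J (a * Q ^ y) n)"
    proof -
      have "Q ^ n = (\<Prod>i<n. Q)" "inverse Q ^ n = (\<Prod>i<n. inverse Q)" by simp_all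
      moreover have "- inverse (c * X) * - inverse (d * X) * - inverse (b * X) * - inverse (Q * X) * Q =
         - inverse (inverse Q ^ x * X) * - inverse (g * Q ^ x * X) * inverse Q * (- inverse (inverse Q ^ y * X) * - inverse (a * Q ^ y * X))"
        if "X \<noteq> 0" for X
      proof -
        have "- inverse (c * X) * - inverse (d * X) * - inverse (b * X) * - inverse (Q * X) * Q = inverse (b * c * d * X ^ 4)"
          using nz that by (simp add: divide_simps eval_nat_numeral)
        also have "\<dots> = inverse (a * g * Q * X ^ 4)" unfolding g ..
        also have "\<dots> = - inverse (inverse Q ^ x * X) * - inverse (g * Q ^ x * X) * inverse Q * (- inverse (inverse Q ^ y * X) * - inverse (a * Q ^ y * X))"
          using nz that by (simp add: power_inverse divide_simps eval_nat_numeral)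
        finally show ?thesis .
      qed
      ultimately show ?thesis
        unfolding J_def using nz by (simp only: prod.distrib[symmetric]) (intro prod.cong refl, simp)
    qed
    have nz': "J b n * J Q n \<noteq> 0" using J_nz nz by simp
    show ?thesis unfolding times_divide_eq_left nonzero_divide_eq_eq[OF nz'] using * by (simp only: mult_ac)
  qed
  have summand: "(\<Prod>i<y. - (c * Q ^ i)) * (racah_coeff (inverse Q) (inverse b) (inverse g) x n
        * qpoch (inverse d * inverse Q ^ n) (inverse Q) (x - n) * racah_basis (inverse Q) (inverse a) (inverse c) n y)
     = J d x * (racah_coeff Q b a y n * qpoch (c * Q ^ n) Q (y - n) * racah_basis Q g d n x)"
    if n: "n \<le> x" "n \<le> y" for n
  proof -
    have 1: "(\<Prod>i<y. - (c * Q ^ i)) * J c y = 1"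
      unfolding J_def prod.distrib[symmetric] using nz by (intro prod.neutral) (auto simp: divide_simps)
    have coeff: "racah_coeff (inverse Q) (inverse b) (inverse g) x n =
       (J (inverse Q ^ x) n * J (g * Q ^ x) n * inverse Q ^ n / (J b n * J Q n))
       * (qpoch (inverse Q ^ x) Q n * qpoch (g * Q ^ x) Q n / (qpoch b Q n * qpoch Q Q n))"
    proof -
      have "qpoch (inverse (inverse Q) ^ x) (inverse Q) n = J (inverse Q ^ x) n * qpoch (inverse Q ^ x) Q n"
        using inv[of "inverse Q ^ x"] nz by (simp add: power_inverse)
      moreover have "qpoch (inverse g * inverse Q ^ x) (inverse Q) n = J (g * Q ^ x) n * qpoch (g * Q ^ x) Q n"
        using inv[of "g * Q ^ x"] nz by (simp add: power_inverse)
      ultimately show ?thesis unfolding racah_coeff_def using nz by (simp add: inv mult_ac)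
    qed
    have basis: "racah_basis (inverse Q) (inverse a) (inverse c) n y =
       (J (inverse Q ^ y) n * J (a * Q ^ y) n) * (J (c * Q ^ n) (y - n))
        * (qpoch (inverse Q ^ y) Q n * qpoch (a * Q ^ y) Q n * qpoch (c * Q ^ n) Q (y - n))"
    proof -
      have "qpoch (inverse (inverse Q) ^ y) (inverse Q) n = J (inverse Q ^ y) n * qpoch (inverse Q ^ y) Q n"
        using inv[of "inverse Q ^ y"] nz by (simp add: power_inverse)
      moreover have "qpoch (inverse a * inverse Q ^ y) (inverse Q) n = J (a * Q ^ y) n * qpoch (a * Q ^ y) Q n"
        using inv[of "a * Q ^ y"] nz by (simp add: power_inverse)
      moreover have "qpoch (inverse c * inverse Q ^ n) (inverse Q) (y - n) = J (c * Q ^ n) (y - n) * qpoch (c * Q ^ n) Q (y - n)"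
        using inv[of "c * Q ^ n"] nz by (simp add: power_inverse)
      ultimately show ?thesis unfolding racah_basis_def by (simp add: mult_ac)
    qed
    have d: "qpoch (inverse d * inverse Q ^ n) (inverse Q) (x - n) = J (d * Q ^ n) (x - n) * qpoch (d * Q ^ n) Q (x - n)"
      using inv[of "d * Q ^ n"] nz by (simp add: power_inverse)
    define R where "R = qpoch (inverse Q ^ x) Q n * qpoch (g * Q ^ x) Q n / (qpoch b Q n * qpoch Q Q n)
        * (qpoch (inverse Q ^ y) Q n * qpoch (a * Q ^ y) Q n * qpoch (c * Q ^ n) Q (y - n)) * qpoch (d * Q ^ n) Q (x - n)"
    have "(\<Prod>i<y. - (c * Q ^ i)) * (racah_coeff (inverse Q) (inverse b) (inverse g) x n
        * qpoch (inverse d * inverse Q ^ n) (inverse Q) (x - n) * racah_basis (inverse Q) (inverse a) (inverse c) n y)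
      = (\<Prod>i<y. - (c * Q ^ i)) * (J (inverse Q ^ x) n * J (g * Q ^ x) n * inverse Q ^ n / (J b n * J Q n)
           * (J (inverse Q ^ y) n * J (a * Q ^ y) n)) * J (c * Q ^ n) (y - n) * J (d * Q ^ n) (x - n) * R"
      unfolding coeff basis d R_def by (simp only: mult_ac)
    also have "\<dots> = ((\<Prod>i<y. - (c * Q ^ i)) * (J c n * J (c * Q ^ n) (y - n))) * (J d n * J (d * Q ^ n) (x - n)) * (Q ^ n * R)"
      unfolding J_key by (simp only: mult_ac)
    also have "\<dots> = J d x * (Q ^ n * R)"
      unfolding J_split[OF n(1), symmetric] J_split[OF n(2), symmetric] 1 by simp
    also have "Q ^ n * R = racah_coeff Q b a y n * qpoch (c * Q ^ n) Q (y - n) * racah_basis Q g d n x"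
      by (simp add: R_def racah_coeff_def racah_basis_def)
    finally show ?thesis .
  qed
  have Qi: "inverse Q \<noteq> 0" using nz by simp
  have J_eq: "(\<Prod>i<x. - inverse (d * Q ^ i)) = J d x" by (simp only: J_def)
  show ?thesis
    unfolding racah_min[OF nz(1)] racah_min[OF Qi] sum_distrib_left J_eq
    by (intro sum.cong) (auto simp: summand min.commute)
qed

section \<open>Powers of q, and the continuous extension in v\<close>

lemma cpw_add: "q > 0 \<Longrightarrow> cpw q r * cpw q s = cpw q (r + s)"
  by (simp add: powr_add)

lemma cpw_power: "q > 0 \<Longrightarrow> cpw q r ^ n = cpw q (real n * r)"
  by (simp add: powr_power mult.commute flip: of_real_power)

lemma cpw_inverse: "inverse (cpw q r) = cpw q (- r)"
  by (simp add: powr_minus)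

lemma norm_cpw: "norm (cpw q r) = q powr r"
  by simp

lemma powr_eq_1_iff:
  fixes q r :: real
  assumes "q > 0" "q \<noteq> 1"
  shows "q powr r = 1 \<longleftrightarrow> r = 0"
  using assms by (auto simp: powr_def)

lemma cpw_eq_1_iff:
  assumes "q > 0" "q \<noteq> 1"
  shows "cpw q r = 1 \<longleftrightarrow> r = 0"
  using powr_eq_1_iff[OF assms, of r] by (metis of_real_eq_1_iff)

text \<open>The product converts the factorial in base q^-2 of \<open>p_AW_raw\<close> into (d;Q)_y,
  which \<open>racah\<close> absorbs. Away from v = 0 no pole in v is left, so this is the
  continuous extension.\<close>

definition p_AW_poly :: "nat \<Rightarrow> nat \<Rightarrow> real \<Rightarrow> real \<Rightarrow> complex \<Rightarrow> real \<Rightarrow> real \<Rightarrow> complex" where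
  "p_AW_poly y x lam rho v k q = (\<Prod>i<y. - (v * inverse (cpw q (rho + lam + k + 1)) * inverse (cpw q 2) ^ i))
     * racah (cpw q 2) (cpw q (2 * lam + 2 * k)) (cpw q (2 * k)) (cpw q (2 * rho + 2 * k))
         (v * cpw q (rho + lam + k + 1)) (inverse v * cpw q (rho + lam + k + 1)) x y"

lemma p_AW_raw_eq_poly:
  assumes q: "q > 0" "q \<noteq> 1" and k: "k > 0" and v: "v \<noteq> 0"
    and nz: "qpoch (v * cpw q (rho + lam + k + 1)) (cpw q 2) (min y x) \<noteq> 0"
      "qpoch (inverse v * cpw q (rho + lam + k + 1)) (cpw q 2) (min y x) \<noteq> 0"
  shows "p_AW_raw y x lam rho v k q = p_AW_poly y x lam rho v k q"
proof -
  define Q e a b g where "Q = cpw q 2" and "e = cpw q (rho + lam + k + 1)" and "a = cpw q (2 * lam + 2 * k)"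
    and "b = cpw q (2 * k)" and "g = cpw q (2 * rho + 2 * k)"
  have Q0: "Q \<noteq> 0" "e \<noteq> 0" using q by (simp_all add: Q_def e_def)
  have params: "cpw q (- 2 * real y) = inverse Q ^ y" "cpw q (- 2 * real x) = inverse Q ^ x"
    "cpw q (2 * real y + 2 * lam + 2 * k) = a * Q ^ y" "cpw q (2 * real x + 2 * rho + 2 * k) = g * Q ^ x"
    "cpw q (- rho - lam - k - 1) = inverse e" "cpw q (-2) = inverse Q"
  proof -
    have "- rho - lam - k - 1 = - (rho + lam + k + 1)" by simp
    thus "cpw q (- rho - lam - k - 1) = inverse e" unfolding e_def cpw_inverse by (simp only:)
    show "cpw q (- 2 * real y) = inverse Q ^ y" "cpw q (- 2 * real x) = inverse Q ^ x"
      "cpw q (2 * real y + 2 * lam + 2 * k) = a * Q ^ y" "cpw q (2 * real x + 2 * rho + 2 * k) = g * Q ^ x" "cpw q (-2) = inverse Q"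
      unfolding Q_def a_def g_def cpw_inverse cpw_power[OF q(1)] cpw_add[OF q(1)]
      by (simp_all add: mult.commute add_ac)
  qed
  define F where "F = (\<Prod>i<y. - (v * inverse e * inverse Q ^ i))"
  have F: "qpoch (v * inverse e) (inverse Q) y = F * qpoch (inverse v * e) Q y"
    using qpoch_inverse_base[of "inverse v * e" Q y] v Q0
    by (simp add: F_def power_inverse)
  define t where "t = (\<lambda>n. qpoch (inverse Q ^ y) Q n * qpoch (a * Q ^ y) Q n * qpoch (inverse Q ^ x) Q n * qpoch (g * Q ^ x) Q n
          / (qpoch b Q n * qpoch (v * e) Q n * qpoch (inverse v * e) Q n) * (Q ^ n / qpoch Q Q n))"
  have "phi43 (inverse Q ^ y) (a * Q ^ y) (inverse Q ^ x) (g * Q ^ x) b (v * e) (inverse v * e) Q Q = (\<Sum>n\<le>min x y. t n)"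
    unfolding phi43_def t_def using Q0
    by (intro suminf_finite) (auto simp: qpoch_inverse_power_eq_0 not_le)
  hence "p_AW_raw y x lam rho v k q = (\<Sum>n\<le>min x y. qpoch (v * e) Q x * (F * qpoch (inverse v * e) Q y) * t n)"
    unfolding p_AW_raw_def params Q_def[symmetric] e_def[symmetric] b_def[symmetric] F by (simp add: sum_distrib_left)
  also have "\<dots> = (\<Sum>n\<le>min x y. F * (racah_coeff Q b g x n * qpoch (v * e * Q ^ n) Q (x - n) * racah_basis Q a (inverse v * e) n y))"
  proof (intro sum.cong refl)
    fix n assume "n \<in> {..min x y}"
    hence n: "n \<le> x" "n \<le> y" "n \<le> min y x" by auto
    have split: "qpoch s Q m = qpoch s Q n * qpoch (s * Q ^ n) Q (m - n)" if "n \<le> m" for s m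
      using qpoch_add[of s Q n "m - n"] that by simp
    have "qpoch (v * e) Q n \<noteq> 0" "qpoch (inverse v * e) Q n \<noteq> 0"
      using nz split[OF n(3)] unfolding Q_def e_def by auto
    thus "qpoch (v * e) Q x * (F * qpoch (inverse v * e) Q y) * t n
       = F * (racah_coeff Q b g x n * qpoch (v * e * Q ^ n) Q (x - n) * racah_basis Q a (inverse v * e) n y)"
      unfolding split[OF n(1), of "v * e"] split[OF n(2), of "inverse v * e"] t_def racah_coeff_def racah_basis_def
      by (simp add: mult_ac)
  qed
  also have "\<dots> = p_AW_poly y x lam rho v k q"
    unfolding p_AW_poly_def racah_min[OF Q0(1)[unfolded Q_def]] F_def params
    by (simp add: Q_def e_def a_def b_def g_def sum_distrib_left)
  finally show ?thesis .
qed

lemma isCont_p_AW_poly: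
  assumes "v \<noteq> 0"
  shows "isCont (\<lambda>u. p_AW_poly y x lam rho u k q) v"
  unfolding p_AW_poly_def racah_def racah_basis_def qpoch_def using assms
  by (intro continuous_intros) auto

text \<open>Only finitely many u make a denominator vanish, so the raw form and
  \<open>p_AW_poly\<close> agree on a punctured neighbourhood of v; continuity of the latter
  identifies the limit in \<open>p_AW\<close>.\<close>

lemma p_AW_eq_poly:
  assumes q: "q > 0" "q \<noteq> 1" and k: "k > 0" and v: "v \<noteq> 0"
  shows "p_AW y x lam rho v k q = p_AW_poly y x lam rho v k q"
proof -
  define e Q where "e = cpw q (rho + lam + k + 1)" and "Q = cpw q 2"
  have e0: "e \<noteq> 0" "Q \<noteq> 0" using q by (simp_all add: e_def Q_def)
  have "\<forall>\<^sub>F u in at v. \<forall>i\<in>{..<min y x}. u \<noteq> 0 \<and> u \<noteq> inverse (e * Q ^ i) \<and> u \<noteq> e * Q ^ i"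
    by (intro eventually_ball_finite ballI eventually_conj eventually_neq_at_within) auto
  moreover have "\<forall>\<^sub>F u in at v. u \<noteq> 0"
    using v by (intro eventually_neq_at_within)
  ultimately have "\<forall>\<^sub>F u in at v. p_AW_poly y x lam rho u k q = p_AW_raw y x lam rho u k q"
  proof eventually_elim
    case (elim u)
    have "u * e * Q ^ i \<noteq> 1" "inverse u * e * Q ^ i \<noteq> 1" if "i < min y x" for i
      using elim that e0 by (auto simp: field_simps)
    hence "qpoch (u * e) Q (min y x) \<noteq> 0" "qpoch (inverse u * e) Q (min y x) \<noteq> 0"
      by (blast intro!: qpoch_nonzero)+
    thus ?case using elim unfolding e_def Q_def by (intro p_AW_raw_eq_poly[OF q k, symmetric])
  qed
  hence "((\<lambda>u. p_AW_raw y x lam rho u k q) \<longlongrightarrow> p_AW_poly y x lam rho v k q) (at v)"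
    by (rule Lim_transform_eventually[rotated]) (use isCont_p_AW_poly[OF v] in \<open>simp add: isCont_def\<close>)
  hence "Lim (at v) (\<lambda>u. p_AW_raw y x lam rho u k q) = p_AW_poly y x lam rho v k q"
    by (intro tendsto_Lim) auto
  thus ?thesis using p_AW_raw_eq_poly[OF q k v, of rho lam y x] by (auto simp: p_AW_def)
qed

text \<open>Inverting q inverts Q, a, b, g and turns c, d into the inverses of d, c, the
  constellation of \<open>racah_inverse_base\<close>; the prefactors of the two functions are its
  two products.\<close>

lemma p_AW_inverse_base:
  assumes q: "q > 0" "q \<noteq> 1" and k: "k > 0" and v: "v \<noteq> 0"
  shows "p_AW y x lam rho v k (inverse q) = p_AW x y rho lam v k q"
proof -
  have q': "inverse q > 0" "inverse q \<noteq> 1" using q by auto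
  have inv: "cpw (inverse q) r = inverse (cpw q r)" for r
    using q by (simp add: powr_minus inverse_powr)
  define Q e a b g where "Q = cpw q 2" and "e = cpw q (rho + lam + k + 1)" and "a = cpw q (2 * lam + 2 * k)"
    and "b = cpw q (2 * k)" and "g = cpw q (2 * rho + 2 * k)"
  have nz: "Q \<noteq> 0" "a \<noteq> 0" "b \<noteq> 0" "g \<noteq> 0" "v * e \<noteq> 0" "inverse v * e \<noteq> 0"
    using q v by (simp_all add: Q_def a_def b_def g_def e_def)
  have g: "a * g * Q = b * (v * e) * (inverse v * e)"
  proof -
    have "a * g * Q = b * (e * e)"
      unfolding Q_def a_def b_def g_def e_def cpw_add[OF q(1)] by (simp add: algebra_simps)
    thus ?thesis using v by simp
  qed
  show ?thesis
    using racah_inverse_base[OF nz g, of y x]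
    unfolding p_AW_eq_poly[OF q' k v] p_AW_eq_poly[OF q k v] p_AW_poly_def inv
    by (simp add: Q_def e_def a_def b_def g_def power_inverse add_ac)
qed

text \<open>Read backwards and stripped of powers, (Q^-x;Q)_x and (1/(g Q^(2x));Q)_x become (Q;Q)_x
  and (g Q^(x+1);Q)_x. The factor \<open>vwp_front\<close> moves (g Q^x;Q)_x to (g
  Q^(x+1);Q)_x.\<close>

lemma racah_norm_diagonal:
  fixes Q g :: "'a::{real_normed_field,banach}"
  assumes Q: "Q \<noteq> 0" "norm Q < 1" and g: "g \<noteq> 0" and gx: "g * Q ^ x \<noteq> 1"
  shows "qpoch (inverse Q ^ x) Q x * qpoch (g * Q ^ x) Q x * vwp_front Q g x
    = qpoch Q Q x * (g * Q ^ x) ^ x * qpoch (1 / (g * Q ^ (2 * x))) Q x"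
proof -
  have flip: "prod f {..<x} = (\<Prod>i<x. f (x - Suc i))" for f :: "nat \<Rightarrow> 'a"
    by (rule prod.nat_diff_reindex[symmetric])
  have 1: "qpoch (inverse Q ^ x) Q x = (\<Prod>i<x. - inverse (Q ^ Suc i)) * qpoch Q Q x"
  proof -
    have "qpoch (inverse Q ^ x) Q x = (\<Prod>i<x. 1 - inverse (Q ^ Suc i))"
      unfolding qpoch_def
    proof (subst flip, intro prod.cong refl)
      fix i assume "i \<in> {..<x}"
      hence "inverse Q ^ x * Q ^ (x - Suc i) = inverse (Q ^ Suc i)"
        using Q by (simp add: power_inverse power_diff field_simps)
      thus "1 - inverse Q ^ x * Q ^ (x - Suc i) = 1 - inverse (Q ^ Suc i)" by simp
    qed
    also have "\<dots> = (\<Prod>i<x. - inverse (Q ^ Suc i) * (1 - Q * Q ^ i))"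
      using Q by (intro prod.cong refl) (simp add: field_simps)
    finally show ?thesis unfolding qpoch_def prod.distrib .
  qed
  have 2: "qpoch (1 / (g * Q ^ (2 * x))) Q x = (\<Prod>i<x. - inverse (g * Q ^ x * Q ^ Suc i)) * qpoch (g * Q ^ Suc x) Q x"
  proof -
    have "qpoch (1 / (g * Q ^ (2 * x))) Q x = (\<Prod>i<x. 1 - inverse (g * Q ^ x * Q ^ Suc i))"
      unfolding qpoch_def
    proof (subst flip, intro prod.cong refl)
      fix i assume i: "i \<in> {..<x}"
      have "Q ^ (2 * x) = Q ^ x * Q ^ Suc i * Q ^ (x - Suc i)"
        using i by (simp add: power_add[symmetric] mult_2 del: power_Suc)
      hence "1 / (g * Q ^ (2 * x)) * Q ^ (x - Suc i) = inverse (g * Q ^ x * Q ^ Suc i)"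
        using Q g by (simp add: divide_simps)
      thus "1 - 1 / (g * Q ^ (2 * x)) * Q ^ (x - Suc i) = 1 - inverse (g * Q ^ x * Q ^ Suc i)" by simp
    qed
    also have "\<dots> = (\<Prod>i<x. - inverse (g * Q ^ x * Q ^ Suc i) * (1 - g * Q ^ Suc x * Q ^ i))"
      using Q g by (intro prod.cong refl) (simp add: field_simps)
    finally show ?thesis unfolding qpoch_def prod.distrib .
  qed
  have 3: "qpoch (g * Q ^ x) Q x * vwp_front Q g x = qpoch (g * Q ^ Suc x) Q x"
  proof (cases "x = 0")
    case False
    have "qpoch (g * Q ^ x) Q x * (1 - g * (Q ^ x)\<^sup>2) = (1 - g * Q ^ x) * qpoch (g * Q ^ Suc x) Q x"
      using qpoch_Suc[of "g * Q ^ x" Q x] qpoch_Suc_left[of "g * Q ^ x" Q x]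
      by (simp add: power2_eq_square mult_ac)
    moreover have "1 - g * Q ^ x \<noteq> 0" using gx by simp
    ultimately show ?thesis using False by (simp add: vwp_front_def divide_simps mult_ac)
  qed (simp add: vwp_front_def)
  have 4: "(\<Prod>i<x. - inverse (Q ^ Suc i)) = (g * Q ^ x) ^ x * (\<Prod>i<x. - inverse (g * Q ^ x * Q ^ Suc i))"
  proof -
    have "(g * Q ^ x) ^ x = (\<Prod>i<x. g * Q ^ x)" by simp
    thus ?thesis unfolding prod.distrib[symmetric] using Q g by (simp only: prod.distrib[symmetric]) (intro prod.cong refl, simp add: divide_simps)
  qed
  have "qpoch (inverse Q ^ x) Q x * qpoch (g * Q ^ x) Q x * vwp_front Q g x
     = (\<Prod>i<x. - inverse (Q ^ Suc i)) * qpoch Q Q x * (qpoch (g * Q ^ x) Q x * vwp_front Q g x)"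
    unfolding 1 by (simp only: mult_ac)
  also have "\<dots> = qpoch Q Q x * (g * Q ^ x) ^ x * qpoch (1 / (g * Q ^ (2 * x))) Q x"
    unfolding 2 3 4 by (simp only: mult_ac)
  finally show ?thesis .
qed

text \<open>Up to the two products that become the denominator of omega, the norm is the reciprocal
  of a weight in the dual variable x, with g in the role of a.\<close>

lemma racah_norm_eq:
  fixes Q g :: "'a::{real_normed_field,banach}"
  assumes Q: "Q \<noteq> 0" "norm Q < 1" and g: "1 < norm (g * Q ^ (2 * x))"
    and b: "\<And>i. b * Q ^ i \<noteq> 1" and bg: "\<And>i. b / (g * Q ^ x) * Q ^ i \<noteq> 1"
  shows "racah_norm Q b g c d x = qpoch_inf (c / (g * Q ^ x)) Q * qpoch_inf (d / (g * Q ^ x)) Q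
    / (vwp_front Q g x * (qpoch b Q x / qpoch Q Q x)
      * (qpoch_inf (1 / (g * Q ^ x)) Q / qpoch_inf (b / (g * Q ^ x)) Q) * inverse ((g * Q ^ x) ^ x))"
  (is "_ = ?c * ?d / (?F * (?B / ?R) * (?I / ?J) * inverse ?G)")
proof -
  let ?P = "qpoch (1 / (g * Q ^ (2 * x))) Q x"
  have g0: "g \<noteq> 0" using g by auto
  \<comment> \<open>The hypothesis on g gives |g Q^j| > 1 >= |Q^i| for j <= 2x, so no factor built
    from g and Q alone vanishes.\<close>
  have small: "1 / (g * Q ^ j) * Q ^ i \<noteq> 1" if "j \<le> 2 * x" for i j
  proof
    assume "1 / (g * Q ^ j) * Q ^ i = 1"
    hence "norm (g * Q ^ j) = norm (Q ^ i)" using Q g0 by (simp add: divide_simps)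
    also have "\<dots> \<le> 1" using Q by (simp add: norm_power power_le_one)
    finally have "norm g * norm Q ^ j \<le> 1" by (simp add: norm_mult norm_power)
    moreover have "norm g * norm Q ^ (2 * x) \<le> norm g * norm Q ^ j"
      using Q that by (intro mult_left_mono power_decreasing) auto
    ultimately show False using g by (simp add: norm_mult norm_power)
  qed
  have split: "qpoch_inf (1 / (g * Q ^ (2 * x))) Q = ?P * ?I"
  proof -
    have "1 / (g * Q ^ (2 * x)) * Q ^ x = 1 / (g * Q ^ x)"
      using Q by (simp add: mult_2 power_add)
    thus ?thesis using qpoch_inf_split[OF Q(2), of "1 / (g * Q ^ (2 * x))" x] by simp
  qed
  have "1 - g * (Q ^ x)\<^sup>2 \<noteq> 0" "1 - g * Q ^ x \<noteq> 0"
    using small[of "2 * x" 0] small[of x 0] Q(1) by (auto simp: power_mult[symmetric] mult.commute)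
  hence F: "?F \<noteq> 0" by (simp add: vwp_front_def)
  have "?J \<noteq> 0" by (rule qpoch_inf_nonzero[OF Q(2) bg])
  moreover have "?I \<noteq> 0" using small[of x] by (intro qpoch_inf_nonzero[OF Q(2)]) auto
  moreover have "?B \<noteq> 0" using b by (intro qpoch_nonzero) auto
  moreover have "?R \<noteq> 0" using power_Suc_neq_1[OF Q(2)] by (intro qpoch_nonzero) auto
  moreover have "?P \<noteq> 0" using small[of "2 * x"] by (intro qpoch_nonzero) auto
  moreover have "?G \<noteq> 0" using Q g0 by simp
  ultimately have nz: "?B \<noteq> 0" "?J \<noteq> 0" "?G \<noteq> 0" "?P \<noteq> 0" "?I \<noteq> 0" "?R \<noteq> 0"
    by blast+
  have "g * Q ^ x \<noteq> 1" using small[of x 0] Q(1) by auto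
  note diag = racah_norm_diagonal[OF Q g0 this]
  have "racah_norm Q b g c d x * (?F * (?B / ?R) * (?I / ?J) * inverse ?G)
     = (qpoch (inverse Q ^ x) Q x * qpoch (g * Q ^ x) Q x * ?F) * (?c * ?d / (?P * ?R * ?G))"
    unfolding racah_norm_def split using nz Q(1) g0 by (simp add: divide_simps)
  also have "\<dots> = ?c * ?d"
    unfolding diag using nz Q(1) g0 by (simp add: divide_simps)
  finally have "racah_norm Q b g c d x * (?F * (?B / ?R) * (?I / ?J) * inverse ?G) = ?c * ?d" .
  moreover have "?F * (?B / ?R) * (?I / ?J) * inverse ?G \<noteq> 0" using nz F by simp
  ultimately show ?thesis by (simp only: nonzero_eq_divide_eq not_False_eq_True)
qed

section \<open>The one-site relation in terms of q\<close>

lemma powr_less_1: "0 < (q::real) \<Longrightarrow> q < 1 \<Longrightarrow> 0 < r \<Longrightarrow> q powr r < 1"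
  using powr_less_mono2[of r q 1] by simp

lemma powr_le_1: "0 < (q::real) \<Longrightarrow> q < 1 \<Longrightarrow> 0 \<le> r \<Longrightarrow> q powr r \<le> 1"
  using powr_mono2[of r q 1] by simp

lemma powr_gt_1: "0 < (q::real) \<Longrightarrow> q < 1 \<Longrightarrow> r < 0 \<Longrightarrow> 1 < q powr r"
  using powr_less_1[of q "- r"] by (simp add: powr_minus one_less_inverse_iff inverse_less_1_iff)

lemma of_real_w_front:
  assumes "q > 0"
  shows "complex_of_real (w_front z a k q) = vwp_front (cpw q 2) (cpw q (2 * a + 2 * k)) z
    * (qpoch (cpw q (2 * k)) (cpw q 2) z / qpoch (cpw q 2) (cpw q 2) z)"
proof -
  have "cpw q (2 * a + 2 * k) * (cpw q 2 ^ z)\<^sup>2 = cpw q (4 * real z + 2 * a + 2 * k)"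
    "cpw q (2 * a + 2 * k) * cpw q 2 ^ z = cpw q (2 * real z + 2 * a + 2 * k)"
    unfolding cpw_power[OF assms] cpw_add[OF assms] by (simp_all add: algebra_simps)
  thus ?thesis unfolding w_front_def vwp_front_def by (simp add: of_real_qpoch)
qed

text \<open>Between the functions for v and 1/v the powers of v cancel; the power of q that is left
  combines with the Gaussian factor of \<open>w_dyn_gt\<close> to the geometric factor (a Q/(b c
  d))^y of \<open>racah_weight\<close>.\<close>

lemma p_AW_prefactor:
  assumes q: "q > 0" and v: "v \<noteq> 0"
  shows "(\<Prod>i<y. - (v * inverse (cpw q A) * inverse (cpw q 2) ^ i)) * (\<Prod>i<y. - (inverse v * inverse (cpw q A) * inverse (cpw q 2) ^ i))
    = cpw q (- 2 * real y * A - 2 * real y * (real y - 1))"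
proof (induction y)
  case (Suc y)
  have "- (v * inverse (cpw q A) * inverse (cpw q 2) ^ y) * - (inverse v * inverse (cpw q A) * inverse (cpw q 2) ^ y)
     = (inverse (cpw q A) * inverse (cpw q 2) ^ y) * (inverse (cpw q A) * inverse (cpw q 2) ^ y)"
    using v by simp
  also have "\<dots> = cpw q (- 2 * A - 4 * real y)"
    unfolding cpw_inverse cpw_power[OF q] cpw_add[OF q] by (simp add: algebra_simps)
  finally have step: "- (v * inverse (cpw q A) * inverse (cpw q 2) ^ y) * - (inverse v * inverse (cpw q A) * inverse (cpw q 2) ^ y)
     = cpw q (- 2 * A - 4 * real y)" .
  have "s * t * (s' * t') = s * s' * (t * t')" for s t s' t' :: complex by (simp only: mult_ac)
  hence "(\<Prod>i<Suc y. - (v * inverse (cpw q A) * inverse (cpw q 2) ^ i)) * (\<Prod>i<Suc y. - (inverse v * inverse (cpw q A) * inverse (cpw q 2) ^ i))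
    = cpw q (- 2 * real y * A - 2 * real y * (real y - 1)) * cpw q (- 2 * A - 4 * real y)"
    unfolding prod.lessThan_Suc step[symmetric] Suc.IH[symmetric] by blast
  also have "\<dots> = cpw q (- 2 * real (Suc y) * A - 2 * real (Suc y) * (real (Suc y) - 1))"
    unfolding cpw_add[OF q] by (simp add: algebra_simps)
  finally show ?case .
qed (use q in simp)

text \<open>The inequalities on x and x' admit rho above -1, as heights inside the lattice require;
  there too the norm is given by the second branch \<open>w_dyn_le\<close>.\<close>

lemma one_site_orthogonality:
  fixes q k lam rho :: real and v :: complex
  assumes q: "0 < q" "q < 1" and k: "0 < k" and lam: "-1 < lam" and v: "v \<noteq> 0"
    and x: "2 * real x + k + rho < 0" "2 * real x' + k + rho < 0"
  shows "(\<lambda>y. p_AW y x lam rho v k q * p_AW y x' lam rho (inverse v) k q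
        * complex_of_real (w_dyn y lam k q) * omega_num y lam rho k v q) sums
    (if x = x' then omega_den x lam rho k v q / complex_of_real (w_dyn_le x rho k q) else 0)"
proof -
  define Q e a b g where "Q = cpw q 2" and "e = cpw q (rho + lam + k + 1)" and "a = cpw q (2 * lam + 2 * k)"
    and "b = cpw q (2 * k)" and "g = cpw q (2 * rho + 2 * k)"
  define c d where "c = v * e" and "d = inverse v * e"
  have q1: "q \<noteq> 1" "\<bar>q powr 2\<bar> < 1" using q powr_less_1[of q 2] by auto
  note cpw = cpw_inverse cpw_power[OF q(1)] cpw_add[OF q(1)]
  have nz: "Q \<noteq> 0" "a \<noteq> 0" "b \<noteq> 0" "c \<noteq> 0" "d \<noteq> 0" "e \<noteq> 0" "g \<noteq> 0"
    using q v by (simp_all add: Q_def a_def b_def c_def d_def e_def g_def)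
  have Q: "norm Q < 1" unfolding Q_def norm_cpw using q by (intro powr_less_1) auto
  have agQ: "a * g * Q = b * c * d"
  proof -
    have "a * g * Q = b * (e * e)"
      unfolding Q_def a_def b_def g_def e_def cpw by (simp add: algebra_simps)
    thus ?thesis using v by (simp add: c_def d_def)
  qed
  have aQ: "a * Q ^ Suc m \<noteq> 1" for m
    unfolding a_def Q_def cpw using lam k by (subst cpw_eq_1_iff[OF q(1) q1(1)]) (simp add: algebra_simps)
  have bQ: "b * Q ^ m \<noteq> 1" for m
    unfolding b_def Q_def cpw using k by (subst cpw_eq_1_iff[OF q(1) q1(1)]) (simp add: algebra_simps)
  have gt: "1 < norm (g * Q ^ n)" if "real n + rho + k < 0" for n
    unfolding g_def Q_def cpw norm_cpw using that by (intro powr_gt_1 q) (simp add: algebra_simps)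
  have tail: "vwp_tail Q a b c d (Suc y) = qpoch_inf (cpw q (2 * real y + 2 * lam + 2)) Q
     * omega_num y lam rho k v q / qpoch_inf (cpw q (2 * real y + 2 * lam + 2 * k + 2)) Q" for y
  proof -
    have 0: "a * inverse e * Q ^ Suc y = cpw q (2 * real y + k + lam - rho + 1)"
      unfolding a_def e_def Q_def cpw by (simp add: algebra_simps)
    have "a / b * Q ^ Suc y = cpw q (2 * real y + 2 * lam + 2)" "a * Q ^ Suc y = cpw q (2 * real y + 2 * lam + 2 * k + 2)"
      unfolding a_def b_def Q_def divide_inverse cpw by (simp_all add: algebra_simps)
    moreover have "a / c * Q ^ Suc y = inverse v * cpw q (2 * real y + k + lam - rho + 1)"
      "a / d * Q ^ Suc y = v * cpw q (2 * real y + k + lam - rho + 1)"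
      unfolding c_def d_def 0[symmetric] using v by (simp_all add: divide_inverse mult_ac)
    ultimately show ?thesis by (simp add: vwp_tail_def omega_num_def Q_def mult_ac)
  qed
  have summand: "p_AW y x lam rho v k q * p_AW y x' lam rho (inverse v) k q
        * complex_of_real (w_dyn y lam k q) * omega_num y lam rho k v q
     = racah_weight Q a b c d y * racah Q a b g c d x y * racah Q a b g d c x' y" for y
  proof -
    have "cpw q (- 2 * real y * (rho + lam + k + 1) - 2 * real y * (real y - 1)) * cpw q (2 * real y * (real y + lam))
       = (a * Q / (b * c * d)) ^ y"
    proof -
      have "a * Q / (b * c * d) = a * Q * inverse b * inverse e * inverse e"
        using v by (simp add: c_def d_def divide_inverse)
      thus ?thesis
        unfolding a_def b_def Q_def e_def by (simp only: cpw) (simp add: algebra_simps)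
    qed
    hence pw: "cpw q (- 2 * real y * (rho + lam + k + 1) - 2 * real y * (real y - 1)) * (cpw q (2 * real y * (real y + lam)) * X)
       = (a * Q / (b * c * d)) ^ y * X" for X by (simp add: mult.assoc[symmetric])
    have w: "complex_of_real (w_dyn y lam k q) = vwp_front Q a y * (qpoch b Q y / qpoch Q Q y)
        * (qpoch_inf (cpw q (2 * real y + 2 * lam + 2)) Q / qpoch_inf (cpw q (2 * real y + 2 * lam + 2 * k + 2)) Q)
        * cpw q (2 * real y * (real y + lam))"
      using lam by (simp add: w_dyn_def w_dyn_gt_def of_real_w_front[OF q(1)] of_real_qpoch_inf[OF q1(2)] Q_def a_def b_def)
    have p: "p_AW y x lam rho v k q * p_AW y x' lam rho (inverse v) k q
      = cpw q (- 2 * real y * (rho + lam + k + 1) - 2 * real y * (real y - 1)) * (racah Q a b g c d x y * racah Q a b g d c x' y)"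
    proof -
      have iv: "inverse v \<noteq> 0" using v by simp
      show ?thesis
        unfolding p_AW_eq_poly[OF q(1) q1(1) k v] p_AW_eq_poly[OF q(1) q1(1) k iv] p_AW_poly_def p_AW_prefactor[OF q(1) v, symmetric]
        by (simp add: Q_def a_def b_def g_def c_def d_def e_def mult_ac)
    qed
    show ?thesis
      unfolding p w racah_weight_def tail
      using pw[of "racah Q a b g c d x y * racah Q a b g d c x' y * (vwp_front Q a y * (qpoch b Q y / qpoch Q Q y)
        * (qpoch_inf (cpw q (2 * real y + 2 * lam + 2)) Q / qpoch_inf (cpw q (2 * real y + 2 * lam + 2 * k + 2)) Q)) * omega_num y lam rho k v q"]
      by (simp only: mult_ac times_divide_eq_left times_divide_eq_right)
  qed
  have norm: "racah_norm Q b g c d x = omega_den x lam rho k v q / complex_of_real (w_dyn_le x rho k q)"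
  proof -
    have "1 < norm (g * Q ^ (2 * x))" using x by (intro gt) simp
    moreover have "b / (g * Q ^ x) * Q ^ i \<noteq> 1" for i
      unfolding b_def g_def Q_def divide_inverse cpw using x k
      by (subst cpw_eq_1_iff[OF q(1) q1(1)]) (simp add: algebra_simps)
    ultimately have N: "racah_norm Q b g c d x = qpoch_inf (c / (g * Q ^ x)) Q * qpoch_inf (d / (g * Q ^ x)) Q
      / (vwp_front Q g x * (qpoch b Q x / qpoch Q Q x)
      * (qpoch_inf (1 / (g * Q ^ x)) Q / qpoch_inf (b / (g * Q ^ x)) Q) * inverse ((g * Q ^ x) ^ x))"
      by (intro racah_norm_eq[OF nz(1) Q _ bQ])
    have "e * inverse (g * Q ^ x) = cpw q (- 2 * real x - k + lam - rho + 1)"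
      unfolding e_def g_def Q_def cpw by (simp add: algebra_simps)
    hence cd: "c / (g * Q ^ x) = v * cpw q (- 2 * real x - k + lam - rho + 1)"
      "d / (g * Q ^ x) = inverse v * cpw q (- 2 * real x - k + lam - rho + 1)"
      unfolding c_def d_def divide_inverse by (simp_all only: mult.assoc)
    have rest: "1 / (g * Q ^ x) = cpw q (- 2 * real x - 2 * rho - 2 * k)" "b / (g * Q ^ x) = cpw q (- 2 * real x - 2 * rho)"
      "inverse ((g * Q ^ x) ^ x) = cpw q (- 2 * real x * (real x + rho + k))"
      unfolding b_def g_def Q_def divide_inverse mult_1 cpw
      by (rule arg_cong[where f = "cpw q"], simp add: algebra_simps)+
    show ?thesis
      unfolding N cd rest
      by (simp add: omega_den_def w_dyn_le_def of_real_w_front[OF q(1)] of_real_qpoch_inf[OF q1(2)] Q_def b_def g_def)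
  qed
  have "1 < norm (g * Q ^ (x + x'))" using x by (intro gt) simp
  from racah_orthogonality[OF nz(1) Q nz(2-5) aQ bQ agQ this]
  show ?thesis unfolding summand norm .
qed

section \<open>Growth bounds\<close>

text \<open>Uniform over lam >= lam0, because the left height of a site varies with the
  configuration but never falls below the boundary height. The exponent adds the size of the
  prefactor and the growth |Q|^(-xy) from \<open>racah_bound\<close>.\<close>

lemma p_AW_bound:
  assumes q: "0 < q" "q < 1" and k: "0 < k" and v: "v \<noteq> 0"
  shows "\<exists>C>0. \<forall>lam\<ge>lam0. \<forall>y. norm (p_AW y x lam rho v k q)
    \<le> C * (norm v ^ y * q powr (- real y * (rho + lam + k + 1) - real y * (real y - 1) - 2 * real x * real y))"
proof -
  define Q where "Q = cpw q 2"
  have Q: "Q \<noteq> 0" "norm Q < 1"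
    unfolding Q_def norm_cpw using q by (simp_all add: powr_less_1 del: powr_numeral)
  \<comment> \<open>Since q < 1, the norms of a, c and d over all lam >= lam0 are largest at
    lam0.\<close>
  define A where "A = Max {q powr (2 * lam0 + 2 * k), norm v * q powr (rho + lam0 + k + 1), norm (inverse v) * q powr (rho + lam0 + k + 1)}"
  obtain C where C: "C > 0" "\<And>a c d y. norm a \<le> A \<Longrightarrow> norm c \<le> A \<Longrightarrow> norm d \<le> A \<Longrightarrow>
      norm (racah Q a (cpw q (2 * k)) (cpw q (2 * rho + 2 * k)) c d x y) * norm Q ^ (x * y) \<le> C"
    using racah_bound[OF Q, of A "cpw q (2 * k)" "cpw q (2 * rho + 2 * k)" x] by blast
  have "norm (p_AW y x lam rho v k q)
    \<le> C * (norm v ^ y * q powr (- real y * (rho + lam + k + 1) - real y * (real y - 1) - 2 * real x * real y))"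
    if lam: "lam \<ge> lam0" for lam y
  proof -
    define e where "e = rho + lam + k + 1"
    have pre: "norm (\<Prod>i<y. - (v * inverse (cpw q e) * inverse Q ^ i)) = norm v ^ y * q powr (- real y * e - real y * (real y - 1))"
    proof (induction y)
      case (Suc y)
      have "norm (- (v * inverse (cpw q e) * inverse Q ^ y)) = norm v * q powr (- e - 2 * real y)"
        unfolding Q_def cpw_inverse cpw_power[OF q(1)] mult.assoc cpw_add[OF q(1)] norm_minus_cancel norm_mult norm_cpw
        by (simp add: algebra_simps)
      hence "norm (\<Prod>i<Suc y. - (v * inverse (cpw q e) * inverse Q ^ i))
         = norm v ^ Suc y * (q powr (- real y * e - real y * (real y - 1)) * q powr (- e - 2 * real y))"
        by (simp only: prod.lessThan_Suc norm_mult[of "prod _ _"] Suc.IH) simp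
      also have "q powr (- real y * e - real y * (real y - 1)) * q powr (- e - 2 * real y)
         = q powr (- real (Suc y) * e - real (Suc y) * (real (Suc y) - 1))"
        unfolding powr_add[symmetric] by (rule arg_cong[where f = "\<lambda>r. q powr r"]) (simp add: algebra_simps)
      finally show ?case .
    qed (use q in simp)
    have mono: "q powr r \<le> q powr s" if "s \<le> r" for r s
      using q that by (intro powr_mono') auto
    have "norm (racah Q (cpw q (2 * lam + 2 * k)) (cpw q (2 * k)) (cpw q (2 * rho + 2 * k)) (v * cpw q e) (inverse v * cpw q e) x y)
       * norm Q ^ (x * y) \<le> C"
    proof (rule C(2))
      have "q powr (2 * lam + 2 * k) \<le> q powr (2 * lam0 + 2 * k)" using lam by (intro mono) auto
      thus "norm (cpw q (2 * lam + 2 * k)) \<le> A" unfolding norm_cpw A_def by (simp add: max.coboundedI1)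
      have e: "q powr e \<le> q powr (rho + lam0 + k + 1)" using lam by (intro mono) (auto simp: e_def)
      show "norm (v * cpw q e) \<le> A"
        unfolding norm_mult norm_cpw A_def using mult_left_mono[OF e, of "norm v"] by simp
      show "norm (inverse v * cpw q e) \<le> A"
        unfolding norm_mult norm_cpw A_def using mult_left_mono[OF e, of "norm (inverse v)"] by simp
    qed
    moreover have "norm Q ^ (x * y) = inverse (q powr (- 2 * real x * real y))"
      unfolding Q_def norm_cpw powr_minus[symmetric] using q by (simp add: powr_power mult_ac del: powr_numeral)
    ultimately have R: "norm (racah Q (cpw q (2 * lam + 2 * k)) (cpw q (2 * k)) (cpw q (2 * rho + 2 * k)) (v * cpw q e) (inverse v * cpw q e) x y)
       \<le> C * q powr (- 2 * real x * real y)"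
      using q by (simp add: divide_inverse[symmetric] pos_divide_le_eq del: powr_minus)
    have q1: "q \<noteq> 1" using q by simp
    have "norm (p_AW y x lam rho v k q) \<le> norm v ^ y * q powr (- real y * e - real y * (real y - 1)) * (C * q powr (- 2 * real x * real y))"
      unfolding p_AW_eq_poly[OF q(1) q1 k v] p_AW_poly_def norm_mult[of "prod _ _"] e_def[symmetric] Q_def[symmetric] pre
      using R by (intro mult_left_mono) auto
    also have "\<dots> = C * (norm v ^ y * (q powr (- real y * e - real y * (real y - 1)) * q powr (- 2 * real x * real y)))"
      by (simp only: mult_ac)
    also have "q powr (- real y * e - real y * (real y - 1)) * q powr (- 2 * real x * real y)
       = q powr (- real y * e - real y * (real y - 1) - 2 * real x * real y)"
      unfolding powr_add[symmetric] by (rule arg_cong[where f = "\<lambda>r. q powr r"]) simp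
    finally show ?thesis by (simp only: e_def)
  qed
  thus ?thesis using C(1) by blast
qed

text \<open>Keeps infinite products in denominators away from zero, uniformly in their
  argument.\<close>

lemma qpoch_inf_ge:
  fixes s t Q :: real
  assumes Q: "0 \<le> Q" "Q < 1" and st: "0 \<le> s" "s \<le> t" "t < 1"
  shows "qpoch_inf t Q \<le> qpoch_inf s Q" "0 < qpoch_inf t Q"
proof -
  have Q': "norm Q < 1" using Q by simp
  have small: "t * Q ^ i < 1" for i
  proof -
    have "t * Q ^ i \<le> t * 1" using Q st by (intro mult_left_mono power_le_one) auto
    thus ?thesis using st by simp
  qed
  show "qpoch_inf t Q \<le> qpoch_inf s Q"
  proof (rule LIMSEQ_le[OF qpoch_tendsto_inf[OF Q'] qpoch_tendsto_inf[OF Q']], intro exI allI impI)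
    fix n
    show "qpoch t Q n \<le> qpoch s Q n"
      unfolding qpoch_def using Q st small by (intro prod_mono) (auto intro: mult_right_mono simp: less_imp_le)
  qed
  have "0 \<le> qpoch_inf t Q"
  proof (intro LIMSEQ_le_const[OF qpoch_tendsto_inf[OF Q']] exI[of _ 0] allI impI)
    show "0 \<le> qpoch t Q n" for n
      using small unfolding qpoch_def by (intro prod_nonneg) (simp add: less_imp_le)
  qed
  moreover have "qpoch_inf t Q \<noteq> 0"
    using small by (intro qpoch_inf_nonzero[OF Q']) (metis less_irrefl)
  ultimately show "0 < qpoch_inf t Q" by simp
qed

text \<open>As lam0 > -1, only the first branch of \<open>w_dyn\<close> occurs. The finite
  denominator for y > 0 and the lower infinite product are both compared with their values at t,
  which bounds the arguments that occur there.\<close>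

lemma w_dyn_bound:
  assumes q: "0 < q" "q < 1" and k: "0 < k" and lam0: "-1 < lam0"
  shows "\<exists>C>0. \<forall>lam\<ge>lam0. \<forall>y. \<bar>w_dyn y lam k q\<bar> \<le> C * q powr (2 * real y * (real y + lam))"
proof -
  define Q where "Q = q powr 2"
  have Q: "0 < Q" "Q < 1" "norm Q < 1"
    unfolding Q_def using q powr_less_1[of q 2] by (simp_all del: powr_numeral)
  have mono: "q powr r \<le> q powr s" if "s \<le> r" for r s
    using q that by (intro powr_mono') auto
  define t where "t = q powr (2 * lam0 + 2 * k + 2)"
  have t: "0 \<le> t" "t < 1" unfolding t_def using q lam0 k by (auto intro!: powr_less_1)
  have b1: "q powr (2 * k) * Q ^ m \<noteq> 1" "Q * Q ^ m \<noteq> 1" for m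
    using power_Suc_neq_1[OF Q(3), of m] powr_less_1[OF q, of "2 * k"] k Q
      mult_left_le[of "Q ^ m" "q powr (2 * k)"] power_le_one[of Q m] by (force, simp)
  obtain C1 where C1: "C1 > 0" "\<And>m. norm (qpoch (q powr (2 * k)) Q m * inverse (qpoch Q Q m)) \<le> C1"
    using Bseq_mult[OF qpoch_bounded[OF Q(3)] inverse_qpoch_bounded[OF Q(3) b1(2)], of "q powr (2 * k)"]
    by (auto elim!: BseqE)
  define C2 where "C2 = 1 + 1 / (1 - t)"
  define C3 where "C3 = exp (1 / (1 - Q)) / qpoch_inf t Q"
  have I: "0 < qpoch_inf t Q" using qpoch_inf_ge(2)[of Q t t] Q t by simp
  have pos: "C2 > 0" "C3 > 0" using t I by (simp_all add: C2_def C3_def add_pos_nonneg)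
  have "\<bar>w_dyn y lam k q\<bar> \<le> (C2 * C1) * C3 * q powr (2 * real y * (real y + lam))" if lam: "lam \<ge> lam0" for lam y
  proof -
    have front: "\<bar>if y = 0 then 1 else (1 - q powr (4 * real y + 2 * lam + 2 * k)) / (1 - q powr (2 * real y + 2 * lam + 2 * k))\<bar> \<le> C2"
    proof (cases "y = 0")
      case False
      have 1: "q powr (2 * real y + 2 * lam + 2 * k) \<le> t"
        unfolding t_def using lam False by (intro mono) (auto simp: Suc_leI)
      have "q powr (4 * real y + 2 * lam + 2 * k) \<le> q powr (2 * real y + 2 * lam + 2 * k)"
        by (intro mono) auto
      hence "\<bar>1 - q powr (4 * real y + 2 * lam + 2 * k)\<bar> \<le> 1" using 1 t by simp
      hence "\<bar>1 - q powr (4 * real y + 2 * lam + 2 * k)\<bar> / \<bar>1 - q powr (2 * real y + 2 * lam + 2 * k)\<bar> \<le> 1 / (1 - t)"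
        using 1 t by (intro frac_le) auto
      thus ?thesis using False by (simp add: C2_def)
    qed (use t in \<open>simp add: C2_def\<close>)
    have tails: "\<bar>qpoch_inf (q powr (2 * real y + 2 * lam + 2)) Q / qpoch_inf (q powr (2 * real y + 2 * lam + 2 * k + 2)) Q\<bar> \<le> C3"
      unfolding C3_def abs_divide
    proof (intro frac_le I)
      have "q powr (2 * real y + 2 * lam + 2) \<le> 1" using lam lam0 by (intro powr_le_1 q) auto
      hence "norm (q powr (2 * real y + 2 * lam + 2)) / (1 - norm Q) \<le> 1 / (1 - Q)"
        using Q by (intro frac_le) auto
      thus "\<bar>qpoch_inf (q powr (2 * real y + 2 * lam + 2)) Q\<bar> \<le> exp (1 / (1 - Q))"
        using norm_qpoch_inf_le[OF Q(3), of "q powr (2 * real y + 2 * lam + 2)"]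
        by (metis exp_le_cancel_iff order_trans real_norm_def)
      have "q powr (2 * real y + 2 * lam + 2 * k + 2) \<le> t"
        unfolding t_def using lam by (intro mono) auto
      thus "qpoch_inf t Q \<le> \<bar>qpoch_inf (q powr (2 * real y + 2 * lam + 2 * k + 2)) Q\<bar>"
        using qpoch_inf_ge(1)[of Q "q powr (2 * real y + 2 * lam + 2 * k + 2)" t] Q t by simp
    qed auto
    have "lam > -1" using lam lam0 by simp
    hence "\<bar>w_dyn y lam k q\<bar> = \<bar>if y = 0 then 1 else (1 - q powr (4 * real y + 2 * lam + 2 * k)) / (1 - q powr (2 * real y + 2 * lam + 2 * k))\<bar>
        * norm (qpoch (q powr (2 * k)) Q y * inverse (qpoch Q Q y))
        * \<bar>qpoch_inf (q powr (2 * real y + 2 * lam + 2)) Q / qpoch_inf (q powr (2 * real y + 2 * lam + 2 * k + 2)) Q\<bar>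
        * q powr (2 * real y * (real y + lam))"
      by (simp add: w_dyn_def w_dyn_gt_def w_front_def Q_def abs_mult divide_inverse del: powr_numeral)
    also have "\<dots> \<le> (C2 * C1) * C3 * q powr (2 * real y * (real y + lam))"
      using front tails C1 pos by (intro mult_right_mono mult_mono) auto
    finally show ?thesis .
  qed
  moreover have "C2 * C1 * C3 > 0" using C1 pos by simp
  ultimately show ?thesis by blast
qed

lemma omega_num_bound:
  assumes q: "0 < q" "q < 1"
  shows "\<exists>C. \<forall>y. norm (omega_num y lam rho K v q) \<le> C"
proof -
  define Q where "Q = cpw q 2"
  have Q: "norm Q < 1" unfolding Q_def norm_cpw using q by (intro powr_less_1) auto
  define E where "E = (\<lambda>u::complex. exp (norm u * q powr (K + lam - rho + 1) / (1 - norm Q)))"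
  have "norm (qpoch_inf (u * cpw q (2 * real y + K + lam - rho + 1)) Q) \<le> E u" for u y
  proof -
    have "norm (u * cpw q (2 * real y + K + lam - rho + 1)) \<le> norm u * q powr (K + lam - rho + 1)"
      unfolding norm_mult norm_cpw using q by (intro mult_left_mono powr_mono') auto
    hence "norm (u * cpw q (2 * real y + K + lam - rho + 1)) / (1 - norm Q) \<le> norm u * q powr (K + lam - rho + 1) / (1 - norm Q)"
      using Q by (intro divide_right_mono) auto
    thus ?thesis using norm_qpoch_inf_le[OF Q, of "u * cpw q (2 * real y + K + lam - rho + 1)"]
      unfolding E_def by (meson exp_le_cancel_iff order_trans)
  qed
  note E = this
  have "norm (omega_num y lam rho K v q) \<le> E v * E (inverse v)" for y
    unfolding omega_num_def Q_def[symmetric] norm_mult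
    by (intro mult_mono E) (auto simp: E_def)
  thus ?thesis by blast
qed

text \<open>The factors q^(-y^2) of the two functions cancel q^(2 y^2) of the weight, and likewise
  the powers with lam and those of |v|; a geometric sequence is left. Both rho and rho' are present
  since the right heights of the two configurations may differ.\<close>

lemma site_bound:
  assumes q: "0 < q" "q < 1" and k: "0 < k" and lam0: "-1 < lam0" and v: "v \<noteq> 0"
  shows "\<exists>C>0. \<forall>lam\<ge>lam0. \<forall>y.
    norm (p_AW y x lam rho v k q * p_AW y x' lam rho' (inverse v) k q * complex_of_real (w_dyn y lam k q))
    \<le> C * (q powr (- (rho + 2 * real x + k) - (rho' + 2 * real x' + k))) ^ y"
proof -
  have iv: "inverse v \<noteq> 0" using v by simp
  obtain C1 where C1: "C1 > 0" "\<And>lam y. lam \<ge> lam0 \<Longrightarrow> norm (p_AW y x lam rho v k q)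
    \<le> C1 * (norm v ^ y * q powr (- real y * (rho + lam + k + 1) - real y * (real y - 1) - 2 * real x * real y))"
    using p_AW_bound[OF q k v] by blast
  obtain C2 where C2: "C2 > 0" "\<And>lam y. lam \<ge> lam0 \<Longrightarrow> norm (p_AW y x' lam rho' (inverse v) k q)
    \<le> C2 * (norm (inverse v) ^ y * q powr (- real y * (rho' + lam + k + 1) - real y * (real y - 1) - 2 * real x' * real y))"
    using p_AW_bound[OF q k iv] by blast
  obtain C3 where C3: "C3 > 0" "\<And>lam y. lam \<ge> lam0 \<Longrightarrow> \<bar>w_dyn y lam k q\<bar> \<le> C3 * q powr (2 * real y * (real y + lam))"
    using w_dyn_bound[OF q k lam0] by blast
  have "norm (p_AW y x lam rho v k q * p_AW y x' lam rho' (inverse v) k q * complex_of_real (w_dyn y lam k q))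
    \<le> C1 * C2 * C3 * (q powr (- (rho + 2 * real x + k) - (rho' + 2 * real x' + k))) ^ y" if lam: "lam \<ge> lam0" for lam y
  proof -
    define A B D where "A = - real y * (rho + lam + k + 1) - real y * (real y - 1) - 2 * real x * real y"
      and "B = - real y * (rho' + lam + k + 1) - real y * (real y - 1) - 2 * real x' * real y"
      and "D = 2 * real y * (real y + lam)"
    have "norm (p_AW y x lam rho v k q * p_AW y x' lam rho' (inverse v) k q * complex_of_real (w_dyn y lam k q))
      \<le> C1 * (norm v ^ y * q powr A) * (C2 * (norm (inverse v) ^ y * q powr B)) * (C3 * q powr D)"
      unfolding norm_mult norm_of_real A_def B_def D_def using C1 C2 C3 lam by (intro mult_mono) auto
    also have "\<dots> = C1 * C2 * C3 * (norm v ^ y * norm (inverse v) ^ y) * (q powr A * q powr B * q powr D)"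
      by (simp only: mult_ac)
    also have "norm v ^ y * norm (inverse v) ^ y = 1"
      using v by (simp add: norm_inverse power_mult_distrib[symmetric])
    also have "q powr A * q powr B * q powr D = (q powr (- (rho + 2 * real x + k) - (rho' + 2 * real x' + k))) ^ y"
      unfolding powr_add[symmetric] powr_power[of q, OF less_imp_neq[OF q(1), symmetric]]
      by (rule arg_cong[where f = "\<lambda>r. q powr r"]) (simp add: A_def B_def D_def algebra_simps)
    finally show ?thesis by simp
  qed
  moreover have "C1 * C2 * C3 > 0" using C1 C2 C3 by simp
  ultimately show ?thesis by blast
qed

lemma summable_on_geometric_PiE:
  fixes r :: "'i \<Rightarrow> real"
  assumes "finite A" "\<And>j. j \<in> A \<Longrightarrow> 0 \<le> r j" "\<And>j. j \<in> A \<Longrightarrow> r j < 1"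
  shows "(\<lambda>\<zeta>. \<Prod>j\<in>A. r j ^ \<zeta> j) summable_on (A \<rightarrow>\<^sub>E UNIV)"
proof -
  have "(\<lambda>n. norm (r j ^ n)) summable_on UNIV" if "j \<in> A" for j
    using assms(2,3)[OF that]
    by (intro norm_summable_imp_summable_on) (simp add: power_abs summable_geometric)
  hence "Infinite_Set_Sum.abs_summable_on (\<lambda>\<zeta>. \<Prod>j\<in>A. r j ^ \<zeta> j) (A \<rightarrow>\<^sub>E UNIV)"
    using assms(1) by (intro abs_summable_on_prod_PiE) (auto simp: abs_summable_equivalent[symmetric])
  thus ?thesis unfolding abs_summable_equivalent[symmetric] by (rule abs_summable_summable)
qed

section \<open>Several sites\<close>

lemma hminus_eq: "hminus k lam \<zeta> M = lam + 2 * real (wt M \<zeta>) + ksum M k"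
  by (simp add: hminus_def wt_def ksum_def sum.distrib sum_distrib_left)

lemma hminus_ge:
  assumes "\<forall>j\<in>{1..M}. 0 < k j" "j \<le> M"
  shows "lam \<le> hminus k lam \<zeta> j"
proof -
  have "0 \<le> (\<Sum>i=1..j. 2 * real (\<zeta> i) + k i)"
    using assms by (intro sum_nonneg) (auto simp: less_imp_le add_nonneg_nonneg)
  thus ?thesis by (simp add: hminus_def)
qed

lemma hplus_top [simp]: "hplus M k rho \<xi> (Suc M) = rho"
  by (simp add: hplus_def)

lemma hplus_step:
  assumes "j \<in> {1..M}"
  shows "hplus M k rho \<xi> j = hplus M k rho \<xi> (j + 1) + 2 * real (\<xi> j) + k j"
proof -
  have "{j..M} = insert j {j + 1..M}" using assms by auto
  thus ?thesis by (simp add: hplus_def)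
qed

lemma hplus_Suc:
  assumes "j \<le> Suc M"
  shows "hplus (Suc M) k rho \<xi> j = hplus M k (rho + 2 * real (\<xi> (Suc M)) + k (Suc M)) \<xi> j"
  using assms by (simp add: hplus_def)

text \<open>Leaving out sites on the left removes only nonnegative terms, so every height is at most
  the full one, which is negative.\<close>

lemma hplus_neg:
  assumes "\<forall>j\<in>{1..M}. 0 < k j" "2 * real (wt M \<xi>) + ksum M k + rho < 0" "1 \<le> j"
  shows "hplus M k rho \<xi> j < 0"
proof -
  have "(\<Sum>i=j..M. 2 * real (\<xi> i) + k i) \<le> (\<Sum>i=1..M. 2 * real (\<xi> i) + k i)"
    using assms(1,3) by (intro sum_mono2) (auto simp: less_imp_le add_nonneg_nonneg)
  also have "\<dots> = 2 * real (wt M \<xi>) + ksum M k"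
    by (simp add: wt_def ksum_def sum.distrib sum_distrib_left)
  finally show ?thesis using assms(2) by (simp add: hplus_def)
qed

lemma wt_Suc [simp]: "wt (Suc M) \<xi> = wt M \<xi> + \<xi> (Suc M)"
  by (simp add: wt_def)

lemma ksum_Suc [simp]: "ksum (Suc M) k = ksum M k + k (Suc M)"
  by (simp add: ksum_def)

lemma P_AW_Suc:
  "P_AW (Suc M) k lam rho v \<zeta> \<xi> q = P_AW M k lam (rho + 2 * real (\<xi> (Suc M)) + k (Suc M)) v \<zeta> \<xi> q
     * p_AW (\<zeta> (Suc M)) (\<xi> (Suc M)) (hminus k lam \<zeta> M) rho v (k (Suc M)) q"
proof -
  have "(\<Prod>j=1..M. p_AW (\<zeta> j) (\<xi> j) (hminus k lam \<zeta> (j - 1)) (hplus (Suc M) k rho \<xi> (j + 1)) v (k j) q)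
      = (\<Prod>j=1..M. p_AW (\<zeta> j) (\<xi> j) (hminus k lam \<zeta> (j - 1)) (hplus M k (rho + 2 * real (\<xi> (Suc M)) + k (Suc M)) \<xi> (j + 1)) v (k j) q)"
    by (intro prod.cong refl) (simp add: hplus_Suc)
  thus ?thesis unfolding P_AW_def by simp
qed

lemma W_L_Suc: "W_L (Suc M) k lam q \<zeta> = W_L M k lam q \<zeta> * w_dyn (\<zeta> (Suc M)) (hminus k lam \<zeta> M) (k (Suc M)) q"
  by (simp add: W_L_def)

lemma W_R_le_Suc:
  "W_R_le (Suc M) k rho q \<xi> = W_R_le M k (rho + 2 * real (\<xi> (Suc M)) + k (Suc M)) q \<xi> * w_dyn_le (\<xi> (Suc M)) rho (k (Suc M)) q"
proof -
  have "(\<Prod>j=1..M. w_dyn_le (\<xi> j) (hplus (Suc M) k rho \<xi> (j + 1)) (k j) q)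
      = (\<Prod>j=1..M. w_dyn_le (\<xi> j) (hplus M k (rho + 2 * real (\<xi> (Suc M)) + k (Suc M)) \<xi> (j + 1)) (k j) q)"
    by (intro prod.cong refl) (simp add: hplus_Suc)
  thus ?thesis unfolding W_R_le_def by simp
qed

lemma hminus_cong: "(\<And>i. i \<in> {1..j} \<Longrightarrow> \<zeta> i = \<zeta>' i) \<Longrightarrow> hminus k lam \<zeta> j = hminus k lam \<zeta>' j"
  unfolding hminus_def by (intro arg_cong2[of _ _ _ _ "(+)"] sum.cong) auto

lemma left_update:
  "P_AW M k lam rho v (\<zeta>(Suc M := y)) \<xi> q = P_AW M k lam rho v \<zeta> \<xi> q"
  "W_L M k lam q (\<zeta>(Suc M := y)) = W_L M k lam q \<zeta>"
  "wt M (\<zeta>(Suc M := y)) = wt M \<zeta>"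
  "hminus k lam (\<zeta>(Suc M := y)) M = hminus k lam \<zeta> M"
proof -
  have h: "hminus k lam (\<zeta>(Suc M := y)) j = hminus k lam \<zeta> j" if "j \<le> M" for j
    using that by (intro hminus_cong) auto
  thus "hminus k lam (\<zeta>(Suc M := y)) M = hminus k lam \<zeta> M" by simp
  have h': "hminus k lam (\<zeta>(Suc M := y)) (j - 1) = hminus k lam \<zeta> (j - 1)" if "j \<in> {1..M}" for j
    using that by (intro h) auto
  show "P_AW M k lam rho v (\<zeta>(Suc M := y)) \<xi> q = P_AW M k lam rho v \<zeta> \<xi> q"
    unfolding P_AW_def by (intro prod.cong refl) (subst h', auto)
  show "W_L M k lam q (\<zeta>(Suc M := y)) = W_L M k lam q \<zeta>"
    unfolding W_L_def by (intro prod.cong refl) (subst h', auto)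
  show "wt M (\<zeta>(Suc M := y)) = wt M \<zeta>"
    unfolding wt_def by (intro sum.cong refl) auto
qed

lemma omega_num_Suc:
  "omega_num (wt M \<zeta> + y) lam rho (ksum M k + k') v q = omega_num y (hminus k lam \<zeta> M) rho k' v q"
proof -
  have "2 * real (wt M \<zeta> + y) + (ksum M k + k') + lam - rho + 1 = 2 * real y + k' + hminus k lam \<zeta> M - rho + 1"
    by (simp add: hminus_eq)
  thus ?thesis by (simp only: omega_num_def)
qed

text \<open>The one-site denominator sees its data only through the left height minus rho + 2 x +
  k', and rho + 2 x + k' is the next right height; this is the numerator exponent for the first M
  sites.\<close>

lemma omega_den_eq_num:
  "omega_den x (hminus k lam \<zeta> M) rho k' v q = omega_num (wt M \<zeta>) lam (rho + 2 * real x + k') (ksum M k) v q"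
proof -
  have "- 2 * real x - k' + hminus k lam \<zeta> M - rho + 1 = 2 * real (wt M \<zeta>) + ksum M k + lam - (rho + 2 * real x + k') + 1"
    by (simp add: hminus_eq)
  thus ?thesis by (simp only: omega_den_def omega_num_def)
qed

lemma omega_den_Suc:
  "omega_den (n + x) lam rho (K + k') v q = omega_den n lam (rho + 2 * real x + k') K v q"
proof -
  have "- 2 * real (n + x) - (K + k') + lam - rho + 1 = - 2 * real n - K + lam - (rho + 2 * real x + k') + 1"
    by simp
  thus ?thesis by (simp only: omega_den_def)
qed

text \<open>
  The heights of the left configuration cancel between the two functions and the weight, so the
  summand is dominated by a product of geometric sequences whose ratios involve only \<open>\<xi>\<close> and \<open>\<xi>'\<close>.
\<close>

lemma multi_site_summable:
  fixes q lam rho :: real and k :: "nat \<Rightarrow> real" and v :: complex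
  assumes q: "0 < q" "q < 1" and k: "\<forall>j\<in>{1..M}. 0 < k j" and lam: "-1 < lam" and v: "v \<noteq> 0"
    and xi: "2 * real (wt M \<xi>) + ksum M k + rho < 0" "2 * real (wt M \<xi>') + ksum M k + rho < 0"
  shows "(\<lambda>\<zeta>. P_AW M k lam rho v \<zeta> \<xi> q * P_AW M k lam rho (inverse v) \<zeta> \<xi>' q
      * complex_of_real (W_L M k lam q \<zeta>) * omega_num (wt M \<zeta>) lam rho (ksum M k) v q) summable_on X_d M"
proof -
  \<comment> \<open>By \<open>hplus_step\<close> this is the ratio in \<open>site_bound\<close> at
    site j; it is less than 1 because both heights are negative.\<close>
  define r where "r = (\<lambda>j. q powr (- hplus M k rho \<xi> j - hplus M k rho \<xi>' j))"
  have r: "0 \<le> r j" "r j < 1" if "j \<in> {1..M}" for j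
    unfolding r_def using that hplus_neg[OF k xi(1), of j] hplus_neg[OF k xi(2), of j]
    by (auto intro!: powr_less_1 q)
  define F where "F = (\<lambda>\<zeta> j. p_AW (\<zeta> j) (\<xi> j) (hminus k lam \<zeta> (j - 1)) (hplus M k rho \<xi> (j + 1)) v (k j) q
       * p_AW (\<zeta> j) (\<xi>' j) (hminus k lam \<zeta> (j - 1)) (hplus M k rho \<xi>' (j + 1)) (inverse v) (k j) q
       * complex_of_real (w_dyn (\<zeta> j) (hminus k lam \<zeta> (j - 1)) (k j) q))"
  have "\<exists>C>0. \<forall>\<zeta>. norm (F \<zeta> j) \<le> C * r j ^ \<zeta> j" if j: "j \<in> {1..M}" for j
  proof -
    have kj: "0 < k j" using k j by auto
    obtain C where C: "C > 0" "\<And>lam' y. lam' \<ge> lam \<Longrightarrow>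
      norm (p_AW y (\<xi> j) lam' (hplus M k rho \<xi> (j + 1)) v (k j) q * p_AW y (\<xi>' j) lam' (hplus M k rho \<xi>' (j + 1)) (inverse v) (k j) q
         * complex_of_real (w_dyn y lam' (k j) q))
      \<le> C * (q powr (- (hplus M k rho \<xi> (j + 1) + 2 * real (\<xi> j) + k j) - (hplus M k rho \<xi>' (j + 1) + 2 * real (\<xi>' j) + k j))) ^ y"
      using site_bound[OF q kj lam v, of "\<xi> j" "hplus M k rho \<xi> (j + 1)" "\<xi>' j" "hplus M k rho \<xi>' (j + 1)"] by blast
    have "lam \<le> hminus k lam \<zeta> (j - 1)" for \<zeta> using j by (intro hminus_ge[OF k]) auto
    hence "norm (F \<zeta> j) \<le> C * r j ^ \<zeta> j" for \<zeta>
      unfolding F_def r_def hplus_step[OF j] by (rule C(2))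
    thus ?thesis using C(1) by blast
  qed
  hence "\<forall>j\<in>{1..M}. \<exists>C. 0 < C \<and> (\<forall>\<zeta>. norm (F \<zeta> j) \<le> C * r j ^ \<zeta> j)" by blast
  then obtain C where C: "\<And>j. j \<in> {1..M} \<Longrightarrow> 0 < C j" "\<And>j \<zeta>. j \<in> {1..M} \<Longrightarrow> norm (F \<zeta> j) \<le> C j * r j ^ \<zeta> j"
    by metis
  obtain D where D: "\<And>y. norm (omega_num y lam rho (ksum M k) v q) \<le> D"
    using omega_num_bound[OF q] by blast
  have bound: "norm (P_AW M k lam rho v \<zeta> \<xi> q * P_AW M k lam rho (inverse v) \<zeta> \<xi>' q
      * complex_of_real (W_L M k lam q \<zeta>) * omega_num (wt M \<zeta>) lam rho (ksum M k) v q)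
      \<le> (\<Prod>j=1..M. C j) * D * (\<Prod>j\<in>{1..M}. r j ^ \<zeta> j)" for \<zeta>
  proof -
    have "P_AW M k lam rho v \<zeta> \<xi> q * P_AW M k lam rho (inverse v) \<zeta> \<xi>' q * complex_of_real (W_L M k lam q \<zeta>)
        = (\<Prod>j=1..M. F \<zeta> j)"
      by (simp add: P_AW_def W_L_def F_def prod.distrib)
    also have "norm \<dots> \<le> (\<Prod>j=1..M. C j * r j ^ \<zeta> j)"
      unfolding prod_norm[symmetric] using C(2) by (intro prod_mono) auto
    also have "\<dots> = (\<Prod>j=1..M. C j) * (\<Prod>j\<in>{1..M}. r j ^ \<zeta> j)" by (simp add: prod.distrib)
    finally have "norm (P_AW M k lam rho v \<zeta> \<xi> q * P_AW M k lam rho (inverse v) \<zeta> \<xi>' q * complex_of_real (W_L M k lam q \<zeta>))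
       \<le> (\<Prod>j=1..M. C j) * (\<Prod>j\<in>{1..M}. r j ^ \<zeta> j)" .
    moreover have "0 \<le> (\<Prod>j=1..M. C j) * (\<Prod>j\<in>{1..M}. r j ^ \<zeta> j)"
      using C(1) r by (intro mult_nonneg_nonneg prod_nonneg) (auto simp: less_imp_le)
    ultimately have "norm (P_AW M k lam rho v \<zeta> \<xi> q * P_AW M k lam rho (inverse v) \<zeta> \<xi>' q * complex_of_real (W_L M k lam q \<zeta>))
         * norm (omega_num (wt M \<zeta>) lam rho (ksum M k) v q)
       \<le> (\<Prod>j=1..M. C j) * (\<Prod>j\<in>{1..M}. r j ^ \<zeta> j) * D"
      using D by (intro mult_mono) auto
    thus ?thesis by (simp add: norm_mult mult_ac)
  qed
  have "(\<lambda>\<zeta>. (\<Prod>j=1..M. C j) * D * (\<Prod>j\<in>{1..M}. r j ^ \<zeta> j)) summable_on X_d M"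
    unfolding X_d_def using r by (intro summable_on_cmult_right summable_on_geometric_PiE) auto
  from abs_summable_summable[OF Infinite_Sum.abs_summable_on_comparison_test'[OF this bound]]
  show ?thesis .
qed

lemma bij_betw_X_d_Suc: "bij_betw (\<lambda>(\<zeta>, y). \<zeta>(Suc M := y)) (X_d M \<times> UNIV) (X_d (Suc M))"
  unfolding bij_betw_def
proof
  show "inj_on (\<lambda>(\<zeta>, y). \<zeta>(Suc M := y)) (X_d M \<times> UNIV)"
    unfolding X_d_def by (rule inj_combinator') simp
  have "X_d (Suc M) = (\<lambda>(y, \<zeta>). \<zeta>(Suc M := y)) ` (UNIV \<times> X_d M)"
  proof -
    have "{1..Suc M} = insert (Suc M) {1..M}" by auto
    thus ?thesis unfolding X_d_def by (simp only: PiE_insert_eq)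
  qed
  thus "(\<lambda>(\<zeta>, y). \<zeta>(Suc M := y)) ` (X_d M \<times> UNIV) = X_d (Suc M)" by (auto simp: image_def)
qed

text \<open>The last site has the fixed right height rho, and its left height involves only the
  other sites of zeta; so for each fixed rest the sum over the last coordinate is a one-site
  relation.\<close>

theorem multi_site_orthogonality:
  fixes q lam rho :: real and k :: "nat \<Rightarrow> real" and v :: complex
  assumes q: "0 < q" "q < 1" and k: "\<forall>j\<in>{1..M}. 0 < k j" and lam: "-1 < lam" and v: "v \<noteq> 0"
    and xi: "2 * real (wt M \<xi>) + ksum M k + rho < 0" "2 * real (wt M \<xi>') + ksum M k + rho < 0"
  shows "((\<lambda>\<zeta>. P_AW M k lam rho v \<zeta> \<xi> q * P_AW M k lam rho (inverse v) \<zeta> \<xi>' q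
      * complex_of_real (W_L M k lam q \<zeta>) * omega_num (wt M \<zeta>) lam rho (ksum M k) v q) has_sum
    (if \<forall>j\<in>{1..M}. \<xi> j = \<xi>' j then omega_den (wt M \<xi>) lam rho (ksum M k) v q / complex_of_real (W_R_le M k rho q \<xi>) else 0))
    (X_d M)"
  using k xi
proof (induction M arbitrary: rho)
  case 0
  have "X_d 0 = {\<lambda>_. undefined}" by (simp add: X_d_def)
  thus ?case
    by (simp add: has_sum_finite_iff P_AW_def W_L_def W_R_le_def omega_num_def omega_den_def wt_def ksum_def)
next
  case (Suc M rho)
  define x x' K where "x = \<xi> (Suc M)" and "x' = \<xi>' (Suc M)" and "K = k (Suc M)"
  define R R' where "R = rho + 2 * real x + K" and "R' = rho + 2 * real x' + K"
  have k: "\<forall>j\<in>{1..M}. 0 < k j" "0 < K" using Suc.prems(1) by (auto simp: K_def)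
  have pos: "0 \<le> 2 * real (wt M \<xi>) + ksum M k" "0 \<le> 2 * real (wt M \<xi>') + ksum M k"
    using k(1) unfolding ksum_def by (intro add_nonneg_nonneg sum_nonneg; simp add: less_imp_le)+
  have x: "2 * real x + K + rho < 0" "2 * real x' + K + rho < 0"
    using Suc.prems(2,3) pos by (simp_all add: x_def x'_def K_def)
  have neg: "2 * real (wt M \<xi>) + ksum M k + R < 0" "2 * real (wt M \<xi>') + ksum M k + R' < 0"
    using Suc.prems(2,3) by (simp_all add: R_def R'_def x_def x'_def K_def)
  define S where "S = (\<lambda>\<zeta>. P_AW (Suc M) k lam rho v \<zeta> \<xi> q * P_AW (Suc M) k lam rho (inverse v) \<zeta> \<xi>' q
      * complex_of_real (W_L (Suc M) k lam q \<zeta>) * omega_num (wt (Suc M) \<zeta>) lam rho (ksum (Suc M) k) v q)"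
  define T where "T = (\<lambda>\<zeta>. P_AW M k lam R v \<zeta> \<xi> q * P_AW M k lam R' (inverse v) \<zeta> \<xi>' q
      * complex_of_real (W_L M k lam q \<zeta>))"
  define G where "G = (\<lambda>\<zeta>. if x = x' then omega_num (wt M \<zeta>) lam R (ksum M k) v q / complex_of_real (w_dyn_le x rho K q) else 0)"
  have S: "S (\<zeta>(Suc M := y)) = T \<zeta> * (p_AW y x (hminus k lam \<zeta> M) rho v K q * p_AW y x' (hminus k lam \<zeta> M) rho (inverse v) K q
        * complex_of_real (w_dyn y (hminus k lam \<zeta> M) K q) * omega_num y (hminus k lam \<zeta> M) rho K v q)" for \<zeta> y
    unfolding S_def T_def P_AW_Suc W_L_Suc wt_Suc ksum_Suc left_update fun_upd_same omega_num_Suc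
      x_def[symmetric] x'_def[symmetric] K_def[symmetric] R_def[symmetric] R'_def[symmetric]
    by (simp only: of_real_mult mult_ac)
  have "S summable_on X_d (Suc M)"
    unfolding S_def by (rule multi_site_summable[OF q Suc.prems(1) lam v Suc.prems(2,3)])
  hence summable: "(\<lambda>(\<zeta>, y). S (\<zeta>(Suc M := y))) summable_on X_d M \<times> UNIV"
    using summable_on_reindex_bij_betw[OF bij_betw_X_d_Suc[of M], of S] by (simp add: case_prod_unfold)
  have inner: "((\<lambda>y. S (\<zeta>(Suc M := y))) has_sum T \<zeta> * G \<zeta>) UNIV" if \<zeta>: "\<zeta> \<in> X_d M" for \<zeta>
  proof -
    have "-1 < hminus k lam \<zeta> M" using hminus_ge[OF k(1) order_refl, of lam \<zeta>] lam by simp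
    from one_site_orthogonality[OF q k(2) this v x]
    have "(\<lambda>y. S (\<zeta>(Suc M := y))) sums (T \<zeta> * G \<zeta>)"
      unfolding S G_def omega_den_eq_num R_def by (rule sums_mult)
    moreover have "(\<lambda>y. S (\<zeta>(Suc M := y))) summable_on UNIV"
      using summable_on_SigmaD1[OF summable \<zeta>] by simp
    \<comment> \<open>The series supplies the value and summability over \<open>UNIV\<close> the
      unconditional convergence.\<close>
    ultimately show ?thesis
      using has_sum_infsum has_sum_imp_sums sums_unique2 by metis
  qed
  have outer: "((\<lambda>\<zeta>. T \<zeta> * G \<zeta>) has_sum
    (if \<forall>j\<in>{1..Suc M}. \<xi> j = \<xi>' j then omega_den (wt (Suc M) \<xi>) lam rho (ksum (Suc M) k) v q
       / complex_of_real (W_R_le (Suc M) k rho q \<xi>) else 0)) (X_d M)"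
  proof (cases "x = x'")
    \<comment> \<open>The first M sites now see different boundary heights R and R', so the
      induction hypothesis does not apply; instead the inner sum vanishes for every rest.\<close>
    case False
    hence "\<not> (\<forall>j\<in>{1..Suc M}. \<xi> j = \<xi>' j)" by (auto simp: x_def x'_def)
    note ne = if_not_P[OF this]
    show ?thesis unfolding ne using False by (intro has_sum_0) (simp add: G_def)
  next
    case True
    hence R': "R' = R" by (simp add: R_def R'_def)
    have iff: "(\<forall>j\<in>{1..Suc M}. \<xi> j = \<xi>' j) \<longleftrightarrow> (\<forall>j\<in>{1..M}. \<xi> j = \<xi>' j)"
      using True by (auto simp: x_def x'_def le_Suc_eq)
    have den: "omega_den (wt (Suc M) \<xi>) lam rho (ksum (Suc M) k) v q = omega_den (wt M \<xi>) lam R (ksum M k) v q"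
      unfolding wt_Suc ksum_Suc omega_den_Suc R_def x_def K_def ..
    have W: "W_R_le (Suc M) k rho q \<xi> = W_R_le M k R q \<xi> * w_dyn_le x rho K q"
      unfolding W_R_le_Suc R_def x_def K_def ..
    have val: "(if E then n / (w * w') else 0) = (if E then n / w else 0) * inverse w'" for E and n w w' :: complex
      by (simp add: divide_inverse mult.assoc)
    have TG: "T \<zeta> * G \<zeta> = P_AW M k lam R v \<zeta> \<xi> q * P_AW M k lam R (inverse v) \<zeta> \<xi>' q
        * complex_of_real (W_L M k lam q \<zeta>) * omega_num (wt M \<zeta>) lam R (ksum M k) v q * inverse (complex_of_real (w_dyn_le x rho K q))" for \<zeta>
      by (simp add: T_def G_def R' True divide_inverse mult.assoc)
    show ?thesis
      unfolding iff den W of_real_mult val TG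
      by (intro has_sum_cmult_left Suc.IH[OF k(1) neg(1) neg(2)[unfolded R']])
  qed
  have "((\<lambda>(\<zeta>, y). S (\<zeta>(Suc M := y))) has_sum
    (if \<forall>j\<in>{1..Suc M}. \<xi> j = \<xi>' j then omega_den (wt (Suc M) \<xi>) lam rho (ksum (Suc M) k) v q
       / complex_of_real (W_R_le (Suc M) k rho q \<xi>) else 0)) (X_d M \<times> UNIV)"
    using inner outer summable by (intro has_sum_SigmaI[where g = "\<lambda>\<zeta>. T \<zeta> * G \<zeta>"]) auto
  thus ?case
    using has_sum_reindex_bij_betw[OF bij_betw_X_d_Suc[of M], of S] by (simp add: S_def case_prod_unfold)
qed

section \<open>Reversing the lattice and inverting the base\<close>

text \<open>Restriction to the sites keeps the result extensional, hence in \<open>X_d\<close>, on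
  which the map is an involution.\<close>

definition rev_sites :: "nat \<Rightarrow> (nat \<Rightarrow> nat) \<Rightarrow> nat \<Rightarrow> nat" where
  "rev_sites M \<xi> = (\<lambda>j\<in>{1..M}. \<xi> (M + 1 - j))"

lemma sum_rev_sites:
  fixes M :: nat
  shows "(\<Sum>j=1..M. f (M + 1 - j)) = (\<Sum>j=1..M. f j :: 'a::comm_monoid_add)"
  by (rule sum.reindex_bij_witness[of _ "\<lambda>j. M + 1 - j" "\<lambda>j. M + 1 - j"]) auto

lemma prod_rev_sites:
  fixes M :: nat
  shows "(\<Prod>j=1..M. f (M + 1 - j)) = (\<Prod>j=1..M. f j :: 'a::comm_monoid_mult)"
  by (rule prod.reindex_bij_witness[of _ "\<lambda>j. M + 1 - j" "\<lambda>j. M + 1 - j"]) auto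

lemma bij_betw_rev_sites: "bij_betw (rev_sites M) (X_d M) (X_d M)"
  by (rule bij_betw_byWitness[of _ "rev_sites M"])
    (auto simp: rev_sites_def X_d_def PiE_iff extensional_def fun_eq_iff)

lemma rev_sites_eq_iff:
  assumes "\<zeta> \<in> X_d M" "\<zeta>' \<in> X_d M"
  shows "(\<forall>j\<in>{1..M}. rev_sites M \<zeta> j = rev_sites M \<zeta>' j) \<longleftrightarrow> \<zeta> = \<zeta>'"
proof
  assume "\<forall>j\<in>{1..M}. rev_sites M \<zeta> j = rev_sites M \<zeta>' j"
  hence "rev_sites M \<zeta> = rev_sites M \<zeta>'" by (auto simp: rev_sites_def fun_eq_iff)
  thus "\<zeta> = \<zeta>'" using assms bij_betw_rev_sites[of M] by (auto simp: bij_betw_def inj_on_def)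
qed simp

lemma wt_rev_sites: "wt M (rev_sites M \<xi>) = wt M \<xi>"
  using sum_rev_sites[of \<xi> M] by (simp add: wt_def rev_sites_def)

lemma ksum_rev_sites: "ksum M (\<lambda>j. k (M + 1 - j)) = ksum M k"
  unfolding ksum_def by (rule sum_rev_sites)

lemma hminus_rev_sites:
  assumes "j \<in> {1..M}"
  shows "hminus (\<lambda>j. k (M + 1 - j)) rho (rev_sites M \<xi>) (j - 1) = hplus M k rho \<xi> (M + 1 - j + 1)"
proof -
  have "(\<Sum>i=1..j - 1. 2 * real (rev_sites M \<xi> i) + k (M + 1 - i)) = (\<Sum>i=M + 1 - j + 1..M. 2 * real (\<xi> i) + k i)"
    using assms by (intro sum.reindex_bij_witness[of _ "\<lambda>i. M + 1 - i" "\<lambda>i. M + 1 - i"]) (auto simp: rev_sites_def)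
  thus ?thesis by (simp add: hminus_def hplus_def)
qed

lemma hplus_rev_sites:
  assumes "j \<in> {1..M}"
  shows "hplus M (\<lambda>j. k (M + 1 - j)) lam (rev_sites M \<zeta>) (j + 1) = hminus k lam \<zeta> (M + 1 - j - 1)"
proof -
  have "(\<Sum>i=j + 1..M. 2 * real (rev_sites M \<zeta> i) + k (M + 1 - i)) = (\<Sum>i=1..M + 1 - j - 1. 2 * real (\<zeta> i) + k i)"
    using assms by (intro sum.reindex_bij_witness[of _ "\<lambda>i. M + 1 - i" "\<lambda>i. M + 1 - i"]) (auto simp: rev_sites_def)
  thus ?thesis by (simp add: hminus_def hplus_def)
qed

text \<open>Duality at each site exchanges zeta and xi, and with them the heights, which then
  accumulate from the opposite ends; reversing the lattice restores the shape of \<open>P_AW\<close>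
  with lam and rho exchanged.\<close>

lemma P_AW_inverse_base:
  assumes q: "q > 0" "q \<noteq> 1" and k: "\<forall>j\<in>{1..M}. 0 < k j" and v: "v \<noteq> 0"
  shows "P_AW M k lam rho v \<zeta> \<xi> (inverse q)
    = P_AW M (\<lambda>j. k (M + 1 - j)) rho lam v (rev_sites M \<xi>) (rev_sites M \<zeta>) q"
proof -
  have "P_AW M k lam rho v \<zeta> \<xi> (inverse q)
     = (\<Prod>j=1..M. p_AW (\<xi> j) (\<zeta> j) (hplus M k rho \<xi> (j + 1)) (hminus k lam \<zeta> (j - 1)) v (k j) q)"
    unfolding P_AW_def using k by (intro prod.cong refl p_AW_inverse_base q v) auto
  also have "\<dots> = (\<Prod>j=1..M. p_AW (\<xi> (M + 1 - j)) (\<zeta> (M + 1 - j)) (hplus M k rho \<xi> (M + 1 - j + 1))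
      (hminus k lam \<zeta> (M + 1 - j - 1)) v (k (M + 1 - j)) q)"
    by (rule prod_rev_sites[symmetric])
  also have "\<dots> = P_AW M (\<lambda>j. k (M + 1 - j)) rho lam v (rev_sites M \<xi>) (rev_sites M \<zeta>) q"
    unfolding P_AW_def
  proof (intro prod.cong refl)
    fix j assume j: "j \<in> {1..M}"
    show "p_AW (\<xi> (M + 1 - j)) (\<zeta> (M + 1 - j)) (hplus M k rho \<xi> (M + 1 - j + 1))
      (hminus k lam \<zeta> (M + 1 - j - 1)) v (k (M + 1 - j)) q
     = p_AW (rev_sites M \<xi> j) (rev_sites M \<zeta> j) (hminus (\<lambda>j. k (M + 1 - j)) rho (rev_sites M \<xi>) (j - 1))
      (hplus M (\<lambda>j. k (M + 1 - j)) lam (rev_sites M \<zeta>) (j + 1)) v (k (M + 1 - j)) q"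
      unfolding hminus_rev_sites[OF j] hplus_rev_sites[OF j] using j by (simp add: rev_sites_def)
  qed
  finally show ?thesis .
qed

lemma W_R_rev_sites: "W_R M k rho q \<xi> = W_L M (\<lambda>j. k (M + 1 - j)) rho q (rev_sites M \<xi>)"
proof -
  have "W_R M k rho q \<xi> = (\<Prod>j=1..M. w_dyn (\<xi> (M + 1 - j)) (hplus M k rho \<xi> (M + 1 - j + 1)) (k (M + 1 - j)) q)"
    unfolding W_R_def by (rule prod_rev_sites[symmetric])
  also have "\<dots> = W_L M (\<lambda>j. k (M + 1 - j)) rho q (rev_sites M \<xi>)"
    unfolding W_L_def
  proof (intro prod.cong refl)
    fix j assume j: "j \<in> {1..M}"
    show "w_dyn (\<xi> (M + 1 - j)) (hplus M k rho \<xi> (M + 1 - j + 1)) (k (M + 1 - j)) q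
     = w_dyn (rev_sites M \<xi> j) (hminus (\<lambda>j. k (M + 1 - j)) rho (rev_sites M \<xi>) (j - 1)) (k (M + 1 - j)) q"
      unfolding hminus_rev_sites[OF j] using j by (simp add: rev_sites_def)
  qed
  finally show ?thesis .
qed

lemma W_L_le_rev_sites: "W_L_le M k lam q \<zeta> = W_R_le M (\<lambda>j. k (M + 1 - j)) lam q (rev_sites M \<zeta>)"
proof -
  have "W_L_le M k lam q \<zeta> = (\<Prod>j=1..M. w_dyn_le (\<zeta> (M + 1 - j)) (hminus k lam \<zeta> (M + 1 - j - 1)) (k (M + 1 - j)) q)"
    unfolding W_L_le_def by (rule prod_rev_sites[symmetric])
  also have "\<dots> = W_R_le M (\<lambda>j. k (M + 1 - j)) lam q (rev_sites M \<zeta>)"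
    unfolding W_R_le_def
  proof (intro prod.cong refl)
    fix j assume j: "j \<in> {1..M}"
    show "w_dyn_le (\<zeta> (M + 1 - j)) (hminus k lam \<zeta> (M + 1 - j - 1)) (k (M + 1 - j)) q
     = w_dyn_le (rev_sites M \<zeta> j) (hplus M (\<lambda>j. k (M + 1 - j)) lam (rev_sites M \<zeta>) (j + 1)) (k (M + 1 - j)) q"
      unfolding hplus_rev_sites[OF j] using j by (simp add: rev_sites_def)
  qed
  finally show ?thesis .
qed

lemma omega_inverse:
  "omega_num y lam rho K (inverse v) q = omega_num y lam rho K v q"
  "omega_den x lam rho K (inverse v) q = omega_den x lam rho K v q"
  by (simp_all add: omega_num_def omega_den_def mult.commute)

lemma W_R_eq_le:
  assumes "\<forall>j\<in>{1..M}. hplus M k rho \<xi> (j + 1) \<le> -1"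
  shows "W_R M k rho q \<xi> = W_R_le M k rho q \<xi>"
  unfolding W_R_def W_R_le_def using assms by (intro prod.cong refl) (force simp: w_dyn_def)

lemma W_L_eq_le:
  assumes "\<forall>j\<in>{1..M}. hminus k lam \<zeta> (j - 1) \<le> -1"
  shows "W_L M k lam q \<zeta> = W_L_le M k lam q \<zeta>"
  unfolding W_L_def W_L_le_def using assms by (intro prod.cong refl) (force simp: w_dyn_def)

text \<open>The denominator of omega is a nonzero constant in the sum over zeta, so one division
  suffices.\<close>

lemma left_orthogonality:
  fixes q lam rho :: real and k :: "nat \<Rightarrow> real" and v :: complex
  assumes q: "0 < q" "q < 1" and k: "\<forall>j\<in>{1..M}. 0 < k j" and lam: "-1 < lam" and v: "v \<noteq> 0"
    and xi: "\<xi> \<in> X_da M k rho" "\<xi>' \<in> X_da M k rho"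
    and den: "omega_den (wt M \<xi>) lam rho (ksum M k) v q \<noteq> 0"
  shows "((\<lambda>\<zeta>. P_AW M k lam rho v \<zeta> \<xi> q * P_AW M k lam rho (inverse v) \<zeta> \<xi>' q
      * complex_of_real (W_L M k lam q \<zeta>) * omega_AW (wt M \<zeta>) (wt M \<xi>) lam rho (ksum M k) v q) has_sum
    (if \<xi> = \<xi>' then 1 else 0) / complex_of_real (W_R_le M k rho q \<xi>)) (X_d M)"
proof -
  define D where "D = omega_den (wt M \<xi>) lam rho (ksum M k) v q"
  have iff: "(\<forall>j\<in>{1..M}. \<xi> j = \<xi>' j) \<longleftrightarrow> \<xi> = \<xi>'"
    using xi by (auto simp: X_da_def X_d_def intro: PiE_ext)
  have "2 * real (wt M \<xi>) + ksum M k + rho < 0" "2 * real (wt M \<xi>') + ksum M k + rho < 0"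
    using xi by (auto simp: X_da_def)
  from has_sum_cmult_left[OF multi_site_orthogonality[OF q k lam v this, unfolded iff], of "inverse D"]
  have "((\<lambda>\<zeta>. P_AW M k lam rho v \<zeta> \<xi> q * P_AW M k lam rho (inverse v) \<zeta> \<xi>' q
      * complex_of_real (W_L M k lam q \<zeta>) * (omega_num (wt M \<zeta>) lam rho (ksum M k) v q * inverse D)) has_sum
    (if \<xi> = \<xi>' then D / complex_of_real (W_R_le M k rho q \<xi>) else 0) * inverse D) (X_d M)"
    by (simp only: D_def mult.assoc)
  moreover have "(if \<xi> = \<xi>' then D / complex_of_real (W_R_le M k rho q \<xi>) else 0) * inverse D
     = (if \<xi> = \<xi>' then 1 else 0) / complex_of_real (W_R_le M k rho q \<xi>)"
  proof -
    have "D \<noteq> 0" using den by (simp add: D_def)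
    thus ?thesis by simp
  qed
  ultimately show ?thesis
    unfolding omega_AW_def divide_inverse[of "omega_num _ _ _ _ _ _"] D_def[symmetric] by simp
qed

text \<open>The left relation on the reversed lattice is used with 1/v: there the configuration
  paired with the given parameter also enters omega, and here that configuration is zeta, paired
  with 1/v. Numerator and denominator of omega are symmetric under inversion of v.\<close>

lemma right_orthogonality:
  fixes q lam rho :: real and k :: "nat \<Rightarrow> real" and v :: complex
  assumes q: "0 < q" "q < 1" and k: "\<forall>j\<in>{1..M}. 0 < k j" and rho: "-1 < rho" and v: "v \<noteq> 0"
    and zeta: "\<zeta> \<in> X_da M k lam" "\<zeta>' \<in> X_da M k lam"
    and den: "omega_den (wt M \<zeta>) rho lam (ksum M k) v q \<noteq> 0"
  shows "((\<lambda>\<xi>. P_AW M k lam rho v \<zeta>' \<xi> (inverse q) * P_AW M k lam rho (inverse v) \<zeta> \<xi> (inverse q)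
      * complex_of_real (W_R M k rho q \<xi>) * omega_AW (wt M \<xi>) (wt M \<zeta>) rho lam (ksum M k) v q) has_sum
    (if \<zeta> = \<zeta>' then 1 else 0) / complex_of_real (W_L_le M k lam q \<zeta>)) (X_d M)"
proof -
  let ?k = "\<lambda>j. k (M + 1 - j)"
  have iv: "inverse v \<noteq> 0" using v by simp
  have q1: "q \<noteq> 1" using q by simp
  have k': "\<forall>j\<in>{1..M}. 0 < ?k j"
  proof
    fix j assume "j \<in> {1..M}"
    hence "M + 1 - j \<in> {1..M}" by auto
    thus "0 < ?k j" using k by blast
  qed
  have X: "\<zeta> \<in> X_d M" "\<zeta>' \<in> X_d M" using zeta by (auto simp: X_da_def)
  have mem: "rev_sites M \<eta> \<in> X_da M ?k lam" if "\<eta> \<in> X_da M k lam" for \<eta>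
    using that bij_betw_rev_sites[of M] unfolding X_da_def mem_Collect_eq wt_rev_sites ksum_rev_sites
    by (auto simp: bij_betw_def)
  have eq: "rev_sites M \<zeta> = rev_sites M \<zeta>' \<longleftrightarrow> \<zeta> = \<zeta>'"
    using rev_sites_eq_iff[OF X] by auto
  have den': "omega_den (wt M (rev_sites M \<zeta>)) rho lam (ksum M ?k) (inverse v) q \<noteq> 0"
    using den unfolding wt_rev_sites ksum_rev_sites omega_inverse .
  define S where "S = (\<lambda>\<eta>. P_AW M ?k rho lam (inverse v) \<eta> (rev_sites M \<zeta>) q * P_AW M ?k rho lam v \<eta> (rev_sites M \<zeta>') q
      * complex_of_real (W_L M ?k rho q \<eta>) * omega_AW (wt M \<eta>) (wt M \<zeta>) rho lam (ksum M k) v q)"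
  have "(S has_sum (if \<zeta> = \<zeta>' then 1 else 0) / complex_of_real (W_L_le M k lam q \<zeta>)) (X_d M)"
    using left_orthogonality[OF q k' rho iv mem[OF zeta(1)] mem[OF zeta(2)] den']
    unfolding S_def W_L_le_rev_sites eq wt_rev_sites ksum_rev_sites omega_AW_def omega_inverse inverse_inverse_eq .
  hence "((\<lambda>\<xi>. S (rev_sites M \<xi>)) has_sum (if \<zeta> = \<zeta>' then 1 else 0) / complex_of_real (W_L_le M k lam q \<zeta>)) (X_d M)"
    unfolding has_sum_reindex_bij_betw[OF bij_betw_rev_sites] .
  moreover have "S (rev_sites M \<xi>) = P_AW M k lam rho v \<zeta>' \<xi> (inverse q) * P_AW M k lam rho (inverse v) \<zeta> \<xi> (inverse q)
      * complex_of_real (W_R M k rho q \<xi>) * omega_AW (wt M \<xi>) (wt M \<zeta>) rho lam (ksum M k) v q" for \<xi>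
    unfolding S_def P_AW_inverse_base[OF q(1) q1 k v] P_AW_inverse_base[OF q(1) q1 k iv] W_R_rev_sites wt_rev_sites
    by (simp only: mult_ac)
  ultimately show ?thesis by simp
qed

text \<open>Off the diagonal both right-hand sides are 0. On it the condition on the heights puts
  every factor of \<open>W_R\<close> or \<open>W_L\<close> on the second branch, so that it equals
  the variant for which the relation is proved.\<close>

theorem theorem2p18:
  fixes q lam rho :: real and M :: nat and k :: "nat \<Rightarrow> real" and v :: complex
  assumes "0 < q" "q < 1" and "\<forall>j\<in>{1..M}. 0 < k j" and "v \<noteq> 0"
  shows
    "(lam > -1 \<and> rho \<le> -1 \<longrightarrow>
       (\<forall>\<xi>\<in>X_da M k rho. \<forall>\<xi>'\<in>X_da M k rho. omega_den (wt M \<xi>) lam rho (ksum M k) v q \<noteq> 0 \<longrightarrow>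
          (let S = (\<lambda>\<zeta>. P_AW M k lam rho v \<zeta> \<xi> q * P_AW M k lam rho (inverse v) \<zeta> \<xi>' q
                       * complex_of_real (W_L M k lam q \<zeta>)
                       * omega_AW (wt M \<zeta>) (wt M \<xi>) lam rho (ksum M k) v q)
           in ((\<xi> = \<xi>' \<longrightarrow> (\<forall>j\<in>{1..M}. hplus M k rho \<xi> (j + 1) \<le> -1)) \<longrightarrow>
                 (S has_sum (if \<xi> = \<xi>' then 1 else 0) / complex_of_real (W_R M k rho q \<xi>)) (X_d M))
            \<and> (S has_sum (if \<xi> = \<xi>' then 1 else 0) / complex_of_real (W_R_le M k rho q \<xi>)) (X_d M)))) \<and>
     (lam \<le> -1 \<and> rho > -1 \<longrightarrow>
       (\<forall>\<zeta>\<in>X_da M k lam. \<forall>\<zeta>'\<in>X_da M k lam. omega_den (wt M \<zeta>) rho lam (ksum M k) v q \<noteq> 0 \<longrightarrow>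
          (let S = (\<lambda>\<xi>. P_AW M k lam rho v \<zeta>' \<xi> (inverse q) * P_AW M k lam rho (inverse v) \<zeta> \<xi> (inverse q)
                       * complex_of_real (W_R M k rho q \<xi>)
                       * omega_AW (wt M \<xi>) (wt M \<zeta>) rho lam (ksum M k) v q)
           in ((\<zeta> = \<zeta>' \<longrightarrow> (\<forall>j\<in>{1..M}. hminus k lam \<zeta> (j - 1) \<le> -1)) \<longrightarrow>
                 (S has_sum (if \<zeta> = \<zeta>' then 1 else 0) / complex_of_real (W_L M k lam q \<zeta>)) (X_d M))
            \<and> (S has_sum (if \<zeta> = \<zeta>' then 1 else 0) / complex_of_real (W_L_le M k lam q \<zeta>)) (X_d M))))"
proof -
  have R: "(if \<xi> = \<xi>' then 1 else 0) / complex_of_real (W_R M k rho q \<xi>)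
      = (if \<xi> = \<xi>' then 1 else 0) / complex_of_real (W_R_le M k rho q \<xi>)"
    if "\<xi> = \<xi>' \<longrightarrow> (\<forall>j\<in>{1..M}. hplus M k rho \<xi> (j + 1) \<le> -1)" for \<xi> \<xi>'
    using that W_R_eq_le[of M k rho \<xi> q] by auto
  have L: "(if \<zeta> = \<zeta>' then 1 else 0) / complex_of_real (W_L M k lam q \<zeta>)
      = (if \<zeta> = \<zeta>' then 1 else 0) / complex_of_real (W_L_le M k lam q \<zeta>)"
    if "\<zeta> = \<zeta>' \<longrightarrow> (\<forall>j\<in>{1..M}. hminus k lam \<zeta> (j - 1) \<le> -1)" for \<zeta> \<zeta>'
    using that W_L_eq_le[of M k lam \<zeta> q] by auto
  show ?thesis
    unfolding Let_def
    by (intro conjI impI ballI; (subst R L, assumption)?; elim conjE;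
        rule left_orthogonality[OF assms(1-3) _ assms(4)] right_orthogonality[OF assms(1-3) _ assms(4)]; assumption)
qed

end
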